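(* Let $\Delta$ be a masure and let $G\le\mathrm{Aut}(\Delta)$ be a group of vectorially Weyl automorphisms. Then the following conditions are equivalent: \begin{enumerate} \item[(i)] $G$ is strongly transitive on $\Delta$; \item[(ii)] every local chamber of $\Delta$ is $G$-friendly; \item[(iii)] every sector-germ of $\Delta$ is $G$-friendly. \end{enumerate}
   Context: \emph{Model apartment.} Let $V$ be a finite-dimensional real vector space, $I$ a nonempty finite set, $(\alpha_i)_{i\in I}$ a linearly independent family in $V^*$, $(\alpha_i^\vee)_{i\in I}$ a family in $V$ such that $(\alpha_j(\alpha_i^\vee))_{i,j}$ is a (possibly decomposable) generalized Cartan matrix. Put $r_i(v)=v-\alpha_i(v)\alpha_i^\vee$, $S=\{r_i\}_{i\in I}$, $W^v=\langle S\rangle\subset GL(V)$ (a Coxeter group), $\Phi=\{w\alpha_i\}$ (real roots; for $\alpha=w\alpha_i$, $\alpha^\vee=w\alpha_i^\vee$, $r_\alpha=wr_iw^{-1}$), $\Phi_{im}$ = imaginary roots of the associated Kac--Moody algebra. For $J\subset I$ (identified with a subset of $S$): $W^v(J)=\langle r_i: i\in J\rangle$ and $F^v(J)=\{v:\alpha_i(v)=0\ (i\in J),\ \alpha_i(v)>0\ (i\notin J)\}$; $C^v_f=F^v(\emptyset)$. Vectorial faces of sign $\pm$ and type $J$ are the $\pm wF^v(J)$, $w\in W^v$; chambers: $J=\emptyset$; $J$ and the face are spherical if $W^v(J)$ is finite. $\mathcal T$ (resp. $\mathcal T^\circ$) is the union of positive (resp. positive spherical) faces. The model apartment $\mathbb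 A$ is $V$ as an affine space with walls $M(\alpha,k)=\{v:\alpha(v)+k=0\}$, $\alpha\in\Phi$, $k\in\Lambda_\alpha$, where $0\in\Lambda_\alpha\subset\mathbb R$ is infinite; put $\Lambda_\alpha=\mathbb R$ for $\alpha\in\Phi_{im}$. $D(\alpha,k)=\{v:\alpha(v)+k\ge0\}$. $W^a$ is generated by the affine reflections in the walls $M(\alpha,k)$ with linear part $r_\alpha$, and is assumed to permute the walls. $\mathrm{Aut}(\mathbb A)$: affine bijections permuting the pairs ($M(\alpha,k)$ a wall, $\alpha^\vee$). $x\le y$ iff $y-x\in\mathcal T$; $x\overset{\circ}{<}y$ iff $y-x\in\mathcal T^\circ$. \emph{Filters.} Subsets are identified with the filter of their supersets; a set contains a filter if it is a member of it; a map fixes a filter pointwise if it fixes pointwise some member of it. The enclosure $cl_{\mathbb A}(F)$ of a filter $F$ consists of the sets containing some member of $F$ of the form $\bigcap_{\alpha\in\Phi\cup\Phi_{im}}D(\alpha,k_\alpha)$, $k_\alpha\in\Lambda_\alpha\cup\{\infty\}$. The support of $F$ is the smallest affine subspace containing it. Local face: $F^\ell(x,F^v)=\mathrm{germ}_x(x+F^v)$ (local chamber if $F^v$ is a chamber); closed face: enclosure of a local face. Sector-face: $x+F^v$ (base point $x$, direction $F^v$); its shortenings are $x+\xi+F^v$, $\xi\in F^v$; its germ is the filter of sets containing a shortening; sector: $F^v$ a chamber; sector-germ: germ of a sector. Chimney: $\mathfrak r(F,F^v)=cl_{\mathbb A}(F+F^v)$, $F$ a local face; splayed if $F^v$ is spherical,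 solid if the direction of its support has finite pointwise stabilizer in $W^v$; its germ is the filter of sets containing some $\mathfrak r(F+\xi,F^v)$, $\xi\in F^v$. A ray or segment from $x$ through $y\ne x$ is preordered if $x\le y$ or $y\le x$, generic if $x\overset{\circ}{<}y$ or $y\overset{\circ}{<}x$. \emph{Masures.} An apartment is a set $A$ with a set $Isom^w(\mathbb A,A)$ of bijections of the form $\{f_0\circ w: w\in W^a\}$. A bijection $\varphi:A\to A'$ of apartments is an isomorphism (resp. Weyl, resp. vectorially Weyl) if $f'^{-1}\varphi f$ lies in $\mathrm{Aut}(\mathbb A)$ (resp. $W^a$, resp. $(W^v\ltimes V)\cap\mathrm{Aut}(\mathbb A)$) for $f\in Isom^w(\mathbb A,A)$, $f'\in Isom^w(\mathbb A,A')$. All notions transfer from $\mathbb A$ to apartments. A masure $(\Delta,\mathcal A)$ is a set $\Delta$ covered by a family $\mathcal A$ of subsets (apartments) with: (MA1) each $A\in\mathcal A$ has a structure of apartment; (MA2) if $F$ is a point, germ of preordered interval, generic ray or solid chimney in $A$ and $A'$ is another apartment containing $F$, then $A\cap A'\supset cl_A(F)$ and some Weyl-isomorphism $A\to A'$ fixes $cl_A(F)$ pointwise; (MA3) if $\mathfrak R$ is the germ of a splayed chimney and $F$ a closed face or germ of a solid chimney, some apartment contains $\mathfrak R$ and $F$; (MA4) if $A,A'$ both contain $\mathfrak R,F$ as in (MA3), then $A\cap A'\supset cl_A(\mathfrak R\cup F)$ and some Weyl-isomorphism $A\to A'$ fixes $cl_A(\mathfrak R\cup F)$ pointwise; (MAO)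 if $x,y\in A\cap A'$ and $x\le_A y$, then $[x,y]_A=[x,y]_{A'}$. $\mathrm{Aut}(\Delta)$: bijections $\varphi$ of $\Delta$ permuting $\mathcal A$ such that each $\varphi|_A:A\to\varphi(A)$ is an isomorphism; $\varphi$ is vectorially Weyl if all $\varphi|_A$ are. \emph{Strong transitivity, friendliness.} $G$ acts strongly transitively on $\Delta$ if every isomorphism whose existence is asserted in (MA2) and (MA4) may be chosen to be the restriction of an element of $G$. A subset or filter $\Omega$ of an apartment is $G$-friendly if for any two apartments $A,A'$ containing $\Omega$ there is $g\in G$ fixing $\Omega$ pointwise such that $A'=g(A)$ and $g|_A:A\to A'$ is a Weyl-isomorphism. *)

theory Defs
  imports "HOL-Analysis.Analysis" "HOL-Combinatorics.Permutations"
begin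

section \<open>Root data and Kac--Moody algebras\<close>

text \<open>The group generated by a set of bijections of a type.\<close>

inductive_set generated :: "('a \<Rightarrow> 'a) set \<Rightarrow> ('a \<Rightarrow> 'a) set" for S where
  gen_id: "id \<in> generated S"
| gen_base: "s \<in> S \<Longrightarrow> s \<in> generated S"
| gen_inv: "g \<in> generated S \<Longrightarrow> inv g \<in> generated S"
| gen_comp: "g \<in> generated S \<Longrightarrow> h \<in> generated S \<Longrightarrow> g \<circ> h \<in> generated S"

text \<open>The index set \<open>I\<close> is the finite type \<open>'i\<close>, the vector space \<open>V\<close> is the type \<open>'v\<close> (its inner product
  plays no role), and linear forms on \<open>V\<close> are linear functions \<open>'v \<Rightarrow> real\<close>.  The last four fields
  describe a Kac--Moody algebra on the type \<open>'g\<close>: its bracket, the embedding of the Cartan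
  subalgebra \<open>V\<close>, and the Chevalley generators.\<close>

record ('i, 'v, 'g) apartment_data =
  sroot :: "'i \<Rightarrow> 'v \<Rightarrow> real"
  scoroot :: "'i \<Rightarrow> 'v"
  Lam :: "('v \<Rightarrow> real) \<Rightarrow> real set"
  bracket :: "'g \<Rightarrow> 'g \<Rightarrow> 'g"
  cartan :: "'v \<Rightarrow> 'g"
  egen :: "'i \<Rightarrow> 'g"
  fgen :: "'i \<Rightarrow> 'g"

definition generalized_cartan_matrix :: "('i \<Rightarrow> 'i \<Rightarrow> real) \<Rightarrow> bool" where
  "generalized_cartan_matrix a \<longleftrightarrow>
     (\<forall>i j. a i j \<in> \<int>) \<and> (\<forall>i. a i i = 2) \<and>
     (\<forall>i j. i \<noteq> j \<longrightarrow> a i j \<le> 0) \<and> (\<forall>i j. a i j = 0 \<longrightarrow> a j i = 0)"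

definition cartan_matrix :: "('i, 'v, 'g) apartment_data \<Rightarrow> 'i \<Rightarrow> 'i \<Rightarrow> real" where
  "cartan_matrix M i j = sroot M j (scoroot M i)"

definition root_datum :: "('i::finite, 'v::euclidean_space, 'g) apartment_data \<Rightarrow> bool" where
  "root_datum M \<longleftrightarrow>
     (\<forall>i. linear (sroot M i)) \<and>
     (\<forall>c. (\<forall>v. (\<Sum>i\<in>UNIV. c i * sroot M i v) = 0) \<longrightarrow> (\<forall>i. c i = 0)) \<and>
     generalized_cartan_matrix (cartan_matrix M)"

definition lie_algebra :: "('g::real_vector \<Rightarrow> 'g \<Rightarrow> 'g) \<Rightarrow> bool" where
  "lie_algebra b \<longleftrightarrow> bilinear b \<and> (\<forall>x. b x x = 0) \<and>
     (\<forall>x y z. b x (b y z) + b y (b z x) + b z (b x y) = 0)"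

definition lie_subalgebra :: "('g::real_vector \<Rightarrow> 'g \<Rightarrow> 'g) \<Rightarrow> 'g set \<Rightarrow> bool" where
  "lie_subalgebra b N \<longleftrightarrow> subspace N \<and> (\<forall>x\<in>N. \<forall>y\<in>N. b x y \<in> N)"

definition lie_ideal :: "('g::real_vector \<Rightarrow> 'g \<Rightarrow> 'g) \<Rightarrow> 'g set \<Rightarrow> bool" where
  "lie_ideal b N \<longleftrightarrow> subspace N \<and> (\<forall>x. \<forall>y\<in>N. b x y \<in> N)"

text \<open>The Kac--Moody algebra of the root datum, with Cartan subalgebra \<open>V\<close>, in its split form over the
  reals; its complexification is the complex Kac--Moody algebra and has the same roots.  Following Kac,
  it is the algebra with the Chevalley generators and relations in which no nonzero ideal meets the
  Cartan subalgebra trivially; this determines it up to isomorphism.  The Serre relations are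
  consequences of this last condition, and are listed because they belong to the usual presentation.\<close>

definition kac_moody_algebra ::
  "('i::finite, 'v::euclidean_space, 'g::real_vector) apartment_data \<Rightarrow> bool" where
  "kac_moody_algebra M \<longleftrightarrow>
     lie_algebra (bracket M) \<and> linear (cartan M) \<and> inj (cartan M) \<and>
     (\<forall>h h'. bracket M (cartan M h) (cartan M h') = 0) \<and>
     (\<forall>h i. bracket M (cartan M h) (egen M i) = sroot M i h *\<^sub>R egen M i) \<and>
     (\<forall>h i. bracket M (cartan M h) (fgen M i) = - sroot M i h *\<^sub>R fgen M i) \<and>
     (\<forall>i j. bracket M (egen M i) (fgen M j) = (if i = j then cartan M (scoroot M i) else 0)) \<and>
     (\<forall>i j. i \<noteq> j \<longrightarrow>
        (bracket M (egen M i) ^^ nat \<lfloor>1 - cartan_matrix M i j\<rfloor>) (egen M j) = 0 \<and>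
        (bracket M (fgen M i) ^^ nat \<lfloor>1 - cartan_matrix M i j\<rfloor>) (fgen M j) = 0) \<and>
     (\<forall>N. lie_subalgebra (bracket M) N \<longrightarrow>
        range (cartan M) \<union> range (egen M) \<union> range (fgen M) \<subseteq> N \<longrightarrow> N = UNIV) \<and>
     (\<forall>N. lie_ideal (bracket M) N \<longrightarrow> N \<inter> range (cartan M) = {0} \<longrightarrow> N = {0})"

definition km_roots ::
  "('i, 'v::euclidean_space, 'g::real_vector) apartment_data \<Rightarrow> ('v \<Rightarrow> real) set" where
  "km_roots M = {\<alpha>. linear \<alpha> \<and> \<alpha> \<noteq> (\<lambda>_. 0) \<and>
     (\<exists>x. x \<noteq> 0 \<and> (\<forall>h. bracket M (cartan M h) x = \<alpha> h *\<^sub>R x))}"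

section \<open>The Weyl group and its roots\<close>

definition srefl :: "('i, 'v::euclidean_space, 'g) apartment_data \<Rightarrow> 'i \<Rightarrow> 'v \<Rightarrow> 'v" where
  "srefl M i v = v - sroot M i v *\<^sub>R scoroot M i"

definition WvJ :: "('i, 'v::euclidean_space, 'g) apartment_data \<Rightarrow> 'i set \<Rightarrow> ('v \<Rightarrow> 'v) set" where
  "WvJ M J = generated (srefl M ` J)"

definition Wv :: "('i, 'v::euclidean_space, 'g) apartment_data \<Rightarrow> ('v \<Rightarrow> 'v) set" where
  "Wv M = WvJ M UNIV"

text \<open>The pairs consisting of a real root \<open>w \<alpha>\<^sub>i\<close> and its coroot \<open>w \<alpha>\<^sub>i\<^sup>\<or>\<close>; the Weyl group acts on
  linear forms by \<open>(w \<alpha>)(v) = \<alpha> (w\<^sup>-\<^sup>1 v)\<close>.\<close>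

definition root_pairs ::
  "('i, 'v::euclidean_space, 'g) apartment_data \<Rightarrow> (('v \<Rightarrow> real) \<times> 'v) set" where
  "root_pairs M = {(sroot M i \<circ> inv w, w (scoroot M i)) | w i. w \<in> Wv M}"

definition real_roots :: "('i, 'v::euclidean_space, 'g) apartment_data \<Rightarrow> ('v \<Rightarrow> real) set" where
  "real_roots M = fst ` root_pairs M"

definition imaginary_roots ::
  "('i, 'v::euclidean_space, 'g::real_vector) apartment_data \<Rightarrow> ('v \<Rightarrow> real) set" where
  "imaginary_roots M = km_roots M - real_roots M"

section \<open>Vectorial faces\<close>

definition Fv :: "('i, 'v::euclidean_space, 'g) apartment_data \<Rightarrow> 'i set \<Rightarrow> 'v set" where
  "Fv M J = {v. (\<forall>i\<in>J. sroot M i v = 0) \<and> (\<forall>i. i \<notin> J \<longrightarrow> sroot M i v > 0)}"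

definition spherical_type :: "('i, 'v::euclidean_space, 'g) apartment_data \<Rightarrow> 'i set \<Rightarrow> bool" where
  "spherical_type M J \<longleftrightarrow> finite (WvJ M J)"

definition positive_faces :: "('i, 'v::euclidean_space, 'g) apartment_data \<Rightarrow> 'v set set" where
  "positive_faces M = {w ` Fv M J | w J. w \<in> Wv M}"

definition positive_spherical_faces ::
  "('i, 'v::euclidean_space, 'g) apartment_data \<Rightarrow> 'v set set" where
  "positive_spherical_faces M = {w ` Fv M J | w J. w \<in> Wv M \<and> spherical_type M J}"

definition positive_chambers :: "('i, 'v::euclidean_space, 'g) apartment_data \<Rightarrow> 'v set set" where
  "positive_chambers M = {w ` Fv M {} | w. w \<in> Wv M}"

definition with_opposites :: "'v::euclidean_space set set \<Rightarrow> 'v set set" where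
  "with_opposites \<F> = \<F> \<union> image uminus ` \<F>"

definition faces :: "('i, 'v::euclidean_space, 'g) apartment_data \<Rightarrow> 'v set set" where
  "faces M = with_opposites (positive_faces M)"

definition spherical_faces :: "('i, 'v::euclidean_space, 'g) apartment_data \<Rightarrow> 'v set set" where
  "spherical_faces M = with_opposites (positive_spherical_faces M)"

definition chambers :: "('i, 'v::euclidean_space, 'g) apartment_data \<Rightarrow> 'v set set" where
  "chambers M = with_opposites (positive_chambers M)"

definition tits_cone :: "('i, 'v::euclidean_space, 'g) apartment_data \<Rightarrow> 'v set" where
  "tits_cone M = \<Union>(positive_faces M)"

definition open_tits_cone :: "('i, 'v::euclidean_space, 'g) apartment_data \<Rightarrow> 'v set" where
  "open_tits_cone M = \<Union>(positive_spherical_faces M)"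

definition tle :: "('i, 'v::euclidean_space, 'g) apartment_data \<Rightarrow> 'v \<Rightarrow> 'v \<Rightarrow> bool" where
  "tle M x y \<longleftrightarrow> y - x \<in> tits_cone M"

definition tless :: "('i, 'v::euclidean_space, 'g) apartment_data \<Rightarrow> 'v \<Rightarrow> 'v \<Rightarrow> bool" where
  "tless M x y \<longleftrightarrow> y - x \<in> open_tits_cone M"

section \<open>The model apartment\<close>

definition hyperplane :: "('v \<Rightarrow> real) \<Rightarrow> real \<Rightarrow> 'v set" where
  "hyperplane \<alpha> k = {v. \<alpha> v + k = 0}"

definition half_space :: "('v \<Rightarrow> real) \<Rightarrow> ereal \<Rightarrow> 'v set" where
  "half_space \<alpha> k = {v. ereal (\<alpha> v) + k \<ge> 0}"

definition walls :: "('i, 'v::euclidean_space, 'g) apartment_data \<Rightarrow> 'v set set" where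
  "walls M = {hyperplane \<alpha> k | \<alpha> k. \<alpha> \<in> real_roots M \<and> k \<in> Lam M \<alpha>}"

definition wall_coroot_pairs ::
  "('i, 'v::euclidean_space, 'g) apartment_data \<Rightarrow> ('v set \<times> 'v) set" where
  "wall_coroot_pairs M =
     {(hyperplane \<alpha> k, c) | \<alpha> c k. (\<alpha>, c) \<in> root_pairs M \<and> k \<in> Lam M \<alpha>}"

definition affine_reflection ::
  "('v::euclidean_space \<Rightarrow> real) \<Rightarrow> 'v \<Rightarrow> real \<Rightarrow> 'v \<Rightarrow> 'v" where
  "affine_reflection \<alpha> c k v = v - (\<alpha> v + k) *\<^sub>R c"

definition Wa :: "('i, 'v::euclidean_space, 'g) apartment_data \<Rightarrow> ('v \<Rightarrow> 'v) set" where
  "Wa M = generated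
     {affine_reflection \<alpha> c k | \<alpha> c k. (\<alpha>, c) \<in> root_pairs M \<and> k \<in> Lam M \<alpha>}"

text \<open>The last clause on \<open>\<Lambda>\<^sub>\<alpha>\<close> says that \<open>\<Lambda>\<^sub>\<alpha>\<close> lists all \<open>k\<close> for which \<open>M(\<alpha>, k)\<close> is a wall.  In view of
  \<open>M(\<alpha>, k) = M(-\<alpha>, -k)\<close> this amounts to \<open>\<Lambda>\<^sub>-\<^sub>\<alpha> = -\<Lambda>\<^sub>\<alpha>\<close>; without it enclosures would not be invariant
  under the affine Weyl group.\<close>

definition model_apartment ::
  "('i::finite, 'v::euclidean_space, 'g::real_vector) apartment_data \<Rightarrow> bool" where
  "model_apartment M \<longleftrightarrow> root_datum M \<and> kac_moody_algebra M \<and>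
     (\<forall>\<alpha>\<in>real_roots M. 0 \<in> Lam M \<alpha> \<and> infinite (Lam M \<alpha>) \<and>
        (\<forall>k. hyperplane \<alpha> k \<in> walls M \<longleftrightarrow> k \<in> Lam M \<alpha>)) \<and>
     (\<forall>w\<in>Wa M. image w ` walls M = walls M)"

definition aut_model :: "('i, 'v::euclidean_space, 'g) apartment_data \<Rightarrow> ('v \<Rightarrow> 'v) set" where
  "aut_model M = {\<phi>. bij \<phi> \<and> linear (\<lambda>v. \<phi> v - \<phi> 0) \<and>
     (\<lambda>(H, c). (\<phi> ` H, \<phi> c - \<phi> 0)) ` wall_coroot_pairs M = wall_coroot_pairs M}"

definition vect_weyl_model :: "('i, 'v::euclidean_space, 'g) apartment_data \<Rightarrow> ('v \<Rightarrow> 'v) set" where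
  "vect_weyl_model M = {\<phi> \<in> aut_model M. \<exists>w\<in>Wv M. \<exists>t. \<phi> = (\<lambda>v. w v + t)}"

section \<open>Filters in the model apartment\<close>

text \<open>A set \<open>S\<close> is identified with \<open>principal S\<close>; the set \<open>S\<close> contains the filter \<open>F\<close> if
  \<open>F \<le> principal S\<close>; a map \<open>\<phi>\<close> fixes \<open>F\<close> pointwise if \<open>\<forall>\<^sub>F x in F. \<phi> x = x\<close>.\<close>

definition full_Lam ::
  "('i, 'v::euclidean_space, 'g::real_vector) apartment_data \<Rightarrow> ('v \<Rightarrow> real) \<Rightarrow> real set" where
  "full_Lam M \<alpha> = (if \<alpha> \<in> imaginary_roots M then UNIV else Lam M \<alpha>)"

definition enclosed_sets ::
  "('i, 'v::euclidean_space, 'g::real_vector) apartment_data \<Rightarrow> 'v set set" where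
  "enclosed_sets M = {\<Inter>\<alpha>\<in>real_roots M \<union> imaginary_roots M. half_space \<alpha> (k \<alpha>) | k.
     \<forall>\<alpha>\<in>real_roots M \<union> imaginary_roots M. k \<alpha> \<in> insert \<infinity> (ereal ` full_Lam M \<alpha>)}"

definition enclosure ::
  "('i, 'v::euclidean_space, 'g::real_vector) apartment_data \<Rightarrow> 'v filter \<Rightarrow> 'v filter" where
  "enclosure M F = (INF P\<in>{P \<in> enclosed_sets M. F \<le> principal P}. principal P)"

lemma enclosed_sets_UNIV: "UNIV \<in> enclosed_sets M"
  unfolding enclosed_sets_def
  by (rule CollectI, rule exI[of _ "\<lambda>_. \<infinity>"]) (auto simp: half_space_def)

lemma half_space_mono: "a \<le> b \<Longrightarrow> half_space \<alpha> a \<subseteq> half_space \<alpha> b"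
  unfolding half_space_def using add_left_mono order_trans by blast

lemma half_space_min: "half_space \<alpha> (min a b) = half_space \<alpha> a \<inter> half_space \<alpha> b"
proof (cases "a \<le> b")
  case True
  then show ?thesis using half_space_mono[OF True, of \<alpha>] by (auto simp: min_def)
next
  case False
  then have "b \<le> a" by simp
  then show ?thesis using half_space_mono[OF \<open>b \<le> a\<close>, of \<alpha>] False by (auto simp: min_def)
qed

lemma enclosed_sets_Int:
  assumes "P \<in> enclosed_sets M" "Q \<in> enclosed_sets M"
  shows "P \<inter> Q \<in> enclosed_sets M"
proof -
  let ?R = "real_roots M \<union> imaginary_roots M"
  obtain k where k: "P = (\<Inter>\<alpha>\<in>?R. half_space \<alpha> (k \<alpha>))"
    "\<forall>\<alpha>\<in>?R. k \<alpha> \<in> insert \<infinity> (ereal ` full_Lam M \<alpha>)"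
    using assms(1) unfolding enclosed_sets_def by blast
  obtain l where l: "Q = (\<Inter>\<alpha>\<in>?R. half_space \<alpha> (l \<alpha>))"
    "\<forall>\<alpha>\<in>?R. l \<alpha> \<in> insert \<infinity> (ereal ` full_Lam M \<alpha>)"
    using assms(2) unfolding enclosed_sets_def by blast
  have "P \<inter> Q = (\<Inter>\<alpha>\<in>?R. half_space \<alpha> (min (k \<alpha>) (l \<alpha>)))"
    unfolding k(1) l(1) half_space_min by (rule INT_Int_distrib[symmetric])
  moreover have "\<forall>\<alpha>\<in>?R. min (k \<alpha>) (l \<alpha>) \<in> insert \<infinity> (ereal ` full_Lam M \<alpha>)"
    using k(2) l(2) by (simp add: min_def)
  ultimately show ?thesis unfolding enclosed_sets_def
    by (intro CollectI exI[of _ "\<lambda>\<alpha>. min (k \<alpha>) (l \<alpha>)"] conjI)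
qed

lemma eventually_enclosure:
  "eventually (\<lambda>v. v \<in> S) (enclosure M F) \<longleftrightarrow>
     (\<exists>P\<in>enclosed_sets M. F \<le> principal P \<and> P \<subseteq> S)"
proof -
  let ?B = "{P \<in> enclosed_sets M. F \<le> principal P}"
  have "eventually (\<lambda>v. v \<in> S) (INF P\<in>?B. principal P) \<longleftrightarrow>
      (\<exists>P\<in>?B. eventually (\<lambda>v. v \<in> S) (principal P))"
  proof (rule eventually_INF_base)
    show "?B \<noteq> {}" using enclosed_sets_UNIV by fastforce
    fix P Q assume "P \<in> ?B" "Q \<in> ?B"
    then have "P \<inter> Q \<in> ?B" using le_inf_iff[of F "principal P" "principal Q"]
      by (simp add: enclosed_sets_Int)
    then show "\<exists>R\<in>?B. principal R \<le> inf (principal P) (principal Q)"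
      by (intro bexI[of _ "P \<inter> Q"]) simp_all
  qed
  then show ?thesis unfolding enclosure_def by (auto simp: eventually_principal)
qed

definition support :: "'v::euclidean_space filter \<Rightarrow> 'v set" where
  "support F = \<Inter>{U. affine U \<and> F \<le> principal U}"

definition direction :: "'v::euclidean_space set \<Rightarrow> 'v set" where
  "direction U = {u - v | u v. u \<in> U \<and> v \<in> U}"

text \<open>The filter of all sets containing \<open>A + S\<close> for some member \<open>A\<close> of \<open>F\<close>.\<close>

definition filter_plus_set :: "'v::euclidean_space filter \<Rightarrow> 'v set \<Rightarrow> 'v filter" where
  "filter_plus_set F S = filtermap (\<lambda>(a, b). a + b) (prod_filter F (principal S))"

definition germ_at :: "'v::euclidean_space \<Rightarrow> 'v set \<Rightarrow> 'v filter" where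
  "germ_at x S = inf (nhds x) (principal S)"

definition local_face :: "'v::euclidean_space \<Rightarrow> 'v set \<Rightarrow> 'v filter" where
  "local_face x F = germ_at x ((+) x ` F)"

text \<open>In the next two germs the infimum is over a decreasing family, since a vectorial face is stable
  under addition and its translates by its own elements are contained in it; so the members are the
  sets containing some shortening.\<close>

definition sector_face_germ :: "'v::euclidean_space \<Rightarrow> 'v set \<Rightarrow> 'v filter" where
  "sector_face_germ x F = (INF \<xi>\<in>F. principal ((+) (x + \<xi>) ` F))"

definition chimney ::
  "('i, 'v::euclidean_space, 'g::real_vector) apartment_data \<Rightarrow> 'v filter \<Rightarrow> 'v set \<Rightarrow> 'v filter" where
  "chimney M F D = enclosure M (filter_plus_set F D)"

definition chimney_germ ::
  "('i, 'v::euclidean_space, 'g::real_vector) apartment_data \<Rightarrow> 'v filter \<Rightarrow> 'v set \<Rightarrow> 'v filter" where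
  "chimney_germ M F D = (INF \<xi>\<in>D. chimney M (filtermap (\<lambda>v. v + \<xi>) F) D)"

lemma eventually_sector_face_germ:
  assumes "F \<noteq> {}" "\<And>u v. u \<in> F \<Longrightarrow> v \<in> F \<Longrightarrow> u + v \<in> F"
  shows "eventually (\<lambda>v. v \<in> S) (sector_face_germ x F) \<longleftrightarrow> (\<exists>\<xi>\<in>F. (+) (x + \<xi>) ` F \<subseteq> S)"
proof -
  have "eventually (\<lambda>v. v \<in> S) (sector_face_germ x F) \<longleftrightarrow>
      (\<exists>\<xi>\<in>F. eventually (\<lambda>v. v \<in> S) (principal ((+) (x + \<xi>) ` F)))"
    unfolding sector_face_germ_def
  proof (rule eventually_INF_base[OF assms(1)])
    fix a b assume ab: "a \<in> F" "b \<in> F"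
    have "(+) (x + (a + b)) ` F \<subseteq> (+) (x + a) ` F \<inter> (+) (x + b) ` F"
    proof
      fix y assume "y \<in> (+) (x + (a + b)) ` F"
      then obtain v where v: "v \<in> F" "y = x + (a + b) + v" by blast
      then have "y = (x + a) + (b + v)" "y = (x + b) + (a + v)" by (simp_all add: algebra_simps)
      then show "y \<in> (+) (x + a) ` F \<inter> (+) (x + b) ` F" using assms(2) ab v(1) by blast
    qed
    then show "\<exists>c\<in>F. principal ((+) (x + c) ` F)
        \<le> inf (principal ((+) (x + a) ` F)) (principal ((+) (x + b) ` F))"
      using assms(2)[OF ab] by (intro bexI[of _ "a + b"]) auto
  qed
  then show ?thesis by (auto simp: eventually_principal)
qed

lemma filter_plus_set_translate_le:
  assumes "\<And>v. v \<in> D \<Longrightarrow> \<xi> + v \<in> D"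
  shows "filter_plus_set (filtermap (\<lambda>v. v + \<xi>) F) D \<le> filter_plus_set F D"
proof (rule filter_leI)
  fix P assume "eventually P (filter_plus_set F D)"
  then obtain Q R where QR: "eventually Q F" "\<forall>v\<in>D. R v" "\<And>a b. Q a \<Longrightarrow> R b \<Longrightarrow> P (a + b)"
    by (auto simp: filter_plus_set_def eventually_filtermap eventually_prod_filter eventually_principal)
  have "eventually (\<lambda>a. Q (a - \<xi>)) (filtermap (\<lambda>v. v + \<xi>) F)"
    using QR(1) by (simp add: eventually_filtermap)
  moreover have "P (a + b)" if "Q (a - \<xi>)" "b \<in> D" for a b
    using QR(3)[OF that(1), of "\<xi> + b"] QR(2) assms[OF that(2)] by (simp add: algebra_simps)
  ultimately show "eventually P (filter_plus_set (filtermap (\<lambda>v. v + \<xi>) F) D)"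
    unfolding filter_plus_set_def eventually_filtermap eventually_prod_filter eventually_principal
    by (intro exI[of _ "\<lambda>a. Q (a - \<xi>)"] exI[of _ "\<lambda>b. b \<in> D"]) (simp add: split_def)
qed

lemma enclosure_mono: "F \<le> F' \<Longrightarrow> enclosure M F \<le> enclosure M F'"
  unfolding enclosure_def by (intro INF_superset_mono) auto

lemma eventually_chimney_germ:
  assumes "D \<noteq> {}" "\<And>u v. u \<in> D \<Longrightarrow> v \<in> D \<Longrightarrow> u + v \<in> D"
  shows "eventually P (chimney_germ M F D) \<longleftrightarrow>
    (\<exists>\<xi>\<in>D. eventually P (chimney M (filtermap (\<lambda>v. v + \<xi>) F) D))"
  unfolding chimney_germ_def
proof (rule eventually_INF_base[OF assms(1)])
  fix a b assume ab: "a \<in> D" "b \<in> D"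
  have le: "chimney M (filtermap (\<lambda>v. v + (c + d)) F) D \<le> chimney M (filtermap (\<lambda>v. v + c) F) D"
    if "c \<in> D" "d \<in> D" for c d
  proof -
    have eq: "filtermap (\<lambda>v. v + (c + d)) F = filtermap (\<lambda>v. v + d) (filtermap (\<lambda>v. v + c) F)"
      by (simp add: filtermap_filtermap add.assoc)
    show ?thesis unfolding chimney_def eq
      by (rule enclosure_mono[OF filter_plus_set_translate_le]) (simp add: assms(2) that(2))
  qed
  show "\<exists>c\<in>D. chimney M (filtermap (\<lambda>v. v + c) F) D
      \<le> inf (chimney M (filtermap (\<lambda>v. v + a) F) D) (chimney M (filtermap (\<lambda>v. v + b) F) D)"
    using le[OF ab] le[OF ab(2) ab(1)] assms(2)[OF ab]
    by (intro bexI[of _ "a + b"]) (simp_all add: add.commute)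
qed

definition solid ::
  "('i, 'v::euclidean_space, 'g::real_vector) apartment_data \<Rightarrow> 'v filter \<Rightarrow> bool" where
  "solid M R \<longleftrightarrow> finite {w \<in> Wv M. \<forall>u\<in>direction (support R). w u = u}"

definition local_faces :: "('i, 'v::euclidean_space, 'g) apartment_data \<Rightarrow> 'v filter set" where
  "local_faces M = {local_face x F | x F. F \<in> faces M}"

definition local_chambers :: "('i, 'v::euclidean_space, 'g) apartment_data \<Rightarrow> 'v filter set" where
  "local_chambers M = {local_face x C | x C. C \<in> chambers M}"

definition sector_germs :: "('i, 'v::euclidean_space, 'g) apartment_data \<Rightarrow> 'v filter set" where
  "sector_germs M = {sector_face_germ x C | x C. C \<in> chambers M}"

definition closed_faces ::
  "('i, 'v::euclidean_space, 'g::real_vector) apartment_data \<Rightarrow> 'v filter set" where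
  "closed_faces M = enclosure M ` local_faces M"

definition solid_chimneys ::
  "('i, 'v::euclidean_space, 'g::real_vector) apartment_data \<Rightarrow> 'v filter set" where
  "solid_chimneys M = {chimney M F D | F D.
     F \<in> local_faces M \<and> D \<in> faces M \<and> solid M (chimney M F D)}"

definition solid_chimney_germs ::
  "('i, 'v::euclidean_space, 'g::real_vector) apartment_data \<Rightarrow> 'v filter set" where
  "solid_chimney_germs M = {chimney_germ M F D | F D.
     F \<in> local_faces M \<and> D \<in> faces M \<and> solid M (chimney M F D)}"

definition splayed_chimney_germs ::
  "('i, 'v::euclidean_space, 'g::real_vector) apartment_data \<Rightarrow> 'v filter set" where
  "splayed_chimney_germs M = {chimney_germ M F D | F D.
     F \<in> local_faces M \<and> D \<in> spherical_faces M}"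

definition points :: "'v::euclidean_space filter set" where
  "points = range (\<lambda>x. principal {x})"

definition preordered_segment_germs ::
  "('i, 'v::euclidean_space, 'g) apartment_data \<Rightarrow> 'v filter set" where
  "preordered_segment_germs M = {germ_at x (closed_segment x y) | x y.
     x \<noteq> y \<and> (tle M x y \<or> tle M y x)}"

definition generic_rays :: "('i, 'v::euclidean_space, 'g) apartment_data \<Rightarrow> 'v filter set" where
  "generic_rays M = {principal {x + t *\<^sub>R (y - x) | t. 0 \<le> t} | x y.
     x \<noteq> y \<and> (tless M x y \<or> tless M y x)}"

section \<open>Apartments\<close>

text \<open>\<open>Iso A\<close> is the set \<open>Isom\<^sup>w(\<bbbA>, A)\<close>.  Notions are transferred to \<open>A\<close> along an
  arbitrary element of it; they do not depend on the choice, being invariant under the affine Weyl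
  group.\<close>

definition apartment_structure ::
  "('i, 'v::euclidean_space, 'g) apartment_data \<Rightarrow> 'd set \<Rightarrow> ('v \<Rightarrow> 'd) set \<Rightarrow> bool" where
  "apartment_structure M A I \<longleftrightarrow> (\<exists>f\<^sub>0. bij_betw f\<^sub>0 UNIV A \<and> I = {f\<^sub>0 \<circ> w | w. w \<in> Wa M})"

definition chart :: "('d set \<Rightarrow> ('v \<Rightarrow> 'd) set) \<Rightarrow> 'd set \<Rightarrow> 'v \<Rightarrow> 'd" where
  "chart Iso A = (SOME f. f \<in> Iso A)"

definition coord :: "('d set \<Rightarrow> ('v \<Rightarrow> 'd) set) \<Rightarrow> 'd set \<Rightarrow> 'd \<Rightarrow> 'v" where
  "coord Iso A = inv (chart Iso A)"

definition filters_in ::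
  "('d set \<Rightarrow> ('v \<Rightarrow> 'd) set) \<Rightarrow> 'd set \<Rightarrow> 'v filter set \<Rightarrow> 'd filter set" where
  "filters_in Iso A \<N> = filtermap (chart Iso A) ` \<N>"

definition enclosure_in ::
  "('i, 'v::euclidean_space, 'g::real_vector) apartment_data \<Rightarrow>
   ('d set \<Rightarrow> ('v \<Rightarrow> 'd) set) \<Rightarrow> 'd set \<Rightarrow> 'd filter \<Rightarrow> 'd filter" where
  "enclosure_in M Iso A F = filtermap (chart Iso A) (enclosure M (filtermap (coord Iso A) F))"

definition le_in ::
  "('i, 'v::euclidean_space, 'g) apartment_data \<Rightarrow>
   ('d set \<Rightarrow> ('v \<Rightarrow> 'd) set) \<Rightarrow> 'd set \<Rightarrow> 'd \<Rightarrow> 'd \<Rightarrow> bool" where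
  "le_in M Iso A x y \<longleftrightarrow> tle M (coord Iso A x) (coord Iso A y)"

definition segment_in ::
  "('d set \<Rightarrow> ('v::euclidean_space \<Rightarrow> 'd) set) \<Rightarrow> 'd set \<Rightarrow> 'd \<Rightarrow> 'd \<Rightarrow> 'd set" where
  "segment_in Iso A x y = chart Iso A ` closed_segment (coord Iso A x) (coord Iso A y)"

text \<open>Maps between apartments are represented by functions on the whole type whose restriction to \<open>A\<close>
  is meant.  The parameter \<open>\<G>\<close> is one of the groups of automorphisms of the model apartment.\<close>

definition apartment_map ::
  "('v \<Rightarrow> 'v) set \<Rightarrow> ('d set \<Rightarrow> ('v \<Rightarrow> 'd) set) \<Rightarrow> 'd set \<Rightarrow> 'd set \<Rightarrow> ('d \<Rightarrow> 'd) \<Rightarrow> bool" where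
  "apartment_map \<G> Iso A A' \<phi> \<longleftrightarrow> bij_betw \<phi> A A' \<and>
     (\<forall>f\<in>Iso A. \<forall>f'\<in>Iso A'. inv f' \<circ> \<phi> \<circ> f \<in> \<G>)"

abbreviation isomorphism where
  "isomorphism M \<equiv> apartment_map (aut_model M)"

abbreviation weyl_isomorphism where
  "weyl_isomorphism M \<equiv> apartment_map (Wa M)"

abbreviation vect_weyl_isomorphism where
  "vect_weyl_isomorphism M \<equiv> apartment_map (vect_weyl_model M)"

section \<open>Masures\<close>

definition ma2_situation ::
  "('i, 'v::euclidean_space, 'g::real_vector) apartment_data \<Rightarrow> 'd set set \<Rightarrow>
   ('d set \<Rightarrow> ('v \<Rightarrow> 'd) set) \<Rightarrow> 'd set \<Rightarrow> 'd set \<Rightarrow> 'd filter \<Rightarrow> bool" where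
  "ma2_situation M \<A> Iso A A' F \<longleftrightarrow> A \<in> \<A> \<and> A' \<in> \<A> \<and> F \<le> principal A' \<and>
     F \<in> filters_in Iso A
       (points \<union> preordered_segment_germs M \<union> generic_rays M \<union> solid_chimneys M)"

definition ma3_situation ::
  "('i, 'v::euclidean_space, 'g::real_vector) apartment_data \<Rightarrow> 'd set set \<Rightarrow>
   ('d set \<Rightarrow> ('v \<Rightarrow> 'd) set) \<Rightarrow> 'd filter \<Rightarrow> 'd filter \<Rightarrow> bool" where
  "ma3_situation M \<A> Iso R F \<longleftrightarrow>
     (\<exists>B\<in>\<A>. R \<in> filters_in Iso B (splayed_chimney_germs M)) \<and>
     (\<exists>B\<in>\<A>. F \<in> filters_in Iso B (closed_faces M \<union> solid_chimney_germs M))"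

definition ma4_situation ::
  "('i, 'v::euclidean_space, 'g::real_vector) apartment_data \<Rightarrow> 'd set set \<Rightarrow>
   ('d set \<Rightarrow> ('v \<Rightarrow> 'd) set) \<Rightarrow> 'd set \<Rightarrow> 'd set \<Rightarrow> 'd filter \<Rightarrow> 'd filter \<Rightarrow> bool" where
  "ma4_situation M \<A> Iso A A' R F \<longleftrightarrow> A \<in> \<A> \<and> A' \<in> \<A> \<and> ma3_situation M \<A> Iso R F \<and>
     R \<le> principal A \<and> F \<le> principal A \<and> R \<le> principal A' \<and> F \<le> principal A'"

text \<open>The filter \<open>sup R F\<close> consists of the sets belonging to both \<open>R\<close> and \<open>F\<close>; it is the union of
  \<open>R\<close> and \<open>F\<close> under the identification of sets with filters.\<close>

definition masure ::
  "('i::finite, 'v::euclidean_space, 'g::real_vector) apartment_data \<Rightarrow> 'd set \<Rightarrow> 'd set set \<Rightarrow>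
   ('d set \<Rightarrow> ('v \<Rightarrow> 'd) set) \<Rightarrow> bool" where
  "masure M \<Delta> \<A> Iso \<longleftrightarrow> model_apartment M \<and> \<Union>\<A> = \<Delta> \<and>
     (\<forall>A\<in>\<A>. apartment_structure M A (Iso A)) \<and>
     (\<forall>A A' F. ma2_situation M \<A> Iso A A' F \<longrightarrow>
        enclosure_in M Iso A F \<le> principal (A \<inter> A') \<and>
        (\<exists>\<phi>. weyl_isomorphism M Iso A A' \<phi> \<and> (\<forall>\<^sub>F x in enclosure_in M Iso A F. \<phi> x = x))) \<and>
     (\<forall>R F. ma3_situation M \<A> Iso R F \<longrightarrow> (\<exists>A\<in>\<A>. R \<le> principal A \<and> F \<le> principal A)) \<and>
     (\<forall>A A' R F. ma4_situation M \<A> Iso A A' R F \<longrightarrow>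
        enclosure_in M Iso A (sup R F) \<le> principal (A \<inter> A') \<and>
        (\<exists>\<phi>. weyl_isomorphism M Iso A A' \<phi> \<and>
           (\<forall>\<^sub>F x in enclosure_in M Iso A (sup R F). \<phi> x = x))) \<and>
     (\<forall>A\<in>\<A>. \<forall>A'\<in>\<A>. \<forall>x\<in>A \<inter> A'. \<forall>y\<in>A \<inter> A'.
        le_in M Iso A x y \<longrightarrow> segment_in Iso A x y = segment_in Iso A' x y)"

text \<open>A bijection of \<open>\<Delta>\<close> is represented by its extension by the identity outside \<open>\<Delta>\<close>.\<close>

definition masure_automorphisms ::
  "('i, 'v::euclidean_space, 'g) apartment_data \<Rightarrow> 'd set \<Rightarrow> 'd set set \<Rightarrow>
   ('d set \<Rightarrow> ('v \<Rightarrow> 'd) set) \<Rightarrow> ('d \<Rightarrow> 'd) set" where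
  "masure_automorphisms M \<Delta> \<A> Iso = {\<phi>. \<phi> permutes \<Delta> \<and> image \<phi> ` \<A> = \<A> \<and>
     (\<forall>A\<in>\<A>. isomorphism M Iso A (\<phi> ` A) \<phi>)}"

definition vect_weyl_automorphism ::
  "('i, 'v::euclidean_space, 'g) apartment_data \<Rightarrow> 'd set set \<Rightarrow>
   ('d set \<Rightarrow> ('v \<Rightarrow> 'd) set) \<Rightarrow> ('d \<Rightarrow> 'd) \<Rightarrow> bool" where
  "vect_weyl_automorphism M \<A> Iso \<phi> \<longleftrightarrow> (\<forall>A\<in>\<A>. vect_weyl_isomorphism M Iso A (\<phi> ` A) \<phi>)"

definition automorphism_group ::
  "('i, 'v::euclidean_space, 'g) apartment_data \<Rightarrow> 'd set \<Rightarrow> 'd set set \<Rightarrow>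
   ('d set \<Rightarrow> ('v \<Rightarrow> 'd) set) \<Rightarrow> ('d \<Rightarrow> 'd) set \<Rightarrow> bool" where
  "automorphism_group M \<Delta> \<A> Iso G \<longleftrightarrow> G \<subseteq> masure_automorphisms M \<Delta> \<A> Iso \<and>
     id \<in> G \<and> (\<forall>g\<in>G. inv g \<in> G) \<and> (\<forall>g\<in>G. \<forall>h\<in>G. g \<circ> h \<in> G)"

definition strongly_transitive ::
  "('i, 'v::euclidean_space, 'g::real_vector) apartment_data \<Rightarrow> 'd set set \<Rightarrow>
   ('d set \<Rightarrow> ('v \<Rightarrow> 'd) set) \<Rightarrow> ('d \<Rightarrow> 'd) set \<Rightarrow> bool" where
  "strongly_transitive M \<A> Iso G \<longleftrightarrow>
     (\<forall>A A' F. ma2_situation M \<A> Iso A A' F \<longrightarrow>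
        (\<exists>g\<in>G. weyl_isomorphism M Iso A A' g \<and> (\<forall>\<^sub>F x in enclosure_in M Iso A F. g x = x))) \<and>
     (\<forall>A A' R F. ma4_situation M \<A> Iso A A' R F \<longrightarrow>
        (\<exists>g\<in>G. weyl_isomorphism M Iso A A' g \<and>
           (\<forall>\<^sub>F x in enclosure_in M Iso A (sup R F). g x = x)))"

definition friendly ::
  "('i, 'v::euclidean_space, 'g) apartment_data \<Rightarrow> 'd set set \<Rightarrow>
   ('d set \<Rightarrow> ('v \<Rightarrow> 'd) set) \<Rightarrow> ('d \<Rightarrow> 'd) set \<Rightarrow> 'd filter \<Rightarrow> bool" where
  "friendly M \<A> Iso G \<Omega> \<longleftrightarrow>
     (\<forall>A\<in>\<A>. \<forall>A'\<in>\<A>. \<Omega> \<le> principal A \<longrightarrow> \<Omega> \<le> principal A' \<longrightarrow>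
        (\<exists>g\<in>G. (\<forall>\<^sub>F x in \<Omega>. g x = x) \<and> A' = g ` A \<and> weyl_isomorphism M Iso A A' g))"

end

theory Submission
  imports Defs
begin

text \<open>Weyl isomorphisms between apartments are handled as pairs of charts, a chart being an element of
  some \<open>Isom\<^sup>w(\<bbbA>, A)\<close>.  Since charts of one apartment differ by affine maps, a chart is determined by its
  restriction to any nonempty open set.  All conditions are therefore compared with the following
  one, \<open>transitive_on_charts\<close>: if charts \<open>f\<close> of \<open>A\<close> and \<open>f'\<close> of \<open>A'\<close> agree on a nonempty open set, then
  \<open>f' = g \<circ> f\<close> for some \<open>g \<in> G\<close>.

  If local chambers are friendly, this holds by rigidity.  If sector germs are friendly, take a point
  \<open>x\<close> near which \<open>f\<close> and \<open>f'\<close> agree and opposite sectors \<open>f (x + C)\<close> in \<open>A\<close>, \<open>f' (x - C)\<close> in \<open>A'\<close>.  An apartment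
  \<open>B\<close> containing the germs of both has a chart that agrees with \<open>f\<close> on the first germ and with \<open>f'\<close> on the
  second one (\<open>transitive_if_sector_germs_friendly\<close>), so \<open>A\<close> can be moved to \<open>B\<close> and \<open>B\<close> to \<open>A'\<close>.

  Conversely, assume the condition on charts, and let \<open>A\<close>, \<open>A'\<close> contain a filter \<open>\<Omega>\<close> as in (MA2) or (MA4).
  Axiom (MA3) provides a chain of apartments from \<open>A\<close> to \<open>A'\<close>, all containing \<open>\<Omega>\<close>, in which consecutive
  apartments share an open set as well (\<open>move_chimney\<close>, \<open>move_MA4_chart\<close>); along it \<open>A\<close> is moved to \<open>A'\<close>
  by \<open>G\<close>.  The difficulty is that the resulting element of \<open>G\<close> has to fix the enclosure of \<open>\<Omega>\<close>, whereas
  some of the motions are only known to fix a local chamber at a point \<open>x\<close> of \<open>\<Omega>\<close>, which says little about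
  the points of \<open>\<Omega>\<close> far from \<open>x\<close>.  This is settled by (MAO): a common point of two apartments that is
  comparable with all points of an open set on which two charts agree has the same coordinates in both
  charts (\<open>same_coordinates\<close>), since these coordinates can be read off from segments.  Points of \<open>\<Omega>\<close>
  near \<open>x\<close> are of this kind, and the others follow by convexity (\<open>agree_on_convex\<close>).

  Finally, strong transitivity implies friendliness: a sector germ is the germ of a splayed and solid
  chimney, and for a local chamber (MA2) is applied to the germ of a regular segment inside it.

  Three facts on roots enter.  The imaginary roots are permuted by the Weyl group, by the theory of
  \<open>sl\<^sub>2\<close>-modules, so enclosures are compatible with Weyl isomorphisms.  Each root has a constant sign on
  each chamber, by the triangular decomposition of the Kac--Moody algebra, so the enclosure of a
  regular segment germ contains a local chamber.  The sets \<open>\<Lambda>\<^sub>\<alpha>\<close> are unbounded, so sector germs are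
  germs of chimneys.\<close>

section \<open>The Weyl group and its chambers\<close>

lemma linear_inv_of_bij:
  fixes w :: "'v::real_vector \<Rightarrow> 'v"
  assumes "linear w" "bij w"
  shows "linear (inv w)"
proof (rule linearI)
  have i: "inv w (w v) = v" "w (inv w v) = v" for v
    using assms(2) by (auto simp: bij_is_inj bij_is_surj surj_f_inv_f)
  fix x y c
  have "w (inv w x + inv w y) = x + y" by (simp add: linear_add[OF assms(1)] i)
  then show "inv w (x + y) = inv w x + inv w y" using i(1) by metis
  have "w (c *\<^sub>R inv w x) = c *\<^sub>R x" by (simp add: linear_cmul[OF assms(1)] i)
  then show "inv w (c *\<^sub>R x) = c *\<^sub>R inv w x" using i(1) by metis
qed

locale root_data =
  fixes M :: "('i::finite, 'v::euclidean_space, 'g::real_vector) apartment_data"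
  assumes root_datum: "root_datum M"
begin

lemma linear_sroot: "linear (sroot M i)"
  using root_datum by (simp add: root_datum_def)

lemma sroot_scoroot_self: "sroot M i (scoroot M i) = 2"
  using root_datum by (simp add: root_datum_def generalized_cartan_matrix_def cartan_matrix_def)

lemma linear_srefl: "linear (srefl M i)"
  unfolding srefl_def
  by (intro linear_compose_sub linear_id[unfolded id_def] linearI)
     (simp_all add: linear_add[OF linear_sroot] linear_cmul[OF linear_sroot] algebra_simps)

lemma srefl_srefl: "srefl M i (srefl M i v) = v"
  by (simp add: srefl_def linear_diff[OF linear_sroot] linear_cmul[OF linear_sroot]
      sroot_scoroot_self)

lemma bij_srefl: "bij (srefl M i)"
  by (rule involuntory_imp_bij) (rule srefl_srefl)

lemma WvJ_linear_bij:
  assumes "w \<in> WvJ M J"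
  shows "linear w \<and> bij w"
  using assms unfolding WvJ_def
proof (induction rule: generated.induct)
  case (gen_comp g h)
  then show ?case using bij_comp[of h g] linear_compose[of h g] by (simp only: simp_thms)
qed (auto simp: linear_id[unfolded id_def] bij_id[unfolded id_def] linear_srefl bij_srefl linear_inv_of_bij bij_imp_bij_inv)

lemma Wv_linear: "w \<in> Wv M \<Longrightarrow> linear w" and Wv_bij: "w \<in> Wv M \<Longrightarrow> bij w"
  using WvJ_linear_bij by (auto simp: Wv_def)

lemma Wv_id: "id \<in> Wv M" and Wv_inv: "w \<in> Wv M \<Longrightarrow> inv w \<in> Wv M"
  and Wv_comp: "w \<in> Wv M \<Longrightarrow> u \<in> Wv M \<Longrightarrow> w \<circ> u \<in> Wv M"
  and Wv_srefl: "srefl M i \<in> Wv M"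
  unfolding Wv_def WvJ_def by (auto intro: generated.intros)

lemma Wv_inv_apply: "w \<in> Wv M \<Longrightarrow> inv w (w v) = v" "w \<in> Wv M \<Longrightarrow> w (inv w v) = v"
  using Wv_bij by (auto simp: bij_is_inj bij_is_surj surj_f_inv_f)

lemma open_Wv_image:
  assumes "w \<in> Wv M" "open S" shows "open (w ` S)"
  using open_surjective_linear_image[OF assms(2) Wv_linear[OF assms(1)]] Wv_bij[OF assms(1)]
  by (simp add: bij_is_surj)

text \<open>Otherwise the values of the simple roots would form a proper subspace of \<open>\<real>\<^sup>I\<close>, and a vector orthogonal
  to it would be a linear relation between them.  In particular no vectorial face is empty.\<close>

lemma sroot_values: "\<exists>v. \<forall>i. sroot M i v = c i"
proof -
  let ?T = "\<lambda>v. (\<chi> i. sroot M i v) :: real^'i"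
  have lin: "linear ?T"
    by (rule linearI) (simp_all add: vec_eq_iff linear_add[OF linear_sroot] linear_cmul[OF linear_sroot])
  have "span (range ?T) = UNIV"
  proof (rule ccontr)
    assume "span (range ?T) \<noteq> UNIV"
    then obtain a where a: "a \<noteq> 0" "\<forall>x\<in>span (range ?T). a \<bullet> x = 0"
      using span_not_univ_subset_hyperplane by blast
    then have "(\<Sum>i\<in>UNIV. a $ i * sroot M i v) = 0" for v
      using span_base[of "?T v" "range ?T"] by (auto simp: inner_vec_def)
    then have "\<forall>i. a $ i = 0" using root_datum unfolding root_datum_def by blast
    then show False using a(1) by (simp add: vec_eq_iff)
  qed
  then have "range ?T = UNIV"
    using linear_subspace_image[OF lin subspace_UNIV] by (metis span_eq_iff)
  then obtain v where "?T v = (\<chi> i. c i)" by (metis UNIV_I imageE)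
  then show ?thesis by (auto simp: vec_eq_iff)
qed

lemma Fv_nonempty: "Fv M J \<noteq> {}"
proof -
  obtain v where "\<forall>i. sroot M i v = (if i \<in> J then 0 else 1)"
    using sroot_values[of "\<lambda>i. if i \<in> J then 0 else 1"] by blast
  then have "v \<in> Fv M J" by (simp add: Fv_def)
  then show ?thesis by blast
qed

lemma Fv_add: "u \<in> Fv M J \<Longrightarrow> v \<in> Fv M J \<Longrightarrow> u + v \<in> Fv M J"
  by (simp add: Fv_def linear_add[OF linear_sroot] add_pos_pos)

lemma Fv_scale: "u \<in> Fv M J \<Longrightarrow> 0 < t \<Longrightarrow> t *\<^sub>R u \<in> Fv M J"
  by (simp add: Fv_def linear_cmul[OF linear_sroot])

lemma Fv_add_chamber:
  assumes "u \<in> Fv M J" "v \<in> Fv M {}" shows "u + v \<in> Fv M {}"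
proof -
  have "sroot M i u \<ge> 0" for i using assms(1) by (cases "i \<in> J") (auto simp: Fv_def less_imp_le)
  then show ?thesis using assms(2) by (simp add: Fv_def linear_add[OF linear_sroot] add_nonneg_pos)
qed

lemma open_fundamental_chamber: "open (Fv M {})"
proof -
  have "Fv M {} = (\<Inter>i\<in>UNIV. sroot M i -` {0<..})" by (auto simp: Fv_def)
  moreover have "open (sroot M i -` {0<..})" for i
    by (rule open_vimage) (simp_all add: linear_continuous_on linear_linear linear_sroot)
  ultimately show ?thesis by auto
qed

lemma chambers_cases:
  assumes "C \<in> chambers M"
  obtains w where "w \<in> Wv M" "C = w ` Fv M {}" | w where "w \<in> Wv M" "C = uminus ` w ` Fv M {}"
  using assms unfolding chambers_def with_opposites_def positive_chambers_def by auto

lemma chamber_is_face: "C \<in> chambers M \<Longrightarrow> C \<in> faces M"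
  unfolding chambers_def faces_def with_opposites_def positive_chambers_def positive_faces_def by blast

lemma spherical_face_is_face: "F \<in> spherical_faces M \<Longrightarrow> F \<in> faces M"
  unfolding spherical_faces_def faces_def with_opposites_def positive_spherical_faces_def
    positive_faces_def by blast

lemma chamber_spherical: "C \<in> chambers M \<Longrightarrow> C \<in> spherical_faces M"
proof -
  have "w = id" if "w \<in> generated {}" for w :: "'v \<Rightarrow> 'v"
    using that by induction (auto simp: inv_id)
  then have "WvJ M {} \<subseteq> {id}" by (auto simp: WvJ_def)
  then have "spherical_type M {}" unfolding spherical_type_def using finite_subset by blast
  then show "C \<in> chambers M \<Longrightarrow> C \<in> spherical_faces M"
    unfolding spherical_faces_def chambers_def with_opposites_def positive_spherical_faces_def
      positive_chambers_def by blast
qed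

lemma uminus_uminus_image: "uminus ` uminus ` (S :: 'v set) = S"
  by (simp add: image_image)

lemma chamber_uminus: "C \<in> chambers M \<Longrightarrow> uminus ` C \<in> chambers M"
  unfolding chambers_def with_opposites_def by (auto simp: uminus_uminus_image)

lemma Wv_image_uminus: "w \<in> Wv M \<Longrightarrow> w ` uminus ` S = uminus ` w ` S"
  by (auto simp: image_image linear_neg[OF Wv_linear])

lemma Wv_stable_faces:
  assumes "w \<in> Wv M" "F \<in> with_opposites {u ` Fv M J | u J. u \<in> Wv M \<and> p J}"
  shows "w ` F \<in> with_opposites {u ` Fv M J | u J. u \<in> Wv M \<and> p J}" (is "_ \<in> with_opposites ?X")
proof -
  have *: "w ` E \<in> ?X" if E: "E \<in> ?X" for E
  proof -
    obtain u J where "u \<in> Wv M" "p J" "E = u ` Fv M J" using E by blast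
    then show ?thesis using Wv_comp[OF assms(1), of u]
      by (intro CollectI exI[of _ "w \<circ> u"] exI[of _ J]) (simp add: image_comp)
  qed
  from assms(2) consider "F \<in> ?X" | E where "E \<in> ?X" "F = uminus ` E"
    unfolding with_opposites_def by blast
  then show ?thesis
    by cases (simp_all add: with_opposites_def * Wv_image_uminus[OF assms(1)] del: mem_Collect_eq)
qed

lemma face_Wv: "w \<in> Wv M \<Longrightarrow> F \<in> faces M \<Longrightarrow> w ` F \<in> faces M"
  and spherical_face_Wv: "w \<in> Wv M \<Longrightarrow> F \<in> spherical_faces M \<Longrightarrow> w ` F \<in> spherical_faces M"
  and chamber_Wv: "w \<in> Wv M \<Longrightarrow> F \<in> chambers M \<Longrightarrow> w ` F \<in> chambers M"
  using Wv_stable_faces[of w F "\<lambda>_. True"] Wv_stable_faces[of w F "spherical_type M"]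
    Wv_stable_faces[of w F "\<lambda>J. J = {}"]
  by (simp_all add: faces_def positive_faces_def spherical_faces_def positive_spherical_faces_def
      chambers_def positive_chambers_def)

text \<open>The sign of a face is absorbed in the linear map \<open>L\<close>, so that positive and negative faces can be
  treated together.\<close>

lemma face_as_image:
  assumes "F \<in> faces M"
  obtains L J where "linear L" "F = L ` Fv M J" "L ` Fv M {} \<in> chambers M"
proof -
  obtain w J where w: "w \<in> Wv M" "F = w ` Fv M J \<or> F = uminus ` w ` Fv M J"
    using assms unfolding faces_def with_opposites_def positive_faces_def by auto
  have "w ` Fv M {} \<in> chambers M" "(\<lambda>v. - w v) ` Fv M {} \<in> chambers M"
    using w(1) unfolding chambers_def with_opposites_def positive_chambers_def
    by (auto simp: image_image[symmetric, of uminus w])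
  then show thesis
    using w that[of w J] that[of "\<lambda>v. - w v" J] Wv_linear[OF w(1)]
    by (auto simp: image_image linear_compose_neg)
qed

lemma face_nonempty: "F \<in> faces M \<Longrightarrow> F \<noteq> {}"
  by (erule face_as_image) (simp add: Fv_nonempty)

lemma face_add: assumes "F \<in> faces M" "u \<in> F" "v \<in> F" shows "u + v \<in> F"
proof -
  obtain L J where L: "linear L" "F = L ` Fv M J" by (rule face_as_image[OF assms(1)])
  then show ?thesis using assms(2,3) Fv_add by (auto simp: linear_add[OF L(1), symmetric])
qed

lemma face_scale: assumes "F \<in> faces M" "u \<in> F" "0 < t" shows "t *\<^sub>R u \<in> F"
proof -
  obtain L J where L: "linear L" "F = L ` Fv M J" by (rule face_as_image[OF assms(1)])
  then show ?thesis using assms(2,3) Fv_scale by (auto simp: linear_cmul[OF L(1), symmetric])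
qed

lemma chamber_open: assumes "C \<in> chambers M" shows "open C"
  using assms
  by (cases rule: chambers_cases)
     (auto simp: open_Wv_image open_fundamental_chamber open_negations)

text \<open>That a face \<open>F\<close> lies in the closure of a chamber \<open>C\<close> is expressed throughout by \<open>F + C \<subseteq> C\<close>.\<close>

lemma face_below_chamber:
  assumes "F \<in> faces M"
  obtains C where "C \<in> chambers M" "\<And>u c. u \<in> F \<Longrightarrow> c \<in> C \<Longrightarrow> u + c \<in> C"
proof -
  obtain L J where L: "linear L" "F = L ` Fv M J" "L ` Fv M {} \<in> chambers M"
    by (rule face_as_image[OF assms])
  show thesis
  proof (rule that[OF L(3)])
    show "u + c \<in> L ` Fv M {}" if "u \<in> F" "c \<in> L ` Fv M {}" for u c
      using that L(2) Fv_add_chamber by (auto simp: linear_add[OF L(1), symmetric])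
  qed
qed

lemma tits_cone_Wv: assumes "w \<in> Wv M" "v \<in> tits_cone M" shows "w v \<in> tits_cone M"
proof -
  obtain u J where "u \<in> Wv M" "v \<in> u ` Fv M J"
    using assms(2) unfolding tits_cone_def positive_faces_def by blast
  then have "w v \<in> (w \<circ> u) ` Fv M J" "w \<circ> u \<in> Wv M" using Wv_comp[OF assms(1)] by auto
  then show ?thesis unfolding tits_cone_def positive_faces_def by blast
qed

lemma open_tits_cone_le: "open_tits_cone M \<subseteq> tits_cone M"
  unfolding open_tits_cone_def tits_cone_def positive_spherical_faces_def positive_faces_def by blast

text \<open>Both the preorder and its opposite allow (MAO) to be applied, so the difference of two points only
  has to be tested for membership in \<open>T \<union> -T\<close>.\<close>

definition comparable :: "'v \<Rightarrow> bool" where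
  "comparable v \<longleftrightarrow> v \<in> tits_cone M \<or> - v \<in> tits_cone M"

lemma comparable_uminus: "comparable (- v) \<longleftrightarrow> comparable v"
  unfolding comparable_def by auto

lemma comparable_iff: "comparable v \<longleftrightarrow> (\<exists>F\<in>faces M. v \<in> F)"
proof
  assume "comparable v"
  then consider F where "F \<in> positive_faces M" "v \<in> F" | F where "F \<in> positive_faces M" "- v \<in> F"
    unfolding comparable_def tits_cone_def by blast
  then show "\<exists>F\<in>faces M. v \<in> F"
  proof cases
    case 1 then show ?thesis by (auto simp: faces_def with_opposites_def)
  next
    case (2 F)
    then have "v \<in> uminus ` F" by force
    then show ?thesis using 2(1) by (auto simp: faces_def with_opposites_def)
  qed
next
  assume "\<exists>F\<in>faces M. v \<in> F"
  then show "comparable v"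
    unfolding comparable_def tits_cone_def faces_def with_opposites_def by auto
qed

lemma comparable_Wv: "w \<in> Wv M \<Longrightarrow> comparable v \<Longrightarrow> comparable (w v)"
  unfolding comparable_iff using face_Wv by (metis imageI)

lemma comparable_chamber: "C \<in> chambers M \<Longrightarrow> c \<in> C \<Longrightarrow> comparable c"
  unfolding comparable_iff using chamber_is_face by blast

section \<open>The affine Weyl group\<close>

lemma Wa_affine:
  assumes "g \<in> Wa M"
  obtains w t where "w \<in> Wv M" "g = (\<lambda>v. w v + t)"
proof -
  have "\<exists>w\<in>Wv M. \<exists>t. g = (\<lambda>v. w v + t)"
    using assms unfolding Wa_def
  proof (induction rule: generated.induct)
    case gen_id
    show ?case using Wv_id by (intro bexI[of _ id] exI[of _ 0]) auto
  next
    case (gen_base s)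
    then obtain w i k where w: "w \<in> Wv M"
      and s: "s = affine_reflection (sroot M i \<circ> inv w) (w (scoroot M i)) k"
      unfolding root_pairs_def by auto
    have "s v = (w \<circ> srefl M i \<circ> inv w) v + (- k *\<^sub>R w (scoroot M i))" for v
      unfolding s affine_reflection_def srefl_def
      by (simp add: linear_diff[OF Wv_linear[OF w]] linear_cmul[OF Wv_linear[OF w]]
          Wv_inv_apply[OF w] algebra_simps)
    moreover have "w \<circ> srefl M i \<circ> inv w \<in> Wv M" by (intro Wv_comp w Wv_srefl Wv_inv)
    ultimately show ?case by blast
  next
    case (gen_inv g)
    then obtain w t where w: "w \<in> Wv M" "g = (\<lambda>v. w v + t)" by blast
    have "g (inv w v + (- inv w t)) = v" for v
      by (simp add: w(2) linear_diff[OF Wv_linear[OF w(1)]] Wv_inv_apply[OF w(1)])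
    moreover have "inv w (g v) + (- inv w t) = v" for v
      by (simp add: w(2) linear_add[OF Wv_linear[OF Wv_inv[OF w(1)]]] Wv_inv_apply[OF w(1)])
    ultimately have "inv g = (\<lambda>v. inv w v + (- inv w t))"
      by (intro inv_equality) auto
    then show ?case using Wv_inv[OF w(1)] by blast
  next
    case (gen_comp g h)
    then obtain w t u s where "w \<in> Wv M" "g = (\<lambda>v. w v + t)" "u \<in> Wv M" "h = (\<lambda>v. u v + s)"
      by blast
    then have "g \<circ> h = (\<lambda>v. (w \<circ> u) v + (w s + t))" "w \<circ> u \<in> Wv M"
      by (auto simp: linear_add[OF Wv_linear] Wv_comp)
    then show ?case by blast
  qed
  then show ?thesis using that by blast
qed

lemma Wa_id: "id \<in> Wa M" and Wa_inv: "w \<in> Wa M \<Longrightarrow> inv w \<in> Wa M"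
  and Wa_comp: "w \<in> Wa M \<Longrightarrow> u \<in> Wa M \<Longrightarrow> w \<circ> u \<in> Wa M"
  unfolding Wa_def by (auto intro: generated.intros)

lemma Wa_bij: assumes "g \<in> Wa M" shows "bij g"
proof -
  obtain w t where w: "w \<in> Wv M" "g = (\<lambda>v. w v + t)" by (rule Wa_affine[OF assms])
  have "g = (\<lambda>v. v + t) \<circ> w" using w by auto
  moreover have "bij (\<lambda>v. v + t)" by (rule bijI') (auto, metis diff_add_cancel)
  ultimately show ?thesis using Wv_bij[OF w(1)] bij_comp by blast
qed

lemma Wa_inv_apply: "w \<in> Wa M \<Longrightarrow> inv w (w v) = v" "w \<in> Wa M \<Longrightarrow> w (inv w v) = v"
  using Wa_bij by (auto simp: bij_is_inj bij_is_surj surj_f_inv_f)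

lemma Wa_segment:
  assumes "g \<in> Wa M" shows "g (x + s *\<^sub>R (y - x)) = g x + s *\<^sub>R (g y - g x)"
proof -
  obtain w t where w: "w \<in> Wv M" "g = (\<lambda>v. w v + t)" by (rule Wa_affine[OF assms])
  then show ?thesis
    by (simp add: linear_add[OF Wv_linear] linear_diff[OF Wv_linear] linear_cmul[OF Wv_linear]
        algebra_simps)
qed

lemma Wa_comparable:
  assumes "g \<in> Wa M" "comparable (x - y)" shows "comparable (g x - g y)"
proof -
  obtain w t where w: "w \<in> Wv M" "g = (\<lambda>v. w v + t)" by (rule Wa_affine[OF assms(1)])
  then have "g x - g y = w (x - y)" by (simp add: linear_diff[OF Wv_linear])
  then show ?thesis using comparable_Wv[OF w(1) assms(2)] by simp
qed

lemma Wa_open: assumes "g \<in> Wa M" "open S" shows "open (g ` S)"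
proof -
  obtain w t where w: "w \<in> Wv M" "g = (\<lambda>v. w v + t)" by (rule Wa_affine[OF assms(1)])
  then have "g ` S = (+) t ` w ` S" by (auto simp: image_image add.commute)
  then show ?thesis using open_translation[OF open_Wv_image[OF w(1) assms(2)]] by simp
qed

lemma Wa_eq_on_open:
  assumes "g \<in> Wa M" "h \<in> Wa M" "open S" "S \<noteq> {}" "\<And>x. x \<in> S \<Longrightarrow> g x = h x"
  shows "g = h"
proof
  fix y
  obtain a where a: "a \<in> S" using assms(4) by blast
  have "((\<lambda>s. a + s *\<^sub>R (y - a)) \<longlongrightarrow> a + 0 *\<^sub>R (y - a)) (at_right (0::real))"
    by (intro tendsto_intros)
  then have "\<forall>\<^sub>F s in at_right (0::real). a + s *\<^sub>R (y - a) \<in> S"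
    using topological_tendstoD[OF _ assms(3)] a by fastforce
  moreover have "\<forall>\<^sub>F s in at_right (0::real). s > 0" by (simp add: eventually_at_right_less)
  ultimately have "\<forall>\<^sub>F s in at_right (0::real). a + s *\<^sub>R (y - a) \<in> S \<and> s > 0"
    by eventually_elim simp
  then obtain s where s: "a + s *\<^sub>R (y - a) \<in> S" "s > 0"
    using eventually_happens'[of "at_right (0::real)"] by fastforce
  have "g a + s *\<^sub>R (g y - g a) = h a + s *\<^sub>R (h y - h a)"
    using assms(5)[OF s(1)] Wa_segment[OF assms(1)] Wa_segment[OF assms(2)] by metis
  then show "g y = h y" using assms(5)[OF a] s(2) by simp
qed

end

section \<open>Roots of the Kac--Moody algebra\<close>

text \<open>Climb from a vector of weight \<open>m\<close> to a vector \<open>v\<close> killed by \<open>E\<close>, of weight \<open>\<mu>\<close> say.  The first power of \<open>F\<close>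
  that kills \<open>v\<close> has exponent \<open>\<mu> + 1\<close>, because \<open>E F\<^sup>j\<^sup>+\<^sup>1 v = (j + 1)(\<mu> - j) F\<^sup>j v\<close>; so the descent from \<open>v\<close>
  does reach the weight \<open>- m\<close>.\<close>

lemma sl2_opposite_weight:
  fixes E F H :: "'g::real_vector \<Rightarrow> 'g"
  assumes lin: "linear E" "linear F" "linear H"
    and EF: "\<And>y. E (F y) - F (E y) = H y"
    and HE: "\<And>y. H (E y) = E (H y) + 2 *\<^sub>R E y"
    and HF: "\<And>y. H (F y) = F (H y) - 2 *\<^sub>R F y"
    and nilE: "\<And>y. \<exists>n. (E ^^ n) y = 0" and nilF: "\<And>y. \<exists>n. (F ^^ n) y = 0"
    and x: "x \<noteq> 0" "H x = m *\<^sub>R x" "m \<ge> 0"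
  shows "\<exists>a k. (F ^^ k) ((E ^^ a) x) \<noteq> 0 \<and> real k = real a + m"
proof -
  define p where "p = (LEAST n. (E ^^ n) x = 0)"
  have p0: "(E ^^ p) x = 0" unfolding p_def using nilE by (rule LeastI_ex)
  then have "p \<noteq> 0" using x(1) by (metis funpow_0)
  then obtain a where a: "p = Suc a" using not0_implies_Suc by blast
  define v where "v = (E ^^ a) x"
  have v: "v \<noteq> 0" unfolding v_def using not_less_Least[of a "\<lambda>n. (E ^^ n) x = 0"] a p_def by auto
  have Ev: "E v = 0" using p0 a v_def by simp
  have wE: "H ((E ^^ j) x) = (m + 2 * real j) *\<^sub>R (E ^^ j) x" for j
    by (induction j) (simp_all add: x(2) HE linear_cmul[OF lin(1)] algebra_simps flip: scaleR_add_left)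
  define \<mu> where "\<mu> = m + 2 * real a"
  have wF: "H ((F ^^ j) v) = (\<mu> - 2 * real j) *\<^sub>R (F ^^ j) v" for j
    by (induction j)
       (simp_all add: wE[of a, folded v_def \<mu>_def] HF linear_cmul[OF lin(2)] algebra_simps
         flip: scaleR_add_left scaleR_diff_left)
  have EFj: "E ((F ^^ Suc j) v) = (real (Suc j) * (\<mu> - real j)) *\<^sub>R (F ^^ j) v" for j
  proof (induction j)
    case 0
    show ?case using EF[of v] Ev wF[of 0] by (simp add: linear_0[OF lin(2)])
  next
    case (Suc j)
    let ?u = "(F ^^ Suc j) v"
    have "E (F ?u) = F (E ?u) + H ?u" using EF[of ?u] by (simp add: algebra_simps)
    also have "\<dots> = (real (Suc j) * (\<mu> - real j)) *\<^sub>R ?u + (\<mu> - 2 * real (Suc j)) *\<^sub>R ?u"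
      unfolding Suc.IH wF by (simp add: linear_cmul[OF lin(2)])
    also have "\<dots> = (real (Suc (Suc j)) * (\<mu> - real (Suc j))) *\<^sub>R ?u"
      unfolding scaleR_add_left[symmetric] by (rule arg_cong[of _ _ "\<lambda>c. c *\<^sub>R ?u"]) (simp add: algebra_simps)
    finally show ?case by simp
  qed
  define q where "q = (LEAST n. (F ^^ n) v = 0)"
  have q0: "(F ^^ q) v = 0" unfolding q_def using nilF by (rule LeastI_ex)
  then have "q \<noteq> 0" using v by (metis funpow_0)
  then obtain b where b: "q = Suc b" using not0_implies_Suc by blast
  have nz: "(F ^^ j) v \<noteq> 0" if "j \<le> b" for j
    using not_less_Least[of j "\<lambda>n. (F ^^ n) v = 0"] b that q_def by auto
  have "(real (Suc b) * (\<mu> - real b)) *\<^sub>R (F ^^ b) v = 0"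
    using EFj[of b] q0 b by (simp add: linear_0[OF lin(1)])
  then have mu: "\<mu> = real b" using nz[of b] by simp
  have "a \<le> b" using mu x(3) \<mu>_def by linarith
  then have "(F ^^ (b - a)) v \<noteq> 0" "real (b - a) = real a + m"
    using nz mu \<mu>_def by (auto simp: of_nat_diff)
  then show ?thesis unfolding v_def by blast
qed

text \<open>If \<open>\<alpha>\<close> and \<open>\<omega> b\<close> differ at \<open>h\<close>, the operator \<open>B h - \<omega> b h\<close> removes \<open>b\<close> from the sum, and it acts on \<open>x\<close> by
  a nonzero scalar.\<close>

lemma weight_of_sum:
  fixes B :: "'h \<Rightarrow> 'g::real_vector \<Rightarrow> 'g"
  assumes lin: "\<And>h. linear (B h)" and "finite T"
    and "\<And>b. b \<in> T \<Longrightarrow> \<omega> b \<noteq> \<alpha>" "\<And>b h. b \<in> T \<Longrightarrow> B h b = \<omega> b h *\<^sub>R b"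
    and "x = (\<Sum>b\<in>T. r b *\<^sub>R b)" "\<And>h. B h x = (\<alpha> h :: real) *\<^sub>R x"
  shows "x = 0"
  using assms(2-)
proof (induction T arbitrary: x r rule: finite_induct)
  case (insert b T)
  obtain h where h: "\<alpha> h \<noteq> \<omega> b h" using insert.prems(1)[of b] by (metis ext insertI1)
  have Bx: "B h x = (\<Sum>c\<in>insert b T. (r c * \<omega> c h) *\<^sub>R c)"
    unfolding insert.prems(3)
    by (simp add: linear_sum[OF lin] linear_cmul[OF lin] insert.prems(2) insert.hyps
        linear_add[OF lin])
  let ?y = "(\<alpha> h - \<omega> b h) *\<^sub>R x"
  have "?y = B h x - \<omega> b h *\<^sub>R x" using insert.prems(4) by (simp add: algebra_simps)
  also have "\<dots> = (\<Sum>c\<in>insert b T. (r c * (\<omega> c h - \<omega> b h)) *\<^sub>R c)"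
    unfolding Bx unfolding insert.prems(3) scaleR_sum_right sum_subtractf[symmetric]
    by (rule sum.cong) (simp_all add: algebra_simps)
  also have "\<dots> = (\<Sum>c\<in>T. (r c * (\<omega> c h - \<omega> b h)) *\<^sub>R c)" using insert.hyps by simp
  finally have y: "?y = (\<Sum>c\<in>T. (r c * (\<omega> c h - \<omega> b h)) *\<^sub>R c)" .
  have "?y = 0"
    by (rule insert.IH[OF _ _ y])
       (use insert.prems in \<open>auto simp: linear_cmul[OF lin]\<close>)
  then show ?case using h by simp
qed simp

locale kac_moody_data = root_data M
  for M :: "('i::finite, 'v::euclidean_space, 'g::real_vector) apartment_data" +
  assumes kac_moody: "kac_moody_algebra M"
begin

abbreviation "br \<equiv> bracket M"

lemma bilinear_br: "bilinear br" and br_self: "br x x = 0"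
  and jacobi: "br x (br y z) + br y (br z x) + br z (br x y) = 0"
  using kac_moody by (auto simp: kac_moody_algebra_def lie_algebra_def)

lemma linear_br: "linear (br x)" using bilinear_br by (simp add: bilinear_def)

lemmas br_simps = bilinear_ladd[OF bilinear_br] bilinear_radd[OF bilinear_br]
  bilinear_lmul[OF bilinear_br] bilinear_rmul[OF bilinear_br]
  bilinear_lneg[OF bilinear_br] bilinear_rneg[OF bilinear_br]
  bilinear_lzero[OF bilinear_br] bilinear_rzero[OF bilinear_br]
  bilinear_lsub[OF bilinear_br] bilinear_rsub[OF bilinear_br]

lemma br_swap: "br x y = - br y x"
proof -
  have "br x y + br y x = 0" using br_self[of "x + y", unfolded br_simps] by (simp add: br_self add.commute)
  then show ?thesis by (simp add: eq_neg_iff_add_eq_0)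
qed

text \<open>The Jacobi identity says that \<open>ad x\<close> is a derivation.\<close>

lemma br_br: "br x (br y z) = br (br x y) z + br y (br x z)"
proof -
  have "br y (br z x) = - br y (br x z)" using br_swap[of z x] by (simp add: br_simps)
  moreover have "br z (br x y) = - br (br x y) z" by (rule br_swap)
  ultimately show ?thesis using jacobi[of x y z] by (simp add: algebra_simps)
qed

lemma
  shows linear_cartan: "linear (cartan M)" and inj_cartan: "inj (cartan M)"
    and br_cartan: "br (cartan M h) (cartan M h') = 0"
    and br_he: "br (cartan M h) (egen M i) = sroot M i h *\<^sub>R egen M i"
    and br_hf: "br (cartan M h) (fgen M i) = - sroot M i h *\<^sub>R fgen M i"
    and br_ef: "br (egen M i) (fgen M j) = (if i = j then cartan M (scoroot M i) else 0)"
  using kac_moody unfolding kac_moody_algebra_def by auto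

lemma serre_e: "i \<noteq> j \<Longrightarrow> \<exists>n. (br (egen M i) ^^ n) (egen M j) = 0"
  and serre_f: "i \<noteq> j \<Longrightarrow> \<exists>n. (br (fgen M i) ^^ n) (fgen M j) = 0"
proof -
  have "\<forall>i j. i \<noteq> j \<longrightarrow>
      (br (egen M i) ^^ nat \<lfloor>1 - cartan_matrix M i j\<rfloor>) (egen M j) = 0 \<and>
      (br (fgen M i) ^^ nat \<lfloor>1 - cartan_matrix M i j\<rfloor>) (fgen M j) = 0"
    using kac_moody unfolding kac_moody_algebra_def by (elim conjE) assumption
  then show "i \<noteq> j \<Longrightarrow> \<exists>n. (br (egen M i) ^^ n) (egen M j) = 0"
    and "i \<noteq> j \<Longrightarrow> \<exists>n. (br (fgen M i) ^^ n) (fgen M j) = 0" by auto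
qed

lemma br_fe: "br (fgen M i) (egen M j) = (if i = j then - cartan M (scoroot M i) else 0)"
  using br_swap[of "fgen M i" "egen M j"] br_ef[of j i] by auto

lemma generated_by_chevalley:
  assumes "subspace N" "\<And>x y. x \<in> N \<Longrightarrow> y \<in> N \<Longrightarrow> br x y \<in> N"
    "\<And>h. cartan M h \<in> N" "\<And>i. egen M i \<in> N" "\<And>i. fgen M i \<in> N"
  shows "N = UNIV"
proof -
  have "lie_subalgebra br N" unfolding lie_subalgebra_def using assms by blast
  moreover have "range (cartan M) \<union> range (egen M) \<union> range (fgen M) \<subseteq> N" using assms by blast
  moreover have "\<forall>N. lie_subalgebra br N \<longrightarrow>
      range (cartan M) \<union> range (egen M) \<union> range (fgen M) \<subseteq> N \<longrightarrow> N = UNIV"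
    using kac_moody unfolding kac_moody_algebra_def by (elim conjE) assumption
  ultimately show ?thesis by simp
qed

text \<open>By the Leibniz rule, \<open>(ad z)\<^sup>p\<^sup>+\<^sup>q [x, y]\<close> is a sum of terms in which \<open>x\<close> is hit at least \<open>p\<close> times or \<open>y\<close>
  at least \<open>q\<close> times.  Hence the local nilpotency of \<open>ad z\<close> can be checked on generators.\<close>

lemma nilpotent_br:
  assumes "(br z ^^ p) x = 0" "(br z ^^ q) y = 0" shows "(br z ^^ (p + q)) (br x y) = 0"
  using assms
proof (induction "p + q" arbitrary: p q x y)
  case 0
  then show ?case by (simp add: br_simps)
next
  case (Suc n)
  have z: "(br z ^^ k) 0 = 0" for k by (induction k) (simp_all add: br_simps)
  have add: "(br z ^^ k) (a + b) = (br z ^^ k) a + (br z ^^ k) b" for k a b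
    by (induction k) (simp_all add: br_simps)
  have sh: "(br z ^^ Suc n) u = (br z ^^ n) (br z u)" for u by (simp only: funpow_Suc_right o_apply)
  have 1: "(br z ^^ n) (br (br z x) y) = 0"
  proof (cases p)
    case 0
    then have "x = 0" using Suc.prems by simp
    then show ?thesis by (simp add: br_simps z)
  next
    case (Suc p')
    then have "(br z ^^ p') (br z x) = 0" using Suc.prems(1) by (simp only: funpow_Suc_right o_apply)
    moreover have "n = p' + q" using \<open>Suc n = p + q\<close> Suc by simp
    ultimately show ?thesis using Suc.hyps(1)[of p' q "br z x" y] Suc.prems(2) by simp
  qed
  have 2: "(br z ^^ n) (br x (br z y)) = 0"
  proof (cases q)
    case 0
    then have "y = 0" using Suc.prems by simp
    then show ?thesis by (simp add: br_simps z)
  next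
    case (Suc q')
    then have "(br z ^^ q') (br z y) = 0" using Suc.prems(2) by (simp only: funpow_Suc_right o_apply)
    moreover have "n = p + q'" using \<open>Suc n = p + q\<close> Suc by simp
    ultimately show ?thesis using Suc.hyps(1)[of p q' x "br z y"] Suc.prems(1) by simp
  qed
  show ?case unfolding \<open>Suc n = p + q\<close>[symmetric] sh br_br[of z x y] add using 1 2 by simp
qed

lemma locally_nilpotent_of_generators:
  assumes "\<And>h. \<exists>n. (br z ^^ n) (cartan M h) = 0" "\<And>i. \<exists>n. (br z ^^ n) (egen M i) = 0"
    "\<And>i. \<exists>n. (br z ^^ n) (fgen M i) = 0"
  shows "\<exists>n. (br z ^^ n) x = 0"
proof -
  have z: "(br z ^^ k) 0 = 0" for k by (induction k) (simp_all add: br_simps)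
  have add: "(br z ^^ k) (a + b) = (br z ^^ k) a + (br z ^^ k) b" for k a b
    by (induction k) (simp_all add: br_simps)
  have mul: "(br z ^^ k) (c *\<^sub>R a) = c *\<^sub>R (br z ^^ k) a" for k c a
    by (induction k) (simp_all add: br_simps)
  have mono: "(br z ^^ (k + l)) a = 0" if "(br z ^^ k) a = 0" for k l a
    using that by (simp add: add.commute[of k] funpow_add z)
  let ?N = "{x. \<exists>n. (br z ^^ n) x = 0}"
  have "?N = UNIV"
  proof (rule generated_by_chevalley)
    show "subspace ?N"
    proof (rule subspaceI)
      fix x y assume "x \<in> ?N" "y \<in> ?N"
      then obtain k l where "(br z ^^ k) x = 0" "(br z ^^ l) y = 0" by blast
      then have "(br z ^^ (k + l)) (x + y) = 0" using mono[of k x l] mono[of l y k]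
        by (simp add: add add.commute)
      then show "x + y \<in> ?N" by blast
    next
      fix c x assume "x \<in> ?N" then show "c *\<^sub>R x \<in> ?N" using mul by fastforce
    qed (use z in blast)
  qed (use assms nilpotent_br in blast)+
  then show ?thesis by blast
qed

lemma nilpotent_e: "\<exists>n. (br (egen M i) ^^ n) x = 0"
proof (rule locally_nilpotent_of_generators)
  have hn: "(br (egen M i) ^^ 2) (cartan M h) = 0" for h
    using br_swap[of "egen M i" "cartan M h"]
    by (simp add: numeral_2_eq_2 br_he br_simps br_self)
  show "\<exists>n. (br (egen M i) ^^ n) (cartan M h) = 0" for h using hn by blast
  show "\<exists>n. (br (egen M i) ^^ n) (egen M j) = 0" for j
  proof (cases "i = j")
    case True
    then show ?thesis by (intro exI[of _ 1]) (simp add: br_self)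
  qed (rule serre_e)
  have "(br (egen M i) ^^ Suc 2) (fgen M j) = 0" for j
    unfolding funpow_Suc_right o_apply br_ef using hn
    by (auto simp: br_simps numeral_2_eq_2)
  then show "\<exists>n. (br (egen M i) ^^ n) (fgen M j) = 0" for j by blast
qed

lemma nilpotent_f: "\<exists>n. (br (fgen M i) ^^ n) x = 0"
proof (rule locally_nilpotent_of_generators)
  have hn: "(br (fgen M i) ^^ 2) (cartan M h) = 0" for h
    using br_swap[of "fgen M i" "cartan M h"]
    by (simp add: numeral_2_eq_2 br_hf br_simps br_self)
  show "\<exists>n. (br (fgen M i) ^^ n) (cartan M h) = 0" for h using hn by blast
  show "\<exists>n. (br (fgen M i) ^^ n) (fgen M j) = 0" for j
  proof (cases "i = j")
    case True
    then show ?thesis by (intro exI[of _ 1]) (simp add: br_self)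
  qed (rule serre_f)
  have "(br (fgen M i) ^^ Suc 2) (egen M j) = 0" for j
    unfolding funpow_Suc_right o_apply br_fe using hn[of "- scoroot M j"]
    by (auto simp: br_simps numeral_2_eq_2 linear_neg[OF linear_cartan])
  then show "\<exists>n. (br (fgen M i) ^^ n) (egen M j) = 0" for j by blast
qed

definition weight_vector :: "('v \<Rightarrow> real) \<Rightarrow> 'g \<Rightarrow> bool" where
  "weight_vector \<alpha> x \<longleftrightarrow> (\<forall>h. br (cartan M h) x = \<alpha> h *\<^sub>R x)"

lemma weight_vector_br:
  assumes "weight_vector \<alpha> x" "weight_vector \<beta> y"
  shows "weight_vector (\<lambda>h. \<alpha> h + \<beta> h) (br x y)"
  using assms unfolding weight_vector_def by (simp add: br_br br_simps scaleR_add_left)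

lemma weight_vector_e: "weight_vector (sroot M i) (egen M i)"
  and weight_vector_f: "weight_vector (\<lambda>h. - sroot M i h) (fgen M i)"
  by (simp_all add: weight_vector_def br_he br_hf)

lemma weight_vector_e_pow:
  "weight_vector \<alpha> x \<Longrightarrow>
     weight_vector (\<lambda>h. \<alpha> h + real n * sroot M i h) ((br (egen M i) ^^ n) x)"
proof (induction n)
  case (Suc n)
  show ?case using weight_vector_br[OF weight_vector_e Suc.IH[OF Suc.prems], of i]
    by (simp add: algebra_simps)
qed simp

lemma weight_vector_f_pow:
  "weight_vector \<alpha> x \<Longrightarrow>
     weight_vector (\<lambda>h. \<alpha> h - real n * sroot M i h) ((br (fgen M i) ^^ n) x)"
proof (induction n)
  case (Suc n)
  show ?case using weight_vector_br[OF weight_vector_f Suc.IH[OF Suc.prems], of i]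
    by (simp add: algebra_simps)
qed simp

lemma km_roots_iff: "\<alpha> \<in> km_roots M \<longleftrightarrow>
    linear \<alpha> \<and> \<alpha> \<noteq> (\<lambda>_. 0) \<and> (\<exists>x. x \<noteq> 0 \<and> weight_vector \<alpha> x)"
  by (simp add: km_roots_def weight_vector_def)

text \<open>The elements \<open>e\<^sub>i\<close>, \<open>f\<^sub>i\<close>, \<open>\<alpha>\<^sub>i\<^sup>\<or>\<close> span a copy of \<open>sl\<^sub>2\<close>, and \<open>ad e\<^sub>i\<close>, \<open>ad f\<^sub>i\<close> are locally nilpotent by
  the Serre relations.  So from a vector of weight \<open>\<alpha>\<close> one gets one of weight \<open>\<alpha> - \<alpha>(\<alpha>\<^sub>i\<^sup>\<or>) \<alpha>\<^sub>i = r\<^sub>i \<alpha>\<close>.\<close>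

lemma km_roots_srefl:
  assumes "\<alpha> \<in> km_roots M" shows "\<alpha> \<circ> srefl M i \<in> km_roots M"
proof -
  obtain x where lin: "linear \<alpha>" and nz: "\<alpha> \<noteq> (\<lambda>_. 0)" and x: "x \<noteq> 0" "weight_vector \<alpha> x"
    using assms by (auto simp: km_roots_iff)
  let ?E = "br (egen M i)" and ?F = "br (fgen M i)" and ?h = "scoroot M i"
  let ?H = "br (cartan M ?h)"
  define m where "m = \<alpha> ?h"
  have refl: "\<alpha> \<circ> srefl M i = (\<lambda>v. \<alpha> v - m * sroot M i v)"
    by (auto simp: srefl_def linear_diff[OF lin] linear_cmul[OF lin] m_def)
  have EF: "?E (?F y) - ?F (?E y) = ?H y" for y
    using br_br[of "egen M i" "fgen M i" y] by (simp add: br_ef)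
  have HE: "?H (?E y) = ?E (?H y) + 2 *\<^sub>R ?E y" for y
    using br_br[of "cartan M ?h" "egen M i" y] by (simp add: br_he sroot_scoroot_self br_simps)
  have HF: "?H (?F y) = ?F (?H y) - 2 *\<^sub>R ?F y" for y
    using br_br[of "cartan M ?h" "fgen M i" y] by (simp add: br_hf sroot_scoroot_self br_simps)
  have Hx: "?H x = m *\<^sub>R x" using x(2) by (simp add: weight_vector_def m_def)
  have "\<exists>y. y \<noteq> 0 \<and> weight_vector (\<lambda>v. \<alpha> v - m * sroot M i v) y"
  proof (cases "m \<ge> 0")
    case True
    obtain a k where ak: "(?F ^^ k) ((?E ^^ a) x) \<noteq> 0" "real k = real a + m"
      using sl2_opposite_weight[OF linear_br linear_br linear_br EF HE HF nilpotent_e nilpotent_f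
          x(1) Hx True] by blast
    have "weight_vector (\<lambda>h. (\<alpha> h + real a * sroot M i h) - real k * sroot M i h)
        ((?F ^^ k) ((?E ^^ a) x))"
      by (intro weight_vector_f_pow weight_vector_e_pow x)
    then show ?thesis using ak by (intro exI[of _ "(?F ^^ k) ((?E ^^ a) x)"]) (simp add: algebra_simps)
  next
    case False
    \<comment> \<open>Exchange the roles of \<open>e\<^sub>i\<close> and \<open>f\<^sub>i\<close>; then \<open>\<alpha>\<^sub>i\<^sup>\<or>\<close> changes sign.\<close>
    let ?H' = "\<lambda>y. - ?H y"
    have "linear ?H'" by (intro linear_compose_neg linear_br)
    moreover have "?F (?E y) - ?E (?F y) = ?H' y" for y using EF[of y] by (simp add: algebra_simps)
    moreover have "?H' (?F y) = ?F (?H' y) + 2 *\<^sub>R ?F y" for y using HF[of y] by (simp add: br_simps)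
    moreover have "?H' (?E y) = ?E (?H' y) - 2 *\<^sub>R ?E y" for y using HE[of y] by (simp add: br_simps)
    moreover have "?H' x = (- m) *\<^sub>R x" "- m \<ge> 0" using Hx False by auto
    ultimately obtain a k where ak: "(?E ^^ k) ((?F ^^ a) x) \<noteq> 0" "real k = real a + - m"
      using sl2_opposite_weight[OF linear_br linear_br _ _ _ _ nilpotent_f nilpotent_e x(1),
          of ?H' i i "- m"] by blast
    have "weight_vector (\<lambda>h. (\<alpha> h - real a * sroot M i h) + real k * sroot M i h)
        ((?E ^^ k) ((?F ^^ a) x))"
      by (intro weight_vector_f_pow weight_vector_e_pow x)
    then show ?thesis using ak by (intro exI[of _ "(?E ^^ k) ((?F ^^ a) x)"]) (simp add: algebra_simps)
  qed
  moreover have "\<alpha> \<circ> srefl M i \<noteq> (\<lambda>_. 0)"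
  proof
    assume "\<alpha> \<circ> srefl M i = (\<lambda>_. 0)"
    then have "\<alpha> (srefl M i (srefl M i v)) = 0" for v by (metis comp_apply)
    then show False using nz by (simp add: srefl_srefl fun_eq_iff)
  qed
  ultimately show ?thesis
    unfolding km_roots_iff using linear_compose[OF linear_srefl lin, of i] refl by metis
qed

lemma km_roots_Wv:
  assumes "w \<in> Wv M" "\<alpha> \<in> km_roots M" shows "\<alpha> \<circ> w \<in> km_roots M"
proof -
  have "\<forall>\<alpha>\<in>km_roots M. \<alpha> \<circ> w \<in> km_roots M \<and> \<alpha> \<circ> inv w \<in> km_roots M"
    using assms(1) unfolding Wv_def WvJ_def
  proof (induction rule: generated.induct)
    case gen_id
    then show ?case by (simp add: inv_id)
  next
    case (gen_base s)
    then obtain i where "s = srefl M i" by blast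
    moreover have "inv (srefl M i) = srefl M i" by (rule inv_equality) (simp_all add: srefl_srefl)
    ultimately show ?case using km_roots_srefl[of _ i] by (simp del: o_apply)
  next
    case (gen_inv g)
    then have "bij g" using Wv_bij unfolding Wv_def WvJ_def by blast
    then show ?case using gen_inv by (simp add: inv_inv_eq)
  next
    case (gen_comp g h)
    then have "bij g" "bij h" using Wv_bij unfolding Wv_def WvJ_def by blast+
    then show ?case using gen_comp.IH by (simp add: o_inv_distrib o_assoc del: o_apply)
  qed
  then show ?thesis using assms(2) by blast
qed

lemma sroot_nonzero: "sroot M i \<noteq> (\<lambda>_. 0)"
  using sroot_scoroot_self[of i] by (metis zero_neq_numeral)

lemma sroot_km_root: "sroot M i \<in> km_roots M"
proof -
  have "cartan M (scoroot M i) \<noteq> 0"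
  proof
    assume "cartan M (scoroot M i) = 0"
    then have "scoroot M i = 0" using inj_cartan linear_0[OF linear_cartan] by (metis injD)
    then show False using sroot_scoroot_self[of i] linear_0[OF linear_sroot] by simp
  qed
  then have "egen M i \<noteq> 0" using br_ef[of i i] by (metis bilinear_lzero[OF bilinear_br])
  then show ?thesis using linear_sroot sroot_nonzero weight_vector_e by (auto simp: km_roots_iff)
qed

lemma real_roots_km: "real_roots M \<subseteq> km_roots M"
  unfolding real_roots_def root_pairs_def using km_roots_Wv[OF Wv_inv sroot_km_root] by auto

text \<open>Since the simple roots are weights of the \<open>e\<^sub>i\<close>, all real roots are roots of the algebra, and the
  union of real and imaginary roots is just the set of all its roots.\<close>

lemma all_roots: "real_roots M \<union> imaginary_roots M = km_roots M"
  using real_roots_km unfolding imaginary_roots_def by blast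

lemma real_roots_Wv:
  assumes "w \<in> Wv M" "\<alpha> \<in> real_roots M" shows "\<alpha> \<circ> w \<in> real_roots M"
proof -
  obtain u i where u: "u \<in> Wv M" "\<alpha> = sroot M i \<circ> inv u"
    using assms(2) unfolding real_roots_def root_pairs_def by auto
  have "\<alpha> \<circ> w = sroot M i \<circ> inv (inv w \<circ> u)"
    unfolding u(2) using Wv_bij[OF assms(1)] Wv_bij[OF u(1)]
    by (simp add: o_inv_distrib bij_imp_bij_inv inv_inv_eq o_assoc)
  then show ?thesis unfolding real_roots_def root_pairs_def
    using Wv_comp[OF Wv_inv[OF assms(1)] u(1)] by force
qed

subsection \<open>The triangular decomposition\<close>

text \<open>Iterated brackets \<open>[x\<^sub>i\<^sub>1, [x\<^sub>i\<^sub>2, \<dots>, x\<^sub>i\<^sub>k]]\<close> with their weights; they span the positive part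
  for \<open>x = egen\<close> and the negative part for \<open>x = fgen\<close>.\<close>

inductive word :: "('i \<Rightarrow> 'g) \<Rightarrow> ('i \<Rightarrow> 'v \<Rightarrow> real) \<Rightarrow> 'g \<Rightarrow> ('v \<Rightarrow> real) \<Rightarrow> bool" for e s where
  word_gen: "word e s (e i) (s i)"
| word_br: "word e s u \<beta> \<Longrightarrow> word e s (br (e i) u) (\<lambda>v. s i v + \<beta> v)"

definition words :: "('i \<Rightarrow> 'g) \<Rightarrow> ('i \<Rightarrow> 'v \<Rightarrow> real) \<Rightarrow> 'g set" where
  "words e s = {u. \<exists>\<beta>. word e s u \<beta>}"

lemma word_weight:
  assumes "word e s u \<beta>" "\<And>i. weight_vector (s i) (e i)" shows "weight_vector \<beta> u"
  using assms by induction (auto intro: weight_vector_br)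

lemma word_weight_e: "word (egen M) (sroot M) u \<beta> \<Longrightarrow> weight_vector \<beta> u"
  and word_weight_f: "word (fgen M) (\<lambda>i v. - sroot M i v) u \<beta> \<Longrightarrow> weight_vector \<beta> u"
  by (erule word_weight, rule weight_vector_e weight_vector_f)+

lemma br_e_span_words:
  assumes x: "x \<in> span (words e s \<union> range (cartan M))" and s: "\<And>i. weight_vector (s i) (e i)"
  shows "br (e i) x \<in> span (words e s)"
proof -
  have "br (e i) ` (words e s \<union> range (cartan M)) \<subseteq> span (words e s)"
  proof -
    have "br (e i) u \<in> span (words e s)" if "u \<in> words e s" for u
      using that by (intro span_base) (auto simp: words_def intro: word.intros)
    moreover have "br (e i) (cartan M h) \<in> span (words e s)" for h
    proof -
      have "e i \<in> words e s" unfolding words_def using word_gen by blast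
      moreover have "br (e i) (cartan M h) = (- s i h) *\<^sub>R e i"
        using br_swap[of "e i"] s[of i] by (simp add: weight_vector_def)
      ultimately show ?thesis by (simp add: span_base span_neg span_scale)
    qed
    ultimately show ?thesis by auto
  qed
  then have "span (br (e i) ` (words e s \<union> range (cartan M))) \<subseteq> span (words e s)"
    by (intro span_minimal subspace_span)
  then show ?thesis using x linear_span_image[OF linear_br, of "e i"] by blast
qed

text \<open>By induction on the word: \<open>[f\<^sub>j, [e\<^sub>i, u]] = [[f\<^sub>j, e\<^sub>i], u] + [e\<^sub>i, [f\<^sub>j, u]]\<close>, and \<open>[f\<^sub>j, e\<^sub>i]\<close> lies in the Cartan
  subalgebra, which acts on \<open>u\<close> by a scalar.  The roles of \<open>e\<close> and \<open>f\<close> may be exchanged.\<close>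

lemma br_f_word:
  assumes "word e s u \<beta>" "\<And>i. weight_vector (s i) (e i)"
    and f: "\<And>i j. br (f j) (e i) \<in> range (cartan M)"
  shows "br (f j) u \<in> span (words e s \<union> range (cartan M))"
  using assms(1)
proof induction
  case (word_gen i)
  show ?case using f by (intro span_base) blast
next
  case (word_br u \<beta> i)
  obtain h where "br (f j) (e i) = cartan M h" using f by blast
  then have "br (br (f j) (e i)) u = \<beta> h *\<^sub>R u"
    using word_weight[OF word_br.hyps assms(2)] by (simp add: weight_vector_def)
  moreover have "u \<in> words e s" using word_br.hyps unfolding words_def by blast
  ultimately have "br (br (f j) (e i)) u \<in> span (words e s \<union> range (cartan M))"
    by (simp add: span_base span_scale)
  moreover have "br (e i) (br (f j) u) \<in> span (words e s \<union> range (cartan M))"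
    using br_e_span_words[OF word_br.IH assms(2)] span_mono[of "words e s"] by blast
  ultimately show ?case unfolding br_br[of "f j"] by (rule span_add)
qed

abbreviation "wordsE \<equiv> words (egen M) (sroot M)"
abbreviation "wordsF \<equiv> words (fgen M) (\<lambda>i v. - sroot M i v)"

lemma triangular_decomposition: "span (wordsE \<union> wordsF \<union> range (cartan M)) = UNIV"
proof -
  let ?B = "wordsE \<union> wordsF \<union> range (cartan M)"
  have fe: "br (fgen M j) (egen M i) \<in> range (cartan M)" for i j
    unfolding br_fe using linear_neg[OF linear_cartan, of "scoroot M j"] linear_0[OF linear_cartan]
    by (metis rangeI)
  have ef: "br (egen M j) (fgen M i) \<in> range (cartan M)" for i j
    unfolding br_ef using linear_0[OF linear_cartan] by (metis rangeI)
  have sub: "span (wordsE \<union> range (cartan M)) \<subseteq> span ?B"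
    "span (wordsF \<union> range (cartan M)) \<subseteq> span ?B"
    "span wordsE \<subseteq> span ?B" "span wordsF \<subseteq> span ?B"
    by (intro span_mono; blast)+
  have closed: "br z x \<in> span ?B" if "\<And>b. b \<in> ?B \<Longrightarrow> br z b \<in> span ?B" "x \<in> span ?B" for z x
  proof -
    have "span (br z ` ?B) \<subseteq> span ?B"
      using that(1) by (intro span_minimal subspace_span image_subsetI)
    then show ?thesis using that(2) linear_span_image[OF linear_br, of z ?B] by blast
  qed
  have e: "br (egen M i) x \<in> span ?B" if "x \<in> span ?B" for i x
  proof (rule closed[OF _ that])
    fix b assume "b \<in> ?B"
    then consider "b \<in> wordsE \<union> range (cartan M)" | "b \<in> wordsF" by blast
    then show "br (egen M i) b \<in> span ?B"
    proof cases
      case 1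
      then have "br (egen M i) b \<in> span wordsE"
        by (intro br_e_span_words span_base weight_vector_e)
      then show ?thesis using sub(3) by blast
    next
      case 2
      then obtain \<beta> where \<beta>: "word (fgen M) (\<lambda>i v. - sroot M i v) b \<beta>" unfolding words_def by blast
      have "br (egen M i) b \<in> span (wordsF \<union> range (cartan M))"
        by (rule br_f_word[OF \<beta> weight_vector_f ef])
      then show ?thesis using sub(2) by blast
    qed
  qed
  have f: "br (fgen M i) x \<in> span ?B" if "x \<in> span ?B" for i x
  proof (rule closed[OF _ that])
    fix b assume "b \<in> ?B"
    then consider "b \<in> wordsF \<union> range (cartan M)" | "b \<in> wordsE" by blast
    then show "br (fgen M i) b \<in> span ?B"
    proof cases
      case 1
      then have "br (fgen M i) b \<in> span wordsF"
        by (intro br_e_span_words span_base weight_vector_f)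
      then show ?thesis using sub(4) by blast
    next
      case 2
      then obtain \<beta> where \<beta>: "word (egen M) (sroot M) b \<beta>" unfolding words_def by blast
      have "br (fgen M i) b \<in> span (wordsE \<union> range (cartan M))"
        by (rule br_f_word[OF \<beta> weight_vector_e fe])
      then show ?thesis using sub(1) by blast
    qed
  qed
  have h: "br (cartan M h) x \<in> span ?B" if "x \<in> span ?B" for h x
  proof (rule closed[OF _ that])
    fix b assume b: "b \<in> ?B"
    then consider "b \<in> wordsE" | "b \<in> wordsF" | "b \<in> range (cartan M)" by blast
    then have "\<exists>c. br (cartan M h) b = c *\<^sub>R b"
    proof cases
      case 1
      then show ?thesis using word_weight_e
        unfolding words_def weight_vector_def by blast
    next
      case 2
      then show ?thesis using word_weight_f
        unfolding words_def weight_vector_def by blast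
    next
      case 3
      then show ?thesis by (intro exI[of _ 0]) (auto simp: br_cartan)
    qed
    then show "br (cartan M h) b \<in> span ?B" using b by (auto simp: span_base span_scale)
  qed
  \<comment> \<open>The normaliser of the span is a subalgebra containing the generators, so the span is an ideal.\<close>
  let ?S = "{z. \<forall>x\<in>span ?B. br z x \<in> span ?B}"
  have "?S = UNIV"
  proof (rule generated_by_chevalley)
    show "subspace ?S"
      by (rule subspaceI) (auto simp: br_simps span_zero span_add span_scale)
    fix y z assume yz: "y \<in> ?S" "z \<in> ?S"
    have "br (br y z) x \<in> span ?B" if "x \<in> span ?B" for x
    proof -
      have "br (br y z) x = br y (br z x) - br z (br y x)" using br_br[of y z x] by simp
      then show ?thesis using yz that by (simp add: span_diff)
    qed
    then show "br y z \<in> ?S" by blast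
  qed (use e f h in auto)
  then have "br z x \<in> span ?B" if "x \<in> span ?B" for z x using that by blast
  moreover have "egen M i \<in> span ?B" "fgen M i \<in> span ?B" for i
    by (rule span_base; use word_gen in \<open>unfold words_def, blast\<close>)+
  ultimately show ?thesis by (intro generated_by_chevalley) (auto simp: span_base)
qed

definition nonneg_comb :: "('v \<Rightarrow> real) \<Rightarrow> bool" where
  "nonneg_comb \<beta> \<longleftrightarrow> (\<exists>n. (\<forall>i. n i \<ge> 0) \<and> \<beta> = (\<lambda>v. \<Sum>i\<in>UNIV. n i * sroot M i v))"

lemma nonneg_comb_sroot: "nonneg_comb (sroot M i)"
  unfolding nonneg_comb_def
  by (rule exI[of _ "\<lambda>j. if j = i then 1 else 0"]) (auto simp: fun_eq_iff if_distrib[of "\<lambda>x. x * _"] cong: if_cong)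

lemma nonneg_comb_add:
  assumes "nonneg_comb \<beta>" "nonneg_comb \<gamma>" shows "nonneg_comb (\<lambda>v. \<beta> v + \<gamma> v)"
proof -
  obtain n m where "\<forall>i. n i \<ge> 0" "\<beta> = (\<lambda>v. \<Sum>i\<in>UNIV. n i * sroot M i v)"
    "\<forall>i. m i \<ge> 0" "\<gamma> = (\<lambda>v. \<Sum>i\<in>UNIV. m i * sroot M i v)"
    using assms unfolding nonneg_comb_def by blast
  then show ?thesis unfolding nonneg_comb_def
    by (intro exI[of _ "\<lambda>i. n i + m i"]) (simp add: distrib_right sum.distrib)
qed

lemma word_e_weight: "word (egen M) (sroot M) u \<beta> \<Longrightarrow> nonneg_comb \<beta>"
  by (induction rule: word.induct) (auto intro: nonneg_comb_sroot nonneg_comb_add)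

lemma word_f_weight: "word (fgen M) (\<lambda>i v. - sroot M i v) u \<beta> \<Longrightarrow> nonneg_comb (\<lambda>v. - \<beta> v)"
proof (induction rule: word.induct)
  case (word_br u \<beta> i)
  then show ?case using nonneg_comb_add[OF nonneg_comb_sroot word_br.IH, of i] by simp
qed (simp add: nonneg_comb_sroot)

text \<open>A root vector is a combination of words and of an element of the Cartan subalgebra, so its weight,
  being nonzero, is the weight of a word.\<close>

theorem km_root_sign:
  assumes "\<alpha> \<in> km_roots M"
  shows "nonneg_comb \<alpha> \<or> nonneg_comb (\<lambda>v. - \<alpha> v)"
proof (rule ccontr)
  assume neg: "\<not> ?thesis"
  obtain x where nz: "\<alpha> \<noteq> (\<lambda>_. 0)" and x: "x \<noteq> 0" "weight_vector \<alpha> x"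
    using assms by (auto simp: km_roots_iff)
  let ?B = "wordsE \<union> wordsF \<union> range (cartan M)"
  have "\<exists>\<omega>. weight_vector \<omega> b \<and> \<omega> \<noteq> \<alpha>" if b: "b \<in> ?B" for b
  proof -
    consider "b \<in> wordsE" | "b \<in> wordsF" | "b \<in> range (cartan M)" using b by blast
    then show ?thesis
    proof cases
      case 1
      then obtain \<beta> where "word (egen M) (sroot M) b \<beta>" unfolding words_def by blast
      then show ?thesis using word_weight_e word_e_weight[of b \<beta>] neg
        by (intro exI[of _ \<beta>]) auto
    next
      case 2
      then obtain \<beta> where "word (fgen M) (\<lambda>i v. - sroot M i v) b \<beta>" unfolding words_def by blast
      then show ?thesis using word_weight_f word_f_weight[of b \<beta>] neg
        by (intro exI[of _ \<beta>]) auto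
    next
      case 3
      then have "weight_vector (\<lambda>_. 0) b" by (auto simp: weight_vector_def br_cartan)
      then show ?thesis using nz by (intro exI[of _ "\<lambda>_. 0"]) auto
    qed
  qed
  then have "\<forall>b. \<exists>\<omega>. b \<in> ?B \<longrightarrow> weight_vector \<omega> b \<and> \<omega> \<noteq> \<alpha>" by blast
  from choice[OF this] obtain \<omega>
    where \<omega>: "\<And>b. b \<in> ?B \<Longrightarrow> weight_vector (\<omega> b) b" "\<And>b. b \<in> ?B \<Longrightarrow> \<omega> b \<noteq> \<alpha>"
    by blast
  have "x \<in> span ?B" using triangular_decomposition by blast
  then obtain T r where T: "finite T" "T \<subseteq> ?B" "x = (\<Sum>b\<in>T. r b *\<^sub>R b)"
    unfolding span_explicit by blast
  have "x = 0"
  proof (rule weight_of_sum[of "\<lambda>h. br (cartan M h)" T \<omega> \<alpha> x r])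
    show "linear (br (cartan M h))" for h by (rule linear_br)
  qed (use T \<omega> x(2) in \<open>auto simp: weight_vector_def\<close>)
  then show False using x(1) by blast
qed

text \<open>For the fundamental chamber this is clear from the signs of the coefficients; the set of roots is
  stable under the Weyl group.\<close>

lemma root_sign_chamber:
  assumes \<beta>: "\<beta> \<in> km_roots M" and C: "C \<in> chambers M"
  shows "(\<forall>c\<in>C. \<beta> c > 0) \<or> (\<forall>c\<in>C. \<beta> c < 0)"
proof -
  have fund: "(\<forall>c\<in>Fv M {}. \<gamma> c > 0) \<or> (\<forall>c\<in>Fv M {}. \<gamma> c < 0)" if \<gamma>: "\<gamma> \<in> km_roots M" for \<gamma>
  proof -
    have pos: "\<delta> c > 0" if \<delta>: "nonneg_comb \<delta>" "\<delta> \<noteq> (\<lambda>_. 0)" and c: "c \<in> Fv M {}" for \<delta> c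
    proof -
      obtain n where n: "\<forall>i. n i \<ge> 0" "\<delta> = (\<lambda>v. \<Sum>i\<in>UNIV. n i * sroot M i v)"
        using \<delta>(1) unfolding nonneg_comb_def by blast
      have "\<exists>i. n i \<noteq> 0"
      proof (rule ccontr)
        assume "\<nexists>i. n i \<noteq> 0"
        then show False using \<delta>(2) n(2) by simp
      qed
      then obtain i where i: "n i \<noteq> 0" by blast
      have "0 < n i * sroot M i c" using i n(1) c by (simp add: Fv_def less_le)
      then show ?thesis unfolding n(2) using n(1) c
        by (intro sum_pos2[of _ i]) (auto simp: Fv_def less_imp_le)
    qed
    have nz: "\<gamma> \<noteq> (\<lambda>_. 0)" using \<gamma> by (simp add: km_roots_iff)
    then have "(\<lambda>v. - \<gamma> v) \<noteq> (\<lambda>_. 0)" by (auto simp: fun_eq_iff)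
    then show ?thesis using km_root_sign[OF \<gamma>] pos[of \<gamma>] nz pos[of "\<lambda>v. - \<gamma> v"] by fastforce
  qed
  from C show ?thesis
  proof (cases rule: chambers_cases)
    case (1 w)
    then show ?thesis using fund[OF km_roots_Wv[OF 1(1) \<beta>]] by simp
  next
    case (2 w)
    have "linear \<beta>" using \<beta> by (simp add: km_roots_iff)
    then show ?thesis using fund[OF km_roots_Wv[OF 2(1) \<beta>]] 2(2) by (auto simp: linear_neg)
  qed
qed

lemma root_minimal_face:
  assumes "\<beta> \<in> km_roots M" "v \<in> Fv M UNIV" shows "\<beta> v = 0"
proof -
  have "\<gamma> v = 0" if "nonneg_comb \<gamma>" for \<gamma>
    using that assms(2) unfolding nonneg_comb_def Fv_def by auto
  then show ?thesis using km_root_sign[OF assms(1)] by fastforce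
qed

end

section \<open>Enclosures\<close>

locale model_apartment_data = kac_moody_data M
  for M :: "('i::finite, 'v::euclidean_space, 'g::real_vector) apartment_data" +
  assumes model: "model_apartment M"
begin

lemma Lam_iff_wall: "\<alpha> \<in> real_roots M \<Longrightarrow> k \<in> Lam M \<alpha> \<longleftrightarrow> hyperplane \<alpha> k \<in> walls M"
  and Lam_0: "\<alpha> \<in> real_roots M \<Longrightarrow> 0 \<in> Lam M \<alpha>"
  and Lam_infinite: "\<alpha> \<in> real_roots M \<Longrightarrow> infinite (Lam M \<alpha>)"
  using model by (auto simp: model_apartment_def)

lemma Wa_walls: "g \<in> Wa M \<Longrightarrow> H \<in> walls M \<Longrightarrow> g ` H \<in> walls M"
  using model unfolding model_apartment_def by blast

lemma km_root_linear: "\<beta> \<in> km_roots M \<Longrightarrow> linear \<beta>"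
  by (simp add: km_roots_iff)

text \<open>The set \<open>\<Lambda>\<^sub>\<alpha>\<close> lists all walls of direction \<open>ker \<alpha>\<close>, and the affine Weyl group permutes the walls.\<close>

lemma Lam_Wa:
  assumes w: "w \<in> Wv M" "g = (\<lambda>v. w v + t)" and g: "g \<in> Wa M"
    and \<beta>: "\<beta> \<in> real_roots M" and k: "k \<in> Lam M \<beta>"
  shows "k + \<beta> t \<in> Lam M (\<beta> \<circ> w)"
proof -
  have lin: "linear \<beta>" using \<beta> real_roots_km km_root_linear by blast
  have "inv g ` hyperplane \<beta> k = g -` hyperplane \<beta> k"
    using bij_vimage_eq_inv_image[OF Wa_bij[OF g]] by simp
  also have "\<dots> = hyperplane (\<beta> \<circ> w) (k + \<beta> t)"
    by (auto simp: hyperplane_def w(2) linear_add[OF lin])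
  finally have "hyperplane (\<beta> \<circ> w) (k + \<beta> t) \<in> walls M"
    using Wa_walls[OF Wa_inv[OF g]] \<beta> k by (metis Lam_iff_wall)
  then show ?thesis using Lam_iff_wall[OF real_roots_Wv[OF w(1) \<beta>]] by simp
qed

text \<open>Enclosures can be transported along Weyl isomorphisms because the affine Weyl group permutes
  the walls and its linear part permutes the real roots as well as the imaginary roots; for the
  latter all half-spaces are admitted.\<close>

lemma enclosed_vimage:
  assumes g: "g \<in> Wa M" and P: "P \<in> enclosed_sets M" shows "g -` P \<in> enclosed_sets M"
proof -
  let ?R = "real_roots M \<union> imaginary_roots M"
  obtain w t where w: "w \<in> Wv M" "g = (\<lambda>v. w v + t)" by (rule Wa_affine[OF g])
  obtain k where k: "P = (\<Inter>\<alpha>\<in>?R. half_space \<alpha> (k \<alpha>))"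
    "\<forall>\<alpha>\<in>?R. k \<alpha> \<in> insert \<infinity> (ereal ` full_Lam M \<alpha>)"
    using P unfolding enclosed_sets_def by blast
  define k' where "k' = (\<lambda>\<alpha>. k (\<alpha> \<circ> inv w) + ereal ((\<alpha> \<circ> inv w) t))"
  have cancel: "\<alpha> \<circ> inv w \<circ> w = \<alpha>" "\<alpha> \<circ> w \<circ> inv w = \<alpha>" for \<alpha> :: "'v \<Rightarrow> real"
    using Wv_inv_apply[OF w(1)] by (auto simp: fun_eq_iff)
  have R: "\<alpha> \<circ> u \<in> ?R" if "u \<in> Wv M" "\<alpha> \<in> ?R" for u \<alpha>
    using that by (simp add: all_roots km_roots_Wv)
  have hs: "g -` half_space (\<alpha> \<circ> inv w) (k (\<alpha> \<circ> inv w)) = half_space \<alpha> (k' \<alpha>)" if "\<alpha> \<in> ?R" for \<alpha>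
  proof -
    have "linear (\<alpha> \<circ> inv w)" using R[OF Wv_inv[OF w(1)] that] km_root_linear by (simp add: all_roots)
    then have "(\<alpha> \<circ> inv w) (g v) = \<alpha> v + (\<alpha> \<circ> inv w) t" for v
      using linear_add[of "\<alpha> \<circ> inv w" "w v" t] by (simp add: w(2) Wv_inv_apply[OF w(1)])
    moreover have "ereal (a + b) + c = ereal a + (c + ereal b)" for a b c by (cases c) auto
    ultimately have "ereal ((\<alpha> \<circ> inv w) (g v)) + k (\<alpha> \<circ> inv w) = ereal (\<alpha> v) + k' \<alpha>" for v
      unfolding k'_def by (simp only:)
    then show ?thesis by (simp add: half_space_def vimage_def)
  qed
  have "g -` P = (\<Inter>\<alpha>\<in>?R. half_space \<alpha> (k' \<alpha>))"
  proof
    show "g -` P \<subseteq> (\<Inter>\<alpha>\<in>?R. half_space \<alpha> (k' \<alpha>))"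
      using hs R[OF Wv_inv[OF w(1)]] unfolding k(1) by blast
    show "(\<Inter>\<alpha>\<in>?R. half_space \<alpha> (k' \<alpha>)) \<subseteq> g -` P"
    proof
      fix v assume v: "v \<in> (\<Inter>\<alpha>\<in>?R. half_space \<alpha> (k' \<alpha>))"
      have "g v \<in> half_space \<alpha> (k \<alpha>)" if "\<alpha> \<in> ?R" for \<alpha>
        using v R[OF w(1) that] hs[OF R[OF w(1) that]] unfolding cancel by blast
      then show "v \<in> g -` P" unfolding k(1) by blast
    qed
  qed
  moreover have "k' \<alpha> \<in> insert \<infinity> (ereal ` full_Lam M \<alpha>)" if \<alpha>: "\<alpha> \<in> ?R" for \<alpha>
  proof (cases "\<alpha> \<in> imaginary_roots M")
    case True
    then have "full_Lam M \<alpha> = UNIV" by (simp add: full_Lam_def)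
    moreover have "k (\<alpha> \<circ> inv w) \<in> insert \<infinity> (range ereal)"
      using k(2) R[OF Wv_inv[OF w(1)] \<alpha>] by blast
    ultimately show ?thesis unfolding k'_def by auto
  next
    case False
    then have re: "\<alpha> \<in> real_roots M" using \<alpha> by blast
    then have re': "\<alpha> \<circ> inv w \<in> real_roots M" by (rule real_roots_Wv[OF Wv_inv[OF w(1)]])
    then have "full_Lam M (\<alpha> \<circ> inv w) = Lam M (\<alpha> \<circ> inv w)"
      by (simp add: full_Lam_def imaginary_roots_def)
    moreover have "l + (\<alpha> \<circ> inv w) t \<in> Lam M \<alpha>" if "l \<in> Lam M (\<alpha> \<circ> inv w)" for l
      using Lam_Wa[OF w g re' that] unfolding cancel by simp
    ultimately show ?thesis using k(2) R[OF Wv_inv[OF w(1)] \<alpha>] False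
      unfolding k'_def full_Lam_def by auto
  qed
  ultimately show ?thesis unfolding enclosed_sets_def by blast
qed

lemma enclosed_closed_convex:
  assumes "P \<in> enclosed_sets M" shows "closed P" "convex P"
proof -
  let ?R = "real_roots M \<union> imaginary_roots M"
  obtain k where k: "P = (\<Inter>\<alpha>\<in>?R. half_space \<alpha> (k \<alpha>))"
    "\<forall>\<alpha>\<in>?R. k \<alpha> \<in> insert \<infinity> (ereal ` full_Lam M \<alpha>)"
    using assms unfolding enclosed_sets_def by blast
  have "closed (half_space \<alpha> (k \<alpha>)) \<and> convex (half_space \<alpha> (k \<alpha>))" if \<alpha>: "\<alpha> \<in> ?R" for \<alpha>
  proof -
    have lin: "linear \<alpha>" using \<alpha> km_root_linear by (simp add: all_roots)
    consider "k \<alpha> = \<infinity>" | r where "k \<alpha> = ereal r" using k(2) \<alpha> by blast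
    then show ?thesis
    proof cases
      case 1
      then show ?thesis by (simp add: half_space_def)
    next
      case (2 r)
      then have eq: "half_space \<alpha> (k \<alpha>) = \<alpha> -` {- r..}" by (auto simp: half_space_def)
      show ?thesis unfolding eq
        by (intro conjI continuous_closed_vimage convex_linear_vimage lin convex_real_interval
            closed_atLeast linear_continuous_at[OF linear_conv_bounded_linear[THEN iffD1, OF lin]])
    qed
  qed
  then show "closed P" "convex P" unfolding k(1) by (auto intro!: closed_INT convex_INT)
qed

lemma half_space_enclosed:
  assumes "\<And>\<alpha>. \<alpha> \<in> A \<Longrightarrow> \<alpha> \<in> real_roots M" "\<And>\<alpha>. \<alpha> \<in> A \<Longrightarrow> \<kappa> \<alpha> \<in> Lam M \<alpha>"
  shows "{v. \<forall>\<alpha>\<in>A. \<alpha> v + \<kappa> \<alpha> \<ge> 0} \<in> enclosed_sets M"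
proof -
  let ?k = "\<lambda>\<alpha>. if \<alpha> \<in> A then ereal (\<kappa> \<alpha>) else \<infinity>"
  have "{v. \<forall>\<alpha>\<in>A. \<alpha> v + \<kappa> \<alpha> \<ge> 0} =
      (\<Inter>\<alpha>\<in>real_roots M \<union> imaginary_roots M. half_space \<alpha> (?k \<alpha>))" (is "?L = ?R")
  proof
    show "?L \<subseteq> ?R" by (auto simp: half_space_def)
    show "?R \<subseteq> ?L"
    proof (intro subsetI CollectI ballI)
      fix v \<alpha> assume v: "v \<in> ?R" and \<alpha>: "\<alpha> \<in> A"
      then have "v \<in> half_space \<alpha> (?k \<alpha>)" using assms(1)[OF \<alpha>] by blast
      then show "0 \<le> \<alpha> v + \<kappa> \<alpha>" using \<alpha> by (simp add: half_space_def)
    qed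
  qed
  moreover have "\<forall>\<alpha>\<in>real_roots M \<union> imaginary_roots M. ?k \<alpha> \<in> insert \<infinity> (ereal ` full_Lam M \<alpha>)"
    using assms by (auto simp: full_Lam_def imaginary_roots_def)
  ultimately show ?thesis unfolding enclosed_sets_def by (intro CollectI exI[of _ ?k] conjI)
qed

text \<open>Two parallel reflections compose to a translation, so \<open>\<Lambda>\<^sub>\<alpha>\<close> is stable under a nontrivial
  group of translations.\<close>

lemma Lam_unbounded:
  assumes \<alpha>: "\<alpha> \<in> real_roots M" shows "\<exists>k\<in>Lam M \<alpha>. k < b"
proof -
  obtain c where c: "(\<alpha>, c) \<in> root_pairs M" using \<alpha> unfolding real_roots_def by auto
  have lin: "linear \<alpha>" using \<alpha> real_roots_km km_root_linear by blast
  have \<alpha>c: "\<alpha> c = 2"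
    using c unfolding root_pairs_def by (auto simp: Wv_inv_apply sroot_scoroot_self)
  have "\<not> Lam M \<alpha> \<subseteq> {0}" using Lam_infinite[OF \<alpha>] finite_subset by blast
  then obtain k where k: "k \<in> Lam M \<alpha>" "k \<noteq> 0" by blast
  have s: "affine_reflection \<alpha> c l \<in> Wa M" if "l \<in> Lam M \<alpha>" for l
    unfolding Wa_def using c that by (intro gen_base) blast
  have tr: "(\<lambda>v. v + m *\<^sub>R c) \<in> Wa M" if "m = k \<or> m = - k" for m
  proof -
    have comp: "affine_reflection \<alpha> c l \<circ> affine_reflection \<alpha> c l' = (\<lambda>v. v + (l' - l) *\<^sub>R c)" for l l'
    proof
      fix v
      let ?v = "v - (\<alpha> v + l') *\<^sub>R c"
      have "(affine_reflection \<alpha> c l \<circ> affine_reflection \<alpha> c l') v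
          = v - ((\<alpha> v + l') + (\<alpha> ?v + l)) *\<^sub>R c"
        unfolding affine_reflection_def o_apply scaleR_add_left[of "\<alpha> v + l'"] by (simp add: algebra_simps)
      also have "(\<alpha> v + l') + (\<alpha> ?v + l) = - (l' - l)"
        by (simp add: linear_diff[OF lin] linear_cmul[OF lin] \<alpha>c)
      finally show "(affine_reflection \<alpha> c l \<circ> affine_reflection \<alpha> c l') v = v + (l' - l) *\<^sub>R c"
        by (simp add: algebra_simps)
    qed
    have "affine_reflection \<alpha> c k \<circ> affine_reflection \<alpha> c 0 = (\<lambda>v. v + (- k) *\<^sub>R c)"
      "affine_reflection \<alpha> c 0 \<circ> affine_reflection \<alpha> c k = (\<lambda>v. v + k *\<^sub>R c)"
      unfolding comp by simp_all
    then show ?thesis using that Wa_comp s k(1) Lam_0[OF \<alpha>] by metis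
  qed
  have "2 * real n * m \<in> Lam M \<alpha>" if m: "m = k \<or> m = - k" for n m
  proof (induction n)
    case 0
    then show ?case using Lam_0[OF \<alpha>] by simp
  next
    case (Suc n)
    have "2 * real n * m + \<alpha> (m *\<^sub>R c) \<in> Lam M (\<alpha> \<circ> id)"
      by (rule Lam_Wa[OF Wv_id _ tr[OF m] \<alpha> Suc]) simp
    moreover have "2 * real (Suc n) * m = 2 * real n * m + \<alpha> (m *\<^sub>R c)"
      by (simp add: linear_cmul[OF lin] \<alpha>c algebra_simps)
    ultimately show ?case by (simp only: comp_id)
  qed
  then have lam: "2 * real n * (- \<bar>k\<bar>) \<in> Lam M \<alpha>" for n by (metis abs_real_def minus_minus)
  obtain n where "- b < real n * (2 * \<bar>k\<bar>)" using k(2) reals_Archimedean3[of "2 * \<bar>k\<bar>"] by auto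
  then show ?thesis using lam[of n] by (intro bexI[OF _ lam[of n]]) (simp add: algebra_simps)
qed

lemma eventually_enclosure_iff:
  "eventually Q (enclosure M F) \<longleftrightarrow>
     (\<exists>P\<in>enclosed_sets M. eventually (\<lambda>v. v \<in> P) F \<and> (\<forall>v\<in>P. Q v))"
  using eventually_enclosure[of "Collect Q" M F] by (simp add: le_principal subset_iff Ball_def)

lemma enclosure_extensive: "F \<le> enclosure M F"
  by (rule filter_leI) (auto simp: eventually_enclosure_iff elim: eventually_mono)

lemma enclosure_le_iff: "enclosure M F \<le> enclosure M F' \<longleftrightarrow> F \<le> enclosure M F'"
proof
  show "enclosure M F \<le> enclosure M F' \<Longrightarrow> F \<le> enclosure M F'"
    using enclosure_extensive order_trans by blast
  assume le: "F \<le> enclosure M F'"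
  show "enclosure M F \<le> enclosure M F'"
  proof (rule filter_leI)
    fix Q assume "eventually Q (enclosure M F')"
    then obtain P where P: "P \<in> enclosed_sets M" "eventually (\<lambda>v. v \<in> P) F'" "\<forall>v\<in>P. Q v"
      by (auto simp: eventually_enclosure_iff)
    then have "eventually (\<lambda>v. v \<in> P) (enclosure M F')" by (auto simp: eventually_enclosure_iff)
    then show "eventually Q (enclosure M F)"
      using P le by (auto simp: eventually_enclosure_iff le_filter_def)
  qed
qed

lemma enclosure_idem: "enclosure M (enclosure M F) = enclosure M F"
  by (intro antisym) (auto simp: enclosure_le_iff enclosure_extensive)

lemma enclosure_Wa:
  assumes g: "g \<in> Wa M" shows "filtermap g (enclosure M F) = enclosure M (filtermap g F)"
proof (rule filter_eq_iff[THEN iffD2], intro allI iffI)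
  fix Q assume "eventually Q (filtermap g (enclosure M F))"
  then obtain P where P: "P \<in> enclosed_sets M" "eventually (\<lambda>v. v \<in> P) F" "\<forall>v\<in>P. Q (g v)"
    by (auto simp: eventually_filtermap eventually_enclosure_iff)
  have "inv g -` P \<in> enclosed_sets M" by (rule enclosed_vimage[OF Wa_inv[OF g] P(1)])
  then show "eventually Q (enclosure M (filtermap g F))"
    using P Wa_inv_apply[OF g] unfolding eventually_enclosure_iff eventually_filtermap
    by (intro bexI[of _ "inv g -` P"] conjI ballI) (simp_all, metis vimageE)
next
  fix Q assume "eventually Q (enclosure M (filtermap g F))"
  then obtain P where P: "P \<in> enclosed_sets M" "eventually (\<lambda>v. g v \<in> P) F" "\<forall>v\<in>P. Q v"
    by (auto simp: eventually_filtermap eventually_enclosure_iff)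
  then show "eventually Q (filtermap g (enclosure M F))"
    using enclosed_vimage[OF g P(1)] unfolding eventually_enclosure_iff eventually_filtermap
    by (intro bexI[of _ "g -` P"]) auto
qed

section \<open>Local faces, sector germs and chimneys\<close>

lemma eventually_local_face:
  "eventually Q (local_face x E) \<longleftrightarrow> (\<exists>S. open S \<and> 0 \<in> S \<and> (\<forall>u\<in>E \<inter> S. Q (x + u)))"
proof
  assume "eventually Q (local_face x E)"
  then obtain S where S: "open S" "x \<in> S" "\<forall>y\<in>S. y \<in> (+) x ` E \<longrightarrow> Q y"
    by (auto simp: local_face_def germ_at_def eventually_inf_principal eventually_nhds)
  have "open ((+) (- x) ` S)" by (rule open_translation[OF S(1)])
  then show "\<exists>S. open S \<and> 0 \<in> S \<and> (\<forall>u\<in>E \<inter> S. Q (x + u))"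
    using S by (intro exI[of _ "(+) (- x) ` S"]) (auto simp: image_iff)
next
  assume "\<exists>S. open S \<and> 0 \<in> S \<and> (\<forall>u\<in>E \<inter> S. Q (x + u))"
  then obtain S where S: "open S" "0 \<in> S" "\<forall>u\<in>E \<inter> S. Q (x + u)" by blast
  then show "eventually Q (local_face x E)"
    unfolding local_face_def germ_at_def eventually_inf_principal eventually_nhds
    by (intro exI[of _ "(+) x ` S"]) (auto simp: open_translation)
qed

lemma local_face_translate: "filtermap (\<lambda>v. v + \<xi>) (local_face x E) = local_face (x + \<xi>) E"
  by (rule filter_eq_iff[THEN iffD2])
     (simp add: eventually_filtermap eventually_local_face add.assoc add.commute add.left_commute)

lemma eventually_filter_plus_set:
  "eventually Q (filter_plus_set F D) \<longleftrightarrow> eventually (\<lambda>a. \<forall>d\<in>D. Q (a + d)) F"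
  unfolding filter_plus_set_def eventually_filtermap eventually_prod_filter eventually_principal
proof
  assume "\<exists>Pf Pg. eventually Pf F \<and> (\<forall>x\<in>D. Pg x) \<and>
    (\<forall>x y. Pf x \<longrightarrow> Pg y \<longrightarrow> Q (case (x, y) of (a, b) \<Rightarrow> a + b))"
  then show "\<forall>\<^sub>F a in F. \<forall>d\<in>D. Q (a + d)" by (auto elim!: eventually_mono)
next
  assume "\<forall>\<^sub>F a in F. \<forall>d\<in>D. Q (a + d)"
  then show "\<exists>Pf Pg. eventually Pf F \<and> (\<forall>x\<in>D. Pg x) \<and>
    (\<forall>x y. Pf x \<longrightarrow> Pg y \<longrightarrow> Q (case (x, y) of (a, b) \<Rightarrow> a + b))"
    by (intro exI[of _ "\<lambda>a. \<forall>d\<in>D. Q (a + d)"] exI[of _ "\<lambda>d. d \<in> D"]) auto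
qed

text \<open>\<open>tube x E D P\<close> says that the set \<open>P\<close> belongs to the filter \<open>germ\<^sub>x(x + E) + D\<close>.\<close>

definition tube :: "'v \<Rightarrow> 'v set \<Rightarrow> 'v set \<Rightarrow> 'v set \<Rightarrow> bool" where
  "tube x E D P \<longleftrightarrow> (\<exists>S. open S \<and> 0 \<in> S \<and> (\<forall>u\<in>E \<inter> S. \<forall>d\<in>D. x + u + d \<in> P))"

lemma eventually_plus_local_face:
  "eventually (\<lambda>v. v \<in> P) (filter_plus_set (local_face x E) D) \<longleftrightarrow> tube x E D P"
  unfolding eventually_filter_plus_set eventually_local_face tube_def ..

lemma eventually_chimney_iff:
  "eventually Q (chimney M (local_face x E) D) \<longleftrightarrow>
     (\<exists>P\<in>enclosed_sets M. tube x E D P \<and> (\<forall>v\<in>P. Q v))"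
  unfolding chimney_def eventually_enclosure_iff eventually_plus_local_face ..

lemma eventually_chimney_germ_iff:
  assumes "D \<in> faces M"
  shows "eventually Q (chimney_germ M (local_face x E) D) \<longleftrightarrow>
     (\<exists>\<xi>\<in>D. \<exists>P\<in>enclosed_sets M. tube (x + \<xi>) E D P \<and> (\<forall>v\<in>P. Q v))"
  by (simp add: eventually_chimney_germ[OF face_nonempty[OF assms] face_add[OF assms]]
      local_face_translate eventually_chimney_iff)

lemma eventually_sector_germ_iff:
  assumes "C \<in> chambers M"
  shows "eventually Q (sector_face_germ x C) \<longleftrightarrow> (\<exists>\<xi>\<in>C. \<forall>c\<in>C. Q (x + \<xi> + c))"
  using eventually_sector_face_germ[of C "Collect Q" x] face_nonempty[OF chamber_is_face[OF assms]]
    face_add[OF chamber_is_face[OF assms]] by (auto simp: image_subset_iff)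

lemma small_multiple_in_open:
  assumes "open S" "u \<in> S"
  shows "\<exists>e>0. \<forall>t. 0 \<le> t \<and> t < e \<longrightarrow> u + t *\<^sub>R (c :: 'v) \<in> S"
proof -
  obtain r where r: "r > 0" "ball u r \<subseteq> S" using assms open_contains_ball by blast
  let ?e = "r / (norm c + 1)"
  have "u + t *\<^sub>R c \<in> S" if "0 \<le> t" "t < ?e" for t
  proof -
    have "t * norm c \<le> t * (norm c + 1)" using that by (intro mult_left_mono) auto
    also have "\<dots> < r" using that by (simp add: pos_less_divide_eq add_nonneg_pos)
    finally have "dist u (u + t *\<^sub>R c) < r" using that by (simp add: dist_norm)
    then show ?thesis using r(2) by auto
  qed
  moreover have "?e > 0" using r(1) by (simp add: add_nonneg_pos)
  ultimately show ?thesis by blast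
qed

lemma eventually_germ_segment:
  fixes x y :: 'v
  assumes "eventually Q (germ_at x (closed_segment x y))"
  shows "\<exists>e>0. e \<le> 1 \<and> (\<forall>s\<in>{0..e}. Q (x + s *\<^sub>R (y - x)))"
proof -
  obtain S where S: "open S" "x \<in> S" "\<forall>z\<in>S. z \<in> closed_segment x y \<longrightarrow> Q z"
    using assms by (auto simp: germ_at_def eventually_inf_principal eventually_nhds)
  obtain e where e: "e > 0" "\<And>s. 0 \<le> s \<Longrightarrow> s < e \<Longrightarrow> x + s *\<^sub>R (y - x) \<in> S"
    using small_multiple_in_open[OF S(1,2)] by blast
  let ?e = "min (e / 2) 1"
  have "Q (x + s *\<^sub>R (y - x))" if "s \<in> {0..?e}" for s
  proof -
    have "x + s *\<^sub>R (y - x) = (1 - s) *\<^sub>R x + s *\<^sub>R y" by (simp add: algebra_simps)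
    then have "x + s *\<^sub>R (y - x) \<in> closed_segment x y"
      using that unfolding closed_segment_def by auto
    then show ?thesis using S(3) e that by auto
  qed
  then show ?thesis using e(1) by (intro exI[of _ ?e]) auto
qed

subsection \<open>Consequences of closedness and convexity\<close>

lemma closed_limit:
  assumes "closed P" "e > 0" "\<And>t. 0 < t \<Longrightarrow> t < e \<Longrightarrow> y + t *\<^sub>R (c :: 'v) \<in> P"
  shows "y \<in> P"
proof (rule ccontr)
  assume "y \<notin> P"
  then obtain d where d: "d > 0" "\<And>t. 0 \<le> t \<Longrightarrow> t < d \<Longrightarrow> y + t *\<^sub>R c \<in> - P"
    using small_multiple_in_open[of "- P" y c] assms(1) by (auto simp: open_Compl)
  let ?t = "min d e / 2"
  have "0 < ?t" "?t < e" "?t < d" using d(1) assms(2) by auto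
  then show False using d(2)[of ?t] assms(3)[of ?t] by auto
qed

lemma tube_base:
  assumes "closed P" "E \<in> faces M" "D \<in> faces M" "tube x E D P"
  shows "d \<in> D \<Longrightarrow> x + d \<in> P" and "eventually (\<lambda>v. v \<in> P) (local_face x E)" and "x \<in> P"
proof -
  obtain S where S: "open S" "0 \<in> S" "\<And>u d. u \<in> E \<Longrightarrow> u \<in> S \<Longrightarrow> d \<in> D \<Longrightarrow> x + u + d \<in> P"
    using assms(4) unfolding tube_def by blast
  obtain u where u: "u \<in> E" using face_nonempty[OF assms(2)] by blast
  obtain e where e: "e > 0" "\<And>t. 0 \<le> t \<Longrightarrow> t < e \<Longrightarrow> 0 + t *\<^sub>R u \<in> S"
    using small_multiple_in_open[OF S(1,2)] by blast
  show xd: "x + d \<in> P" if "d \<in> D" for d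
  proof (rule closed_limit[OF assms(1) e(1)])
    fix t assume "0 < t" "t < e"
    then have "x + t *\<^sub>R u + d \<in> P" using S(3) e(2)[of t] face_scale[OF assms(2) u] that by auto
    then show "x + d + t *\<^sub>R u \<in> P" by (simp add: algebra_simps)
  qed
  obtain d where d: "d \<in> D" using face_nonempty[OF assms(3)] by blast
  show "x \<in> P"
    by (rule closed_limit[OF assms(1), of 1 _ d]) (use xd face_scale[OF assms(3) d] in auto)
  have "x + u \<in> P" if "u \<in> E \<inter> S" for u
    by (rule closed_limit[OF assms(1), of 1 _ d]) (use S(3) that face_scale[OF assms(3) d] in auto)
  then show "eventually (\<lambda>v. v \<in> P) (local_face x E)"
    unfolding eventually_local_face using S(1,2) by blast
qed

lemma local_face_base:
  assumes "closed P" "E \<in> faces M" "eventually (\<lambda>v. v \<in> P) (local_face x E)"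
  shows "x \<in> P"
proof -
  obtain S where S: "open S" "0 \<in> S" "\<And>u. u \<in> E \<Longrightarrow> u \<in> S \<Longrightarrow> x + u \<in> P"
    using assms(3) unfolding eventually_local_face by blast
  obtain u where u: "u \<in> E" using face_nonempty[OF assms(2)] by blast
  obtain e where e: "e > 0" "\<And>t. 0 \<le> t \<Longrightarrow> t < e \<Longrightarrow> 0 + t *\<^sub>R u \<in> S"
    using small_multiple_in_open[OF S(1,2)] by blast
  show ?thesis
  proof (rule closed_limit[OF assms(1) e(1)])
    fix t assume "0 < t" "t < e"
    then show "x + t *\<^sub>R u \<in> P" using S(3) e(2)[of t] face_scale[OF assms(2) u] by auto
  qed
qed

lemma tube_translate:
  assumes "D \<in> faces M" "tube x E D P" "d \<in> D" shows "tube (x + d) E D P"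
  using assms(2) face_add[OF assms(1,3)] unfolding tube_def by (metis add.assoc add.left_commute)

text \<open>A local face may be replaced by a local chamber having it in its closure: a closed set that
  belongs to the filter built on the chamber also belongs to the filter built on the face.\<close>

lemma tube_below:
  assumes "closed P" "C \<in> chambers M" "\<And>u c. u \<in> E \<Longrightarrow> c \<in> C \<Longrightarrow> u + c \<in> C" "tube x C D P"
  shows "tube x E D P"
proof -
  obtain S where S: "open S" "0 \<in> S" "\<And>u d. u \<in> C \<Longrightarrow> u \<in> S \<Longrightarrow> d \<in> D \<Longrightarrow> x + u + d \<in> P"
    using assms(4) unfolding tube_def by blast
  obtain c where c: "c \<in> C" using face_nonempty[OF chamber_is_face[OF assms(2)]] by blast
  have "x + u + d \<in> P" if u: "u \<in> E" "u \<in> S" and d: "d \<in> D" for u d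
  proof -
    obtain e where e: "e > 0" "\<And>t. 0 \<le> t \<Longrightarrow> t < e \<Longrightarrow> u + t *\<^sub>R c \<in> S"
      using small_multiple_in_open[OF S(1) u(2)] by blast
    show ?thesis
    proof (rule closed_limit[OF assms(1) e(1)])
      fix t assume t: "0 < t" "t < e"
      then have "u + t *\<^sub>R c \<in> C" using assms(3)[OF u(1)] face_scale[OF chamber_is_face[OF assms(2)] c] by blast
      then have "x + (u + t *\<^sub>R c) + d \<in> P" using S(3) e(2)[of t] t d by auto
      then show "x + u + d + t *\<^sub>R c \<in> P" by (simp add: algebra_simps)
    qed
  qed
  then show ?thesis unfolding tube_def using S(1,2) by blast
qed

lemma local_face_below:
  assumes "closed P" "C \<in> chambers M" "\<And>u c. u \<in> E \<Longrightarrow> c \<in> C \<Longrightarrow> u + c \<in> C"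
    "eventually (\<lambda>v. v \<in> P) (local_face x C)"
  shows "eventually (\<lambda>v. v \<in> P) (local_face x E)"
  using tube_below[OF assms(1-3), where x = x and D = "{0}"] assms(4) unfolding tube_def eventually_local_face by auto

lemma enclosure_local_face_below:
  assumes "C \<in> chambers M" "\<And>u c. u \<in> E \<Longrightarrow> c \<in> C \<Longrightarrow> u + c \<in> C"
  shows "enclosure M (local_face x E) \<le> enclosure M (local_face x C)"
  unfolding enclosure_le_iff
proof (rule filter_leI)
  fix Q assume "eventually Q (enclosure M (local_face x C))"
  then obtain P where P: "P \<in> enclosed_sets M" "eventually (\<lambda>v. v \<in> P) (local_face x C)" "\<forall>v\<in>P. Q v"
    by (auto simp: eventually_enclosure_iff)
  have "eventually (\<lambda>v. v \<in> P) (local_face x E)"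
    by (rule local_face_below[OF enclosed_closed_convex(1)[OF P(1)] assms P(2)])
  then show "eventually Q (local_face x E)" using P(3) by (auto elim: eventually_mono)
qed

lemma chimney_germ_below:
  assumes "C \<in> chambers M" "\<And>u c. u \<in> E \<Longrightarrow> c \<in> C \<Longrightarrow> u + c \<in> C" "D \<in> faces M"
  shows "chimney_germ M (local_face x E) D \<le> chimney_germ M (local_face x C) D"
  by (rule filter_leI)
     (auto simp: eventually_chimney_germ_iff[OF assms(3)]
       intro: tube_below[OF _ assms(1,2)] enclosed_closed_convex)

text \<open>The point \<open>y + c\<close> is a limit of points of the segments from \<open>y\<close> to the points \<open>x1 + t c\<close>, \<open>t \<rightarrow> \<infinity>\<close>.  This is
  how the enclosure of a sector germ and a point \<open>y\<close> comes to contain the whole sector based at \<open>y\<close>.\<close>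

lemma recession:
  assumes "closed P" "convex P" "C \<in> chambers M" "\<And>c. c \<in> C \<Longrightarrow> x1 + c \<in> P" "y \<in> P"
    and "\<And>c. c \<in> C \<Longrightarrow> d + c \<in> C"
  shows "y + d \<in> P"
proof -
  note C = chamber_is_face[OF assms(3)]
  have yc: "y + c \<in> P" if c: "c \<in> C" for c
  proof (rule closed_limit[OF assms(1), of 1 _ "x1 - y"])
    fix t :: real assume t: "0 < t" "t < 1"
    have "(1 - t) *\<^sub>R y + t *\<^sub>R (x1 + (1 / t) *\<^sub>R c) \<in> P"
      using assms(4)[OF face_scale[OF C c, of "1 / t"]] assms(5) t
      by (intro convexD[OF assms(2)]) auto
    then show "y + c + t *\<^sub>R (x1 - y) \<in> P" using t by (simp add: algebra_simps)
  qed simp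
  obtain c where c: "c \<in> C" using face_nonempty[OF C] by blast
  show ?thesis
  proof (rule closed_limit[OF assms(1), of 1 _ c])
    fix t :: real assume "0 < t" "t < 1"
    then show "y + d + t *\<^sub>R c \<in> P" using yc[OF assms(6)[OF face_scale[OF C c]]] by (simp add: add.assoc)
  qed simp
qed

lemma chamber_roots:
  assumes "C \<in> chambers M"
  obtains a where "\<And>i::'i. a i \<in> real_roots M" "C = {v. \<forall>i. 0 < a i v}"
  using assms
proof (cases rule: chambers_cases)
  case (1 w)
  show thesis
  proof (rule that)
    show "sroot M i \<circ> inv w \<in> real_roots M" for i
      unfolding real_roots_def root_pairs_def using 1(1) by force
    show "C = {v. \<forall>i. 0 < (sroot M i \<circ> inv w) v}"
      using Wv_inv_apply[OF 1(1)] unfolding 1(2) Fv_def by (auto simp: image_iff) metis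
  qed
next
  case (2 w)
  show thesis
  proof (rule that)
    show "sroot M i \<circ> inv (w \<circ> srefl M i) \<in> real_roots M" for i
      unfolding real_roots_def root_pairs_def using Wv_comp[OF 2(1) Wv_srefl] by force
    have "inv (w \<circ> srefl M i) = srefl M i \<circ> inv w" for i
      using o_inv_distrib[OF Wv_bij[OF 2(1)] bij_srefl] inv_equality[of "srefl M i" "srefl M i"]
      by (simp add: srefl_srefl)
    then have "(sroot M i \<circ> inv (w \<circ> srefl M i)) v = sroot M i (inv w (- v))" for i v
      by (simp add: srefl_def linear_diff[OF linear_sroot] linear_cmul[OF linear_sroot]
          sroot_scoroot_self linear_neg[OF linear_sroot] linear_neg[OF Wv_linear[OF Wv_inv[OF 2(1)]]])
    then show "C = {v. \<forall>i. 0 < (sroot M i \<circ> inv (w \<circ> srefl M i)) v}"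
      using Wv_inv_apply[OF 2(1)] unfolding 2(2) Fv_def
      by (auto simp: image_iff) (metis add.inverse_inverse)
  qed
qed

text \<open>Because the \<open>\<Lambda>\<^sub>\<alpha>\<close> are unbounded, a sector contains the enclosures of those of its shortenings that
  lie deep enough inside.  So the axioms on splayed or solid chimneys apply to sector germs.\<close>

lemma sector_germ_eq_chimney_germ:
  assumes C: "C \<in> chambers M"
  shows "sector_face_germ x C = chimney_germ M (local_face x C) C"
proof (rule filter_eq_iff[THEN iffD2], intro allI iffI)
  note F = chamber_is_face[OF C]
  fix Q assume "eventually Q (sector_face_germ x C)"
  then obtain \<xi> where \<xi>: "\<xi> \<in> C" "\<And>c. c \<in> C \<Longrightarrow> Q (x + \<xi> + c)"
    by (auto simp: eventually_sector_germ_iff[OF C])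
  obtain a where a: "\<And>i::'i. a i \<in> real_roots M" "C = {v. \<forall>i. 0 < a i v}"
    using chamber_roots[OF C] by metis
  have lin: "linear (a i)" for i using a(1) real_roots_km km_root_linear by blast
  have "\<forall>\<alpha>\<in>range a. \<exists>k. k \<in> Lam M \<alpha> \<and> k < - \<alpha> (x + \<xi>)" using Lam_unbounded a(1) by blast
  then obtain \<kappa> where \<kappa>: "\<And>\<alpha>. \<alpha> \<in> range a \<Longrightarrow> \<kappa> \<alpha> \<in> Lam M \<alpha>"
    "\<And>\<alpha>. \<alpha> \<in> range a \<Longrightarrow> \<kappa> \<alpha> < - \<alpha> (x + \<xi>)" by metis
  let ?P = "{v. \<forall>\<alpha>\<in>range a. \<alpha> v + \<kappa> \<alpha> \<ge> 0}"
  have P: "?P \<in> enclosed_sets M" using a(1) \<kappa>(1) by (intro half_space_enclosed) auto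
  have "Q v" if "v \<in> ?P" for v
  proof -
    have "0 < a i (v - (x + \<xi>))" for i
    proof -
      have "\<kappa> (a i) < - a i (x + \<xi>)" by (rule \<kappa>(2)) simp
      moreover have "a i v + \<kappa> (a i) \<ge> 0" using that by simp
      ultimately show ?thesis by (simp add: linear_diff[OF lin])
    qed
    then have "v - (x + \<xi>) \<in> C" by (simp add: a(2))
    then show ?thesis using \<xi>(2)[of "v - (x + \<xi>)"] by simp
  qed
  moreover
  have "\<exists>n::nat. \<forall>i. a i (x + real n *\<^sub>R \<xi>) + \<kappa> (a i) \<ge> 0 \<and> n > 0"
  proof -
    have "\<forall>\<^sub>F n in sequentially. a i (x + real n *\<^sub>R \<xi>) + \<kappa> (a i) \<ge> 0" for i
    proof -
      have pos: "a i \<xi> > 0" using \<xi>(1) a(2) by blast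
      have "\<forall>\<^sub>F n in sequentially. real n \<ge> (- \<kappa> (a i) - a i x) / a i \<xi>"
        using filterlim_real_sequentially unfolding filterlim_at_top by blast
      then show ?thesis
      proof eventually_elim
        case (elim n)
        then have "- \<kappa> (a i) - a i x \<le> real n * a i \<xi>" using pos by (simp add: pos_divide_le_eq)
        then show ?case by (simp add: linear_add[OF lin] linear_cmul[OF lin])
      qed
    qed
    then have "\<forall>\<^sub>F n in sequentially. \<forall>i. a i (x + real n *\<^sub>R \<xi>) + \<kappa> (a i) \<ge> 0"
      by (rule eventually_all_finite)
    then have "\<forall>\<^sub>F n in sequentially. (\<forall>i. a i (x + real n *\<^sub>R \<xi>) + \<kappa> (a i) \<ge> 0) \<and> n > 0"
      by (rule eventually_conj[OF _ eventually_gt_at_top])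
    then show ?thesis using eventually_happens'[OF sequentially_bot] by blast
  qed
  then obtain n where n: "\<And>i. a i (x + real n *\<^sub>R \<xi>) + \<kappa> (a i) \<ge> 0" "n > 0" by blast
  have "x + real n *\<^sub>R \<xi> + u + d \<in> ?P" if "u \<in> C" "d \<in> C" for u d
  proof -
    have "a i (x + real n *\<^sub>R \<xi> + u + d) + \<kappa> (a i) \<ge> 0" for i
    proof -
      have "a i u > 0" "a i d > 0" using that a(2) by auto
      then show ?thesis using n(1)[of i] by (simp add: linear_add[OF lin])
    qed
    then show ?thesis by auto
  qed
  then have "tube (x + real n *\<^sub>R \<xi>) C C ?P"
    unfolding tube_def by (intro exI[of _ UNIV]) auto
  ultimately show "eventually Q (chimney_germ M (local_face x C) C)"
    unfolding eventually_chimney_germ_iff[OF F]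
    using P face_scale[OF F \<xi>(1), of "real n"] n(2)
    by (intro bexI[of _ "real n *\<^sub>R \<xi>"] bexI[of _ ?P]) auto
next
  note F = chamber_is_face[OF C]
  fix Q assume "eventually Q (chimney_germ M (local_face x C) C)"
  then obtain \<xi> P where \<xi>1: "\<xi> \<in> C" "tube (x + \<xi>) C C P" and P: "\<forall>v\<in>P. Q v"
    unfolding eventually_chimney_germ_iff[OF F] by blast
  obtain S where S: "open S" "0 \<in> S" "\<And>u d. u \<in> C \<Longrightarrow> u \<in> S \<Longrightarrow> d \<in> C \<Longrightarrow> x + \<xi> + u + d \<in> P"
    using \<xi>1(2) unfolding tube_def by blast
  note \<xi> = \<xi>1(1) P[THEN bspec] S
  obtain e where e: "e > 0" "\<And>t. 0 \<le> t \<Longrightarrow> t < e \<Longrightarrow> 0 + t *\<^sub>R \<xi> \<in> S"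
    using small_multiple_in_open[OF \<xi>(3,4)] by blast
  have u: "(e / 2) *\<^sub>R \<xi> \<in> C" "(e / 2) *\<^sub>R \<xi> \<in> S"
    using e(1) e(2)[of "e / 2"] face_scale[OF F \<xi>(1)] by auto
  then have "Q (x + (\<xi> + (e / 2) *\<^sub>R \<xi>) + c)" if "c \<in> C" for c
    using \<xi>(2)[OF \<xi>(5)[OF u that]] by (simp add: add.assoc)
  then show "eventually Q (sector_face_germ x C)"
    unfolding eventually_sector_germ_iff[OF C] using face_add[OF F \<xi>(1) u(1)] by blast
qed

text \<open>A point \<open>x + u\<close> of the chamber with \<open>e c - u \<in> C\<close> lies between \<open>x\<close> and \<open>x + e c\<close> for the order defined by \<open>C\<close>.
  As each root has a constant sign on \<open>C\<close>, a half-space containing both of these points contains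
  \<open>x + u\<close>.\<close>

lemma local_chamber_le_enclosure_segment:
  assumes C: "C \<in> chambers M" and c: "c \<in> C"
  shows "local_face x C \<le> enclosure M (germ_at x (closed_segment x (x + c)))"
proof (rule filter_leI)
  fix Q assume "eventually Q (enclosure M (germ_at x (closed_segment x (x + c))))"
  then obtain P where P: "P \<in> enclosed_sets M" "\<forall>v\<in>P. Q v"
    "eventually (\<lambda>v. v \<in> P) (germ_at x (closed_segment x (x + c)))"
    by (auto simp: eventually_enclosure_iff)
  obtain e where e: "e > 0" "\<And>s. s \<in> {0..e} \<Longrightarrow> x + s *\<^sub>R c \<in> P"
    using eventually_germ_segment[OF P(3)] by auto
  obtain k where k: "P = (\<Inter>\<alpha>\<in>real_roots M \<union> imaginary_roots M. half_space \<alpha> (k \<alpha>))"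
    using P(1) unfolding enclosed_sets_def by blast
  let ?S = "(\<lambda>u. e *\<^sub>R c - u) -` C"
  have "open ?S" by (rule open_vimage[OF chamber_open[OF C]]) (intro continuous_intros)
  moreover have "0 \<in> ?S" using face_scale[OF chamber_is_face[OF C] c e(1)] by simp
  moreover have "x + u \<in> P" if u: "u \<in> C" "u \<in> ?S" for u
  proof -
    have "x + u \<in> half_space \<beta> (k \<beta>)" if \<beta>: "\<beta> \<in> real_roots M \<union> imaginary_roots M" for \<beta>
    proof -
      have \<beta>': "\<beta> \<in> km_roots M" using \<beta> by (simp add: all_roots)
      have lin: "linear \<beta>" by (rule km_root_linear[OF \<beta>'])
      have "x + 0 *\<^sub>R c \<in> P" "x + e *\<^sub>R c \<in> P" using e(1) by (intro e(2), simp)+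
      then have xs: "0 \<le> ereal (\<beta> x) + k \<beta>" "0 \<le> ereal (\<beta> (x + e *\<^sub>R c)) + k \<beta>"
        using \<beta> unfolding k half_space_def by auto
      have "\<beta> x \<le> \<beta> (x + u) \<or> \<beta> (x + e *\<^sub>R c) \<le> \<beta> (x + u)"
        using root_sign_chamber[OF \<beta>' C]
      proof
        assume "\<forall>c\<in>C. 0 < \<beta> c"
        then show ?thesis using u(1) by (auto simp: linear_add[OF lin] less_imp_le)
      next
        assume "\<forall>c\<in>C. \<beta> c < 0"
        then have "\<beta> (e *\<^sub>R c - u) < 0" using u(2) by blast
        then show ?thesis by (simp add: linear_add[OF lin] linear_diff[OF lin])
      qed
      then obtain b where "b \<le> \<beta> (x + u)" "0 \<le> ereal b + k \<beta>" using xs by blast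
      then show ?thesis unfolding half_space_def
        by (auto intro: order_trans[OF _ add_right_mono[of "ereal b"]])
    qed
    then show ?thesis unfolding k by blast
  qed
  ultimately show "eventually Q (local_face x C)"
    unfolding eventually_local_face using P(2) by blast
qed

lemma minimal_face: "Fv M UNIV \<in> faces M"
  unfolding faces_def with_opposites_def positive_faces_def
  using Wv_id by (intro UnI1 CollectI exI[of _ id] exI[of _ UNIV]) simp

text \<open>All roots vanish on \<open>F\<^sup>v(I)\<close>.  Hence the enclosure of a point is a closed face, and the points
  common to two apartments can be used in (MA3) and (MA4).\<close>

lemma enclosure_minimal_face:
  "enclosure M (local_face y (Fv M UNIV)) \<le> enclosure M (principal {y})"
  unfolding enclosure_le_iff
proof (rule filter_leI)
  fix Q assume "eventually Q (enclosure M (principal {y}))"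
  then obtain P where P: "P \<in> enclosed_sets M" "y \<in> P" "\<forall>v\<in>P. Q v"
    by (auto simp: eventually_enclosure_iff eventually_principal)
  obtain k where k: "P = (\<Inter>\<alpha>\<in>real_roots M \<union> imaginary_roots M. half_space \<alpha> (k \<alpha>))"
    using P(1) unfolding enclosed_sets_def by blast
  have "y + u \<in> P" if u: "u \<in> Fv M UNIV" for u
  proof -
    have same: "\<beta> (y + u) = \<beta> y" if "\<beta> \<in> real_roots M \<union> imaginary_roots M" for \<beta>
      using that root_minimal_face[OF _ u, of \<beta>] linear_add[OF km_root_linear, of \<beta> y u]
      by (simp add: all_roots)
    have "y + u \<in> half_space \<beta> (k \<beta>) \<longleftrightarrow> y \<in> half_space \<beta> (k \<beta>)"
      if "\<beta> \<in> real_roots M \<union> imaginary_roots M" for \<beta>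
      using same[OF that] by (simp add: half_space_def)
    then show ?thesis using P(2) unfolding k by blast
  qed
  then show "eventually Q (local_face y (Fv M UNIV))"
    unfolding eventually_local_face using P(3) by (intro exI[of _ UNIV]) auto
qed

subsection \<open>Solidity and the action of the affine Weyl group\<close>

text \<open>A chimney based on a local chamber has interior points, so its support is the whole space.\<close>

lemma solid_of_chamber:
  assumes C: "C \<in> chambers M" and D: "D \<in> faces M"
  shows "solid M (chimney M (local_face x C) D)"
proof -
  have "U = UNIV" if U: "affine U" "chimney M (local_face x C) D \<le> principal U" for U
  proof -
    have "eventually (\<lambda>v. v \<in> U) (chimney M (local_face x C) D)" using U(2) by (simp add: le_principal)
    then obtain P' where P': "tube x C D P'" "\<forall>v\<in>P'. v \<in> U"
      unfolding eventually_chimney_iff by blast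
    obtain S where S: "open S" "0 \<in> S" "\<And>u d. u \<in> C \<Longrightarrow> u \<in> S \<Longrightarrow> d \<in> D \<Longrightarrow> x + u + d \<in> P'"
      using P'(1) unfolding tube_def by blast
    note P = S(1,2) P'(2)[THEN bspec] S(3)
    obtain d where d: "d \<in> D" using face_nonempty[OF D] by blast
    obtain c where c: "c \<in> C" using face_nonempty[OF chamber_is_face[OF C]] by blast
    obtain e where e: "e > 0" "\<And>t. 0 \<le> t \<Longrightarrow> t < e \<Longrightarrow> 0 + t *\<^sub>R c \<in> S"
      using small_multiple_in_open[OF P(1,2)] by blast
    let ?O = "(+) (x + d) ` (C \<inter> S)"
    have "open ?O" using chamber_open[OF C] P(1) by (intro open_translation open_Int)
    moreover have "?O \<subseteq> U" using P(3,4) d by (auto simp: algebra_simps)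
    moreover have "(e / 2) *\<^sub>R c \<in> C \<inter> S"
      using e(1) e(2)[of "e / 2"] face_scale[OF chamber_is_face[OF C] c] by auto
    ultimately have "interior U \<noteq> {}" by (metis IntI empty_iff image_is_empty interior_maximal subset_empty)
    then show "U = UNIV" using affine_hull_nonempty_interior[of U] U(1) by (metis affine_hull_eq)
  qed
  then have "support (chimney M (local_face x C) D) = UNIV" unfolding support_def by auto
  moreover have "direction (UNIV :: 'v set) = UNIV"
  proof -
    have "x \<in> direction UNIV" for x :: 'v
      unfolding direction_def by (intro CollectI exI[of _ x] exI[of _ 0]) simp
    then show ?thesis by blast
  qed
  ultimately have "{w \<in> Wv M. \<forall>u\<in>direction (support (chimney M (local_face x C) D)). w u = u} \<subseteq> {id}"
    by auto
  then show ?thesis unfolding solid_def using finite_subset by blast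
qed

lemma germ_at_Wa:
  assumes g: "g \<in> Wa M" shows "filtermap g (germ_at x S) = germ_at (g x) (g ` S)"
proof (rule filter_eq_iff[THEN iffD2], intro allI iffI)
  fix Q assume "eventually Q (filtermap g (germ_at x S))"
  then obtain U where U: "open U" "x \<in> U" "\<forall>v\<in>U. v \<in> S \<longrightarrow> Q (g v)"
    by (auto simp: germ_at_def eventually_filtermap eventually_inf_principal eventually_nhds)
  have "\<forall>v\<in>g ` U. v \<in> g ` S \<longrightarrow> Q v"
    using U(3) Wa_inv_apply(1)[OF g] by (metis imageE)
  then show "eventually Q (germ_at (g x) (g ` S))"
    unfolding germ_at_def eventually_inf_principal eventually_nhds
    using U(2) Wa_open[OF g U(1)] by (intro exI[of _ "g ` U"] conjI imageI) simp_all
next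
  fix Q assume "eventually Q (germ_at (g x) (g ` S))"
  then obtain U where U: "open U" "g x \<in> U" "\<forall>v\<in>U. v \<in> g ` S \<longrightarrow> Q v"
    by (auto simp: germ_at_def eventually_inf_principal eventually_nhds)
  have "open (inv g ` U)" by (rule Wa_open[OF Wa_inv[OF g] U(1)])
  moreover have "x \<in> inv g ` U" using U(2) Wa_inv_apply(1)[OF g] by (metis imageI)
  moreover have "\<forall>v\<in>inv g ` U. v \<in> S \<longrightarrow> Q (g v)" using U(3) Wa_inv_apply(2)[OF g] by auto
  ultimately show "eventually Q (filtermap g (germ_at x S))"
    unfolding germ_at_def eventually_filtermap eventually_inf_principal eventually_nhds by blast
qed

lemma local_face_Wa:
  assumes w: "w \<in> Wv M" "g = (\<lambda>v. w v + t)" and g: "g \<in> Wa M"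
  shows "filtermap g (local_face x E) = local_face (g x) (w ` E)"
proof -
  have "g ` (+) x ` E = (+) (g x) ` w ` E"
    by (simp add: image_image w linear_add[OF Wv_linear[OF w(1)]] ac_simps)
  then show ?thesis unfolding local_face_def germ_at_Wa[OF g] by simp
qed

lemma chimney_germ_Wa:
  assumes w: "w \<in> Wv M" "g = (\<lambda>v. w v + t)" and g: "g \<in> Wa M" and D: "D \<in> faces M"
  shows "filtermap g (chimney_germ M F D) = chimney_germ M (filtermap g F) (w ` D)"
proof (rule filter_eq_iff[THEN iffD2], intro allI)
  note D' = face_Wv[OF w(1) D]
  have add: "g (v + d) = g v + w d" for v d by (simp add: w linear_add[OF Wv_linear[OF w(1)]])
  have tr: "filtermap g (filtermap (\<lambda>v. v + \<xi>) F) = filtermap (\<lambda>v. v + w \<xi>) (filtermap g F)" for \<xi>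
    by (simp add: filtermap_filtermap add)
  have "filtermap g (filter_plus_set F D) = filter_plus_set (filtermap g F) (w ` D)" for F
    by (rule filter_eq_iff[THEN iffD2]) (simp add: eventually_filtermap eventually_filter_plus_set add)
  then have ch: "filtermap g (chimney M F D) = chimney M (filtermap g F) (w ` D)" for F
    unfolding chimney_def enclosure_Wa[OF g] by simp
  fix Q
  have "eventually Q (filtermap g (chimney_germ M F D)) \<longleftrightarrow>
      (\<exists>\<xi>\<in>D. eventually Q (filtermap g (chimney M (filtermap (\<lambda>v. v + \<xi>) F) D)))"
    unfolding eventually_filtermap[of Q g]
    by (rule eventually_chimney_germ[OF face_nonempty[OF D] face_add[OF D]])
  also have "\<dots> \<longleftrightarrow> eventually Q (chimney_germ M (filtermap g F) (w ` D))"
    unfolding ch tr by (simp add: eventually_chimney_germ[OF face_nonempty[OF D'] face_add[OF D']])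
  finally show "eventually Q (filtermap g (chimney_germ M F D)) =
      eventually Q (chimney_germ M (filtermap g F) (w ` D))" .
qed

end

section \<open>The axioms of a masure in terms of charts\<close>

locale masure_data = model_apartment_data M
  for M :: "('i::finite, 'v::euclidean_space, 'g::real_vector) apartment_data" +
  fixes \<Delta> :: "'d set" and \<A> :: "'d set set" and Iso :: "'d set \<Rightarrow> ('v \<Rightarrow> 'd) set"
  assumes masure: "masure M \<Delta> \<A> Iso"
begin

lemmas masure_axioms = masure[unfolded masure_def, THEN conjunct2, THEN conjunct2]
lemmas MA1 = masure_axioms[THEN conjunct1]
  and MA2 = masure_axioms[THEN conjunct2, THEN conjunct1]
  and MA3' = masure_axioms[THEN conjunct2, THEN conjunct2, THEN conjunct1]
  and MA4 = masure_axioms[THEN conjunct2, THEN conjunct2, THEN conjunct2, THEN conjunct1]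
  and MAO = masure_axioms[THEN conjunct2, THEN conjunct2, THEN conjunct2, THEN conjunct2]

lemma chart_obtain:
  assumes "A \<in> \<A>" obtains f\<^sub>0 where "bij_betw f\<^sub>0 UNIV A" "Iso A = {f\<^sub>0 \<circ> w | w. w \<in> Wa M}"
  using bspec[OF MA1 assms] unfolding apartment_structure_def by (elim exE conjE)

lemma chart_bij: assumes "A \<in> \<A>" "f \<in> Iso A" shows "bij_betw f UNIV A"
proof -
  obtain f\<^sub>0 where f\<^sub>0: "bij_betw f\<^sub>0 UNIV A" "Iso A = {f\<^sub>0 \<circ> w | w. w \<in> Wa M}"
    by (rule chart_obtain[OF assms(1)])
  then obtain w where "w \<in> Wa M" "f = f\<^sub>0 \<circ> w" using assms(2) by blast
  then show ?thesis using bij_betw_trans[OF Wa_bij f\<^sub>0(1)] by simp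
qed

lemma chart_inj: "A \<in> \<A> \<Longrightarrow> f \<in> Iso A \<Longrightarrow> f u = f v \<longleftrightarrow> u = v"
  using chart_bij by (meson UNIV_I bij_betw_def inj_on_eq_iff)

lemma chart_range: "A \<in> \<A> \<Longrightarrow> f \<in> Iso A \<Longrightarrow> range f = A"
  using chart_bij by (simp add: bij_betw_def)

lemma chart_mem: "A \<in> \<A> \<Longrightarrow> f \<in> Iso A \<Longrightarrow> f v \<in> A"
  using chart_range by blast

lemma inv_chart:
  assumes "A \<in> \<A>" "f \<in> Iso A" shows "inv f (f v) = v" "x \<in> A \<Longrightarrow> f (inv f x) = x"
  using chart_bij[OF assms] by (auto simp: bij_betw_def f_inv_into_f)

lemma chart_comp: assumes "A \<in> \<A>" "f \<in> Iso A" "w \<in> Wa M" shows "f \<circ> w \<in> Iso A"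
proof -
  obtain f\<^sub>0 where f\<^sub>0: "bij_betw f\<^sub>0 UNIV A" "Iso A = {f\<^sub>0 \<circ> w | w. w \<in> Wa M}"
    by (rule chart_obtain[OF assms(1)])
  then obtain u where "f = f\<^sub>0 \<circ> u" "u \<in> Wa M" using assms(2) by blast
  then have "f \<circ> w = f\<^sub>0 \<circ> (u \<circ> w)" "u \<circ> w \<in> Wa M" using Wa_comp assms(3) by (auto simp: o_assoc)
  then show ?thesis unfolding f\<^sub>0(2) by blast
qed

lemma chart_change:
  assumes "A \<in> \<A>" "f \<in> Iso A" "f' \<in> Iso A" obtains w where "w \<in> Wa M" "f' = f \<circ> w"
proof -
  obtain f\<^sub>0 where f\<^sub>0: "bij_betw f\<^sub>0 UNIV A" "Iso A = {f\<^sub>0 \<circ> w | w. w \<in> Wa M}"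
    by (rule chart_obtain[OF assms(1)])
  then obtain u u' where u: "f = f\<^sub>0 \<circ> u" "u \<in> Wa M" "f' = f\<^sub>0 \<circ> u'" "u' \<in> Wa M" using assms by blast
  then have "f' = f \<circ> (inv u \<circ> u')" using Wa_inv_apply(2)[OF u(2)] by auto
  then show thesis using that Wa_comp Wa_inv u by blast
qed

lemma chart_in: assumes "A \<in> \<A>" shows "chart Iso A \<in> Iso A"
proof -
  obtain f\<^sub>0 where "Iso A = {f\<^sub>0 \<circ> w | w. w \<in> Wa M}" by (rule chart_obtain[OF assms])
  then have "\<exists>f. f \<in> Iso A" using Wa_id by blast
  then show ?thesis unfolding chart_def by (rule someI_ex)
qed

lemma chart_le: "A \<in> \<A> \<Longrightarrow> f \<in> Iso A \<Longrightarrow> filtermap f F \<le> principal A"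
  by (simp add: le_principal eventually_filtermap chart_mem)

lemma filtermap_agree:
  assumes "eventually (\<lambda>v. f' v = f v) F" shows "filtermap f' F = filtermap f F"
proof (rule filter_eq_iff[THEN iffD2], intro allI)
  fix P
  have "eventually (\<lambda>v. P (f' v)) F" if "eventually (\<lambda>v. P (f v)) F"
    using that assms by eventually_elim simp
  moreover have "eventually (\<lambda>v. P (f v)) F" if "eventually (\<lambda>v. P (f' v)) F"
    using that assms by eventually_elim simp
  ultimately show "eventually P (filtermap f' F) = eventually P (filtermap f F)"
    by (auto simp: eventually_filtermap)
qed

lemma filter_in_chart:
  assumes "A \<in> \<A>" "f \<in> Iso A" "F \<le> principal A"
  shows "F = filtermap f (filtermap (inv f) F)"
proof -
  have "eventually (\<lambda>x. f (inv f x) = x) F"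
    using assms(3) inv_chart(2)[OF assms(1,2)] by (auto simp: le_principal elim: eventually_mono)
  then have "filtermap (\<lambda>x. f (inv f x)) F = filtermap (\<lambda>x. x) F"
    by (rule filtermap_agree)
  then show ?thesis by (simp add: filtermap_filtermap)
qed

text \<open>A Weyl isomorphism from \<open>A\<close> to \<open>A'\<close> is the same as a chart \<open>f'\<close> of \<open>A'\<close> corresponding to a given chart \<open>f\<close>
  of \<open>A\<close>; it fixes \<open>f v\<close> if and only if \<open>f' v = f v\<close>.  In the sequel isomorphisms are replaced by pairs of
  charts, and fixing a filter by the agreement of charts.\<close>

lemma weyl_isomorphism_iff:
  assumes "A \<in> \<A>" "A' \<in> \<A>" "f \<in> Iso A"
  shows "weyl_isomorphism M Iso A A' \<phi> \<longleftrightarrow> \<phi> \<circ> f \<in> Iso A'"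
proof
  assume \<phi>: "weyl_isomorphism M Iso A A' \<phi>"
  let ?f' = "chart Iso A'"
  have f': "?f' \<in> Iso A'" by (rule chart_in[OF assms(2)])
  have w: "inv ?f' \<circ> \<phi> \<circ> f \<in> Wa M" using \<phi> assms(3) f' by (simp add: apartment_map_def)
  have "\<phi> (f v) \<in> A'" for v
    using \<phi> chart_mem[OF assms(1,3)] by (auto simp: apartment_map_def bij_betw_def)
  then have "\<phi> \<circ> f = ?f' \<circ> (inv ?f' \<circ> \<phi> \<circ> f)" using inv_chart(2)[OF assms(2) f'] by auto
  then show "\<phi> \<circ> f \<in> Iso A'" using chart_comp[OF assms(2) f' w] by simp
next
  assume \<phi>: "\<phi> \<circ> f \<in> Iso A'"
  have "bij_betw \<phi> A A'"
    using bij_betw_comp_iff[OF chart_bij[OF assms(1,3)]] chart_bij[OF assms(2) \<phi>] by blast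
  moreover have "inv h' \<circ> \<phi> \<circ> h \<in> Wa M" if h: "h \<in> Iso A" "h' \<in> Iso A'" for h h'
  proof -
    obtain w w' where w: "w \<in> Wa M" "h = f \<circ> w" "w' \<in> Wa M" "\<phi> \<circ> f = h' \<circ> w'"
      using chart_change[OF assms(1,3) h(1)] chart_change[OF assms(2) h(2) \<phi>] by metis
    have "\<phi> (f (w v)) = h' (w' (w v))" for v using w(4) by (metis comp_apply)
    then have "inv h' \<circ> \<phi> \<circ> h = w' \<circ> w"
      using inv_chart(1)[OF assms(2) h(2)] by (auto simp: w(2))
    then show ?thesis using Wa_comp w by simp
  qed
  ultimately show "weyl_isomorphism M Iso A A' \<phi>" by (simp add: apartment_map_def)
qed

lemma enclosure_in_chart:
  assumes "A \<in> \<A>" "f \<in> Iso A"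
  shows "enclosure_in M Iso A (filtermap f F) = filtermap f (enclosure M F)"
proof -
  note c = chart_in[OF assms(1)]
  obtain w where w: "w \<in> Wa M" "f = chart Iso A \<circ> w" using chart_change[OF assms(1) c assms(2)] .
  have "coord Iso A \<circ> f = w"
    using inv_chart(1)[OF assms(1) c] by (auto simp: coord_def w(2))
  then have "enclosure_in M Iso A (filtermap f F) = filtermap (chart Iso A) (enclosure M (filtermap w F))"
    by (simp add: enclosure_in_def filtermap_filtermap o_def[symmetric])
  also have "\<dots> = filtermap f (enclosure M F)"
    by (simp add: enclosure_Wa[OF w(1), symmetric] filtermap_filtermap w(2) o_def)
  finally show ?thesis .
qed

text \<open>Notions are transferred to an apartment along a fixed chart; for a family of filters that is stable
  under the affine Weyl group any chart will do.\<close>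

lemma filters_in_chart:
  assumes "A \<in> \<A>" "f \<in> Iso A" "F \<in> N"
    "\<And>g w t F. g \<in> Wa M \<Longrightarrow> w \<in> Wv M \<Longrightarrow> g = (\<lambda>v. w v + t) \<Longrightarrow> F \<in> N \<Longrightarrow> filtermap g F \<in> N"
  shows "filtermap f F \<in> filters_in Iso A N"
proof -
  obtain g where g: "g \<in> Wa M" "f = chart Iso A \<circ> g"
    using chart_change[OF assms(1) chart_in[OF assms(1)] assms(2)] .
  then have "filtermap f F = filtermap (chart Iso A) (filtermap g F)"
    by (simp add: filtermap_filtermap o_def)
  moreover obtain w t where "w \<in> Wv M" "g = (\<lambda>v. w v + t)" by (rule Wa_affine[OF g(1)])
  ultimately show ?thesis unfolding filters_in_def using assms(3,4) g(1) by blast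
qed

lemma filters_in_mono: "N \<subseteq> N' \<Longrightarrow> filters_in Iso A N \<subseteq> filters_in Iso A N'"
  unfolding filters_in_def by blast

lemma in_segment: "z \<in> closed_segment x y \<longleftrightarrow> (\<exists>s\<in>{0..1}. z = x + s *\<^sub>R (y - x))" for x y z :: 'v
proof -
  have "(1 - s) *\<^sub>R x + s *\<^sub>R y = x + s *\<^sub>R (y - x)" for s by (simp add: algebra_simps)
  then show ?thesis unfolding closed_segment_def by auto
qed

lemma Wa_closed_segment: "g \<in> Wa M \<Longrightarrow> g ` closed_segment x y = closed_segment (g x) (g y)"
proof -
  have "closed_segment a b = (\<lambda>s. a + s *\<^sub>R (b - a)) ` {0..1}" for a b :: 'v
    by (rule set_eqI) (simp only: in_segment image_iff)
  then show "g \<in> Wa M \<Longrightarrow> ?thesis" by (simp add: image_image Wa_segment)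
qed

lemma point_in_chart:
  "A \<in> \<A> \<Longrightarrow> f \<in> Iso A \<Longrightarrow> filtermap f (principal {p}) \<in> filters_in Iso A points"
  by (rule filters_in_chart) (auto simp: points_def)

lemma segment_germ_in_chart:
  assumes "A \<in> \<A>" "f \<in> Iso A" "x \<noteq> y" "comparable (y - x)"
  shows "filtermap f (germ_at x (closed_segment x y)) \<in> filters_in Iso A (preordered_segment_germs M)"
proof (rule filters_in_chart[OF assms(1,2)])
  have eq: "preordered_segment_germs M = {germ_at x (closed_segment x y) | x y. x \<noteq> y \<and> comparable (y - x)}"
    unfolding preordered_segment_germs_def tle_def comparable_def by simp
  show "germ_at x (closed_segment x y) \<in> preordered_segment_germs M" unfolding eq using assms by blast
  fix w u :: "'v \<Rightarrow> 'v" and t F assume w: "w \<in> Wa M" "F \<in> preordered_segment_germs M"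
  then obtain x y where F: "F = germ_at x (closed_segment x y)" "x \<noteq> y" "comparable (y - x)"
    unfolding eq by blast
  have "filtermap w F = germ_at (w x) (closed_segment (w x) (w y))"
    unfolding F(1) germ_at_Wa[OF w(1)] Wa_closed_segment[OF w(1)] ..
  moreover have "w x \<noteq> w y" using F(2) Wa_inv_apply(1)[OF w(1)] by metis
  ultimately show "filtermap w F \<in> preordered_segment_germs M"
    unfolding eq using Wa_comparable[OF w(1) F(3)] by blast
qed

lemma splayed_in_chart:
  assumes "A \<in> \<A>" "f \<in> Iso A" "E \<in> faces M" "D \<in> spherical_faces M"
  shows "filtermap f (chimney_germ M (local_face x E) D) \<in> filters_in Iso A (splayed_chimney_germs M)"
proof (rule filters_in_chart[OF assms(1,2)])
  show "chimney_germ M (local_face x E) D \<in> splayed_chimney_germs M"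
    using assms unfolding splayed_chimney_germs_def local_faces_def by blast
  fix g w t F assume g: "g \<in> Wa M" and w: "w \<in> Wv M" "g = (\<lambda>v. w v + t)" and "F \<in> splayed_chimney_germs M"
  then obtain x E D where F: "F = chimney_germ M (local_face x E) D" "E \<in> faces M" "D \<in> spherical_faces M"
    unfolding splayed_chimney_germs_def local_faces_def by blast
  show "filtermap g F \<in> splayed_chimney_germs M"
    unfolding F(1) chimney_germ_Wa[OF w g spherical_face_is_face[OF F(3)]] local_face_Wa[OF w g]
    using face_Wv[OF w(1) F(2)] spherical_face_Wv[OF w(1) F(3)]
    unfolding splayed_chimney_germs_def local_faces_def by blast
qed

lemma closed_face_in_chart:
  assumes "A \<in> \<A>" "f \<in> Iso A" "E \<in> faces M"
  shows "filtermap f (enclosure M (local_face x E)) \<in> filters_in Iso A (closed_faces M)"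
proof (rule filters_in_chart[OF assms(1,2)])
  show "enclosure M (local_face x E) \<in> closed_faces M"
    using assms unfolding closed_faces_def local_faces_def by blast
  fix g w t F assume g: "g \<in> Wa M" and w: "w \<in> Wv M" "g = (\<lambda>v. w v + t)" and "F \<in> closed_faces M"
  then obtain x E where F: "F = enclosure M (local_face x E)" "E \<in> faces M"
    unfolding closed_faces_def local_faces_def by blast
  show "filtermap g F \<in> closed_faces M"
    unfolding F(1) enclosure_Wa[OF g] local_face_Wa[OF w g]
    using face_Wv[OF w(1) F(2)] unfolding closed_faces_def local_faces_def by blast
qed

lemma solid_germ_in_chart:
  assumes "A \<in> \<A>" "f \<in> Iso A" "C \<in> chambers M" "D \<in> faces M"
  shows "filtermap f (chimney_germ M (local_face x C) D) \<in> filters_in Iso A (solid_chimney_germs M)"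
proof -
  let ?N = "{chimney_germ M (local_face x C) D | x C D. C \<in> chambers M \<and> D \<in> faces M}"
  have "?N \<subseteq> solid_chimney_germs M"
    using solid_of_chamber chamber_is_face unfolding solid_chimney_germs_def local_faces_def by blast
  moreover have "filtermap f (chimney_germ M (local_face x C) D) \<in> filters_in Iso A ?N"
  proof (rule filters_in_chart[OF assms(1,2)])
    show "chimney_germ M (local_face x C) D \<in> ?N" using assms by blast
    fix g w t F assume g: "g \<in> Wa M" and w: "w \<in> Wv M" "g = (\<lambda>v. w v + t)" and "F \<in> ?N"
    then obtain x C D where F: "F = chimney_germ M (local_face x C) D" "C \<in> chambers M" "D \<in> faces M"
      by blast
    show "filtermap g F \<in> ?N"
      unfolding F(1) chimney_germ_Wa[OF w g F(3)] local_face_Wa[OF w g]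
      using face_Wv[OF w(1) F(3)] chamber_Wv[OF w(1) F(2)] by blast
  qed
  ultimately show ?thesis using filters_in_mono by blast
qed

lemma local_chamber_in_chart:
  assumes "A \<in> \<A>" "f \<in> Iso A" "C \<in> chambers M"
  shows "filtermap f (local_face x C) \<in> filters_in Iso A (local_chambers M)"
proof (rule filters_in_chart[OF assms(1,2)])
  show "local_face x C \<in> local_chambers M" using assms unfolding local_chambers_def by blast
  fix g w t F assume g: "g \<in> Wa M" and w: "w \<in> Wv M" "g = (\<lambda>v. w v + t)" and "F \<in> local_chambers M"
  then obtain x C where F: "F = local_face x C" "C \<in> chambers M" unfolding local_chambers_def by blast
  show "filtermap g F \<in> local_chambers M"
    unfolding F(1) local_face_Wa[OF w g] using chamber_Wv[OF w(1) F(2)]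
    unfolding local_chambers_def by blast
qed

lemma sector_germ_in_chart:
  assumes "A \<in> \<A>" "f \<in> Iso A" "C \<in> chambers M"
  shows "filtermap f (sector_face_germ x C) \<in> filters_in Iso A (sector_germs M)"
proof (rule filters_in_chart[OF assms(1,2)])
  show "sector_face_germ x C \<in> sector_germs M" using assms unfolding sector_germs_def by blast
  fix g w t F assume g: "g \<in> Wa M" and w: "w \<in> Wv M" "g = (\<lambda>v. w v + t)" and "F \<in> sector_germs M"
  then obtain x C where F: "F = sector_face_germ x C" "C \<in> chambers M" unfolding sector_germs_def by blast
  show "filtermap g F \<in> sector_germs M"
    unfolding F(1) sector_germ_eq_chimney_germ[OF F(2)] chimney_germ_Wa[OF w g chamber_is_face[OF F(2)]]
      local_face_Wa[OF w g]
    using chamber_Wv[OF w(1) F(2)] sector_germ_eq_chimney_germ[symmetric]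
    unfolding sector_germs_def by blast
qed

lemma MA2_chart:
  assumes "ma2_situation M \<A> Iso A A' (filtermap f F)" "f \<in> Iso A"
  obtains f' where "f' \<in> Iso A'" "eventually (\<lambda>v. f' v = f v) (enclosure M F)"
proof -
  have A: "A \<in> \<A>" "A' \<in> \<A>" using assms(1) by (auto simp: ma2_situation_def)
  obtain \<phi> where \<phi>: "weyl_isomorphism M Iso A A' \<phi>"
    "\<forall>\<^sub>F x in enclosure_in M Iso A (filtermap f F). \<phi> x = x"
    using MA2[rule_format, OF assms(1)] by blast
  show thesis
  proof (rule that)
    show "\<phi> \<circ> f \<in> Iso A'" using weyl_isomorphism_iff[OF A assms(2)] \<phi>(1) by blast
    show "\<forall>\<^sub>F v in enclosure M F. (\<phi> \<circ> f) v = f v"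
      using \<phi>(2) by (simp add: enclosure_in_chart[OF A(1) assms(2)] eventually_filtermap)
  qed
qed

lemma MA2_point:
  assumes "A \<in> \<A>" "A' \<in> \<A>" "f \<in> Iso A" "f p \<in> A'"
  obtains f' where "f' \<in> Iso A'" "eventually (\<lambda>v. f' v = f v) (enclosure M (principal {p}))"
proof (rule MA2_chart[OF _ assms(3)])
  show "ma2_situation M \<A> Iso A A' (filtermap f (principal {p}))"
    unfolding ma2_situation_def
  proof (intro conjI)
    show "filtermap f (principal {p}) \<le> principal A'"
      using assms(4) by (simp add: le_principal eventually_filtermap eventually_principal)
    show "filtermap f (principal {p}) \<in> filters_in Iso A
        (points \<union> preordered_segment_germs M \<union> generic_rays M \<union> solid_chimneys M)"
      by (rule subsetD[OF filters_in_mono point_in_chart[OF assms(1,3)]]) blast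
  qed (use assms in auto)
qed

lemma segment_ma2:
  assumes "A \<in> \<A>" "A' \<in> \<A>" "f \<in> Iso A" "x \<noteq> y" "comparable (y - x)"
    "f ` closed_segment x y \<subseteq> A'"
  shows "ma2_situation M \<A> Iso A A' (filtermap f (germ_at x (closed_segment x y)))"
  unfolding ma2_situation_def
proof (intro conjI)
  show "filtermap f (germ_at x (closed_segment x y)) \<le> principal A'"
    using assms(6)
    by (auto simp: le_principal eventually_filtermap germ_at_def eventually_inf_principal
        intro!: always_eventually)
  show "filtermap f (germ_at x (closed_segment x y)) \<in> filters_in Iso A
      (points \<union> preordered_segment_germs M \<union> generic_rays M \<union> solid_chimneys M)"
    by (rule subsetD[OF filters_in_mono segment_germ_in_chart[OF assms(1,3-5)]]) blast
qed (use assms in auto)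

lemma MA3:
  assumes "ma3_situation M \<A> Iso R F" obtains A where "A \<in> \<A>" "R \<le> principal A" "F \<le> principal A"
  using MA3'[rule_format, OF assms] by blast

lemma ma3_situationI:
  assumes "A \<in> \<A>" "R \<in> filters_in Iso A (splayed_chimney_germs M)" "B \<in> \<A>"
    "F \<in> filters_in Iso B (closed_faces M) \<or> F \<in> filters_in Iso B (solid_chimney_germs M)"
  shows "ma3_situation M \<A> Iso R F"
  using assms filters_in_mono[of "closed_faces M" "closed_faces M \<union> solid_chimney_germs M"]
    filters_in_mono[of "solid_chimney_germs M" "closed_faces M \<union> solid_chimney_germs M"]
  unfolding ma3_situation_def by blast

lemma MA4_chart:
  assumes "ma4_situation M \<A> Iso A A' (filtermap f R) (filtermap f F)" "f \<in> Iso A"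
  obtains f' where "f' \<in> Iso A'" "eventually (\<lambda>v. f' v = f v) (enclosure M (sup R F))"
proof -
  have A: "A \<in> \<A>" "A' \<in> \<A>" using assms(1) by (auto simp: ma4_situation_def)
  obtain \<phi> where \<phi>: "weyl_isomorphism M Iso A A' \<phi>"
    "\<forall>\<^sub>F x in enclosure_in M Iso A (sup (filtermap f R) (filtermap f F)). \<phi> x = x"
    using MA4[rule_format, OF assms(1)] by blast
  show thesis
  proof (rule that)
    show "\<phi> \<circ> f \<in> Iso A'" using weyl_isomorphism_iff[OF A assms(2)] \<phi>(1) by blast
    show "\<forall>\<^sub>F v in enclosure M (sup R F). (\<phi> \<circ> f) v = f v"
      using \<phi>(2) by (simp add: filtermap_sup[symmetric] enclosure_in_chart[OF A(1) assms(2)] eventually_filtermap)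
  qed
qed

lemma MAO_chart:
  assumes "A \<in> \<A>" "A' \<in> \<A>" "f \<in> Iso A" "f' \<in> Iso A'" "f p = f' p'" "f z = f' z'" "comparable (z - p)"
  shows "f ` closed_segment p z = f' ` closed_segment p' z'"
proof -
  have seg: "segment_in Iso B (h a) (h b) = h ` closed_segment a b" and
    le: "le_in M Iso B (h a) (h b) \<longleftrightarrow> b - a \<in> tits_cone M"
    if B: "B \<in> \<A>" "h \<in> Iso B" for B h a b
  proof -
    note c = chart_in[OF B(1)]
    obtain w where w: "w \<in> Wa M" "h = chart Iso B \<circ> w" using chart_change[OF B(1) c B(2)] .
    have co: "coord Iso B (h v) = w v" for v using inv_chart(1)[OF B(1) c] by (simp add: coord_def w(2))
    show "segment_in Iso B (h a) (h b) = h ` closed_segment a b"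
      unfolding segment_in_def co Wa_closed_segment[OF w(1), symmetric] by (simp add: image_comp w(2))
    obtain u t where u: "u \<in> Wv M" "w = (\<lambda>v. u v + t)" by (rule Wa_affine[OF w(1)])
    have "w b - w a = u (b - a)" by (simp add: u(2) linear_diff[OF Wv_linear[OF u(1)]])
    moreover have "u (b - a) \<in> tits_cone M \<longleftrightarrow> b - a \<in> tits_cone M"
      using tits_cone_Wv[OF u(1)] tits_cone_Wv[OF Wv_inv[OF u(1)]] Wv_inv_apply(1)[OF u(1)] by metis
    ultimately show "le_in M Iso B (h a) (h b) \<longleftrightarrow> b - a \<in> tits_cone M"
      unfolding le_in_def tle_def co by simp
  qed
  have mao: "segment_in Iso A x y = segment_in Iso A' x y"
    if "x \<in> A \<inter> A'" "y \<in> A \<inter> A'" "le_in M Iso A x y" for x y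
    by (rule MAO[rule_format, OF assms(1,2) that])
  have mem: "f p \<in> A \<inter> A'" "f z \<in> A \<inter> A'"
    by (metis IntI assms(5,6) chart_mem[OF assms(1,3)] chart_mem[OF assms(2,4)])+
  from assms(7) consider "z - p \<in> tits_cone M" | "p - z \<in> tits_cone M"
    unfolding comparable_def by auto
  then show ?thesis
  proof cases
    case 1
    then show ?thesis using mao[OF mem] le[OF assms(1,3)] seg[OF assms(1,3)] seg[OF assms(2,4)] assms(5,6)
      by metis
  next
    case 2
    then have "f ` closed_segment z p = f' ` closed_segment z' p'"
      using mao[OF mem(2,1)] le[OF assms(1,3)] seg[OF assms(1,3)] seg[OF assms(2,4)] assms(5,6) by metis
    then show ?thesis by (simp add: closed_segment_commute)
  qed
qed

section \<open>Rigidity of charts\<close>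

text \<open>An affine map is determined by its restriction to an open set.\<close>

lemma chart_eq_on_open:
  assumes "A \<in> \<A>" "f \<in> Iso A" "f' \<in> Iso A" "open U" "U \<noteq> {}" "\<And>v. v \<in> U \<Longrightarrow> f v = f' v"
  shows "f = f'"
proof -
  obtain w where w: "w \<in> Wa M" "f' = f \<circ> w" using chart_change[OF assms(1-3)] .
  have "w v = id v" if "v \<in> U" for v
    using assms(6)[OF that] chart_inj[OF assms(1,2)] by (simp add: w(2))
  then have "w = id" by (rule Wa_eq_on_open[OF w(1) Wa_id assms(4,5)])
  then show ?thesis by (simp add: w(2))
qed

lemma local_chamber_open_subset:
  assumes "C \<in> chambers M" "eventually Q (local_face x C)"
  obtains U where "open U" "U \<noteq> {}" "\<And>v. v \<in> U \<Longrightarrow> Q v" "U \<subseteq> (+) x ` C"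
proof -
  obtain S where S: "open S" "0 \<in> S" "\<forall>u\<in>C \<inter> S. Q (x + u)"
    using assms(2) unfolding eventually_local_face by blast
  obtain c where c: "c \<in> C" using face_nonempty[OF chamber_is_face[OF assms(1)]] by blast
  obtain e where e: "e > 0" "\<And>t. 0 \<le> t \<Longrightarrow> t < e \<Longrightarrow> 0 + t *\<^sub>R c \<in> S"
    using small_multiple_in_open[OF S(1,2)] by blast
  have "(e / 2) *\<^sub>R c \<in> C \<inter> S"
    using e(1) e(2)[of "e / 2"] face_scale[OF chamber_is_face[OF assms(1)] c] by auto
  then show thesis
    using S chamber_open[OF assms(1)]
    by (intro that[of "(+) x ` (C \<inter> S)"]) (auto intro: open_translation open_Int)
qed

lemma chimney_germ_open_subset:
  assumes "C \<in> chambers M" "D \<in> faces M" "eventually Q (chimney_germ M (local_face x C) D)"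
  obtains U where "open U" "U \<noteq> {}" "\<And>v. v \<in> U \<Longrightarrow> Q v"
proof -
  obtain \<xi> P where P: "\<xi> \<in> D" "P \<in> enclosed_sets M" "tube (x + \<xi>) C D P" "\<forall>v\<in>P. Q v"
    using assms(3) unfolding eventually_chimney_germ_iff[OF assms(2)] by blast
  have "eventually (\<lambda>v. v \<in> P) (local_face (x + \<xi>) C)"
    by (rule tube_base(2)[OF enclosed_closed_convex(1)[OF P(2)] chamber_is_face[OF assms(1)] assms(2) P(3)])
  then show thesis
    using local_chamber_open_subset[OF assms(1)] P(4) that by metis
qed

lemma Wv_norm_dim1:
  assumes "DIM('v) = 1" "w \<in> Wv M" shows "norm (w v) = norm v"
  using assms(2) unfolding Wv_def WvJ_def
proof (induction arbitrary: v rule: generated.induct)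
  case (gen_base s)
  then obtain i where s: "s = srefl M i" by blast
  have c0: "scoroot M i \<noteq> 0"
    using sroot_scoroot_self[of i] linear_0[OF linear_sroot, of i] by force
  have "dim {scoroot M i} = 1" using c0 by (simp add: dim_eq_card_independent)
  then have "span {scoroot M i} = UNIV" using assms(1) by (metis dim_eq_full)
  then obtain k where "v = k *\<^sub>R scoroot M i" by (metis UNIV_I span_singleton rangeE)
  then have "s v = - v"
    by (simp add: s srefl_def linear_cmul[OF linear_sroot] sroot_scoroot_self algebra_simps)
       (simp add: scaleR_2[symmetric])
  then show ?case by simp
next
  case (gen_inv g)
  then have "g \<in> Wv M" by (simp add: Wv_def WvJ_def)
  then show ?case using gen_inv.IH[of "inv g v"] Wv_inv_apply(2)[of g v] by simp
qed auto

text \<open>By (MAO) the point \<open>p'\<close> lies on the half-line from \<open>z\<close> through \<open>p\<close>, for each \<open>z\<close> in \<open>U\<close>.  If \<open>p' \<noteq> p\<close>, all of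
  \<open>U\<close> is therefore contained in the line through \<open>p\<close> and \<open>p'\<close>, so that \<open>V\<close> has dimension one.  In this
  case the Weyl group is \<open>{\<plusminus>1}\<close>, and by (MA2) the transition map between the two charts is an isometry
  near each point of the segment from \<open>z\<close> to \<open>p\<close>, which gives \<open>p' = p\<close> again.\<close>

lemma same_coordinates:
  assumes A: "A \<in> \<A>" "A' \<in> \<A>" "f \<in> Iso A" "f' \<in> Iso A'"
    and U: "open U" "U \<noteq> {}" "\<And>z. z \<in> U \<Longrightarrow> f z = f' z"
    and p: "f p = f' p'" "\<And>z. z \<in> U \<Longrightarrow> comparable (z - p)"
  shows "p' = p"
proof (rule ccontr)
  assume ne: "p' \<noteq> p"
  then have pU: "p \<notin> U" using U(3) p(1) chart_inj[OF A(2,4)] by metis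
  have ray: "\<exists>l>0. p' - z = l *\<^sub>R (p - z)" if z: "z \<in> U" for z
  proof -
    obtain e where e: "e > 0" "\<And>t. 0 \<le> t \<Longrightarrow> t < e \<Longrightarrow> z + t *\<^sub>R (p - z) \<in> U"
      using small_multiple_in_open[OF U(1) z] by blast
    define t where "t = min e 1 / 2"
    have t: "0 < t" "t < e" "t \<le> 1" using e(1) by (auto simp: t_def)
    let ?u = "z + t *\<^sub>R (p - z)"
    have "?u \<in> closed_segment z p" unfolding in_segment using t by auto
    then have "f ?u \<in> f' ` closed_segment p' z"
      using MAO_chart[OF A p(1) U(3)[OF z] p(2)[OF z]] by (auto simp: closed_segment_commute)
    then have "?u \<in> closed_segment z p'"
      using U(3)[OF e(2)[of t]] t chart_inj[OF A(2,4)] by (auto simp: closed_segment_commute)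
    then obtain s where s: "s \<in> {0..1}" "t *\<^sub>R (p - z) = s *\<^sub>R (p' - z)" unfolding in_segment by auto
    have "s \<noteq> 0" using s(2) t(1) pU z by auto
    then have "p' - z = (t / s) *\<^sub>R (p - z)" using s(2)
      by (metis (no_types, opaque_lifting) divide_inverse mult.commute scaleR_scaleR left_inverse scaleR_one)
    moreover have "t / s > 0" using s(1) t(1) \<open>s \<noteq> 0\<close> by auto
    ultimately show ?thesis by blast
  qed
  have "U \<subseteq> (+) p ` span {p' - p}"
  proof
    fix z assume "z \<in> U"
    then obtain l where l: "p' - z = l *\<^sub>R (p - z)" using ray by blast
    then have eq: "p' - p = (l - 1) *\<^sub>R (p - z)" by (simp add: algebra_simps)
    then have "l \<noteq> 1" using ne by auto
    then have "z - p = (- 1 / (l - 1)) *\<^sub>R (p' - p)" unfolding eq by simp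
    then have "z - p \<in> span {p' - p}" by (metis insertI1 span_base span_scale)
    then show "z \<in> (+) p ` span {p' - p}" by (metis add.commute diff_add_cancel imageI)
  qed
  then have "interior ((+) p ` span {p' - p}) \<noteq> {}" using U(1,2) interior_maximal by blast
  moreover have "affine ((+) p ` span {p' - p})"
    using affine_translation subspace_imp_affine[OF subspace_span] by blast
  ultimately have "(+) p ` span {p' - p} = UNIV"
    using affine_hull_nonempty_interior by (metis affine_hull_eq)
  then have "v \<in> span {p' - p}" for v by (metis UNIV_I add_left_imp_eq imageE)
  then have "span {p' - p} = UNIV" by blast
  then have "dim {p' - p} = DIM('v)" by (metis dim_UNIV dim_span)
  moreover have "dim {p' - p} \<le> 1" using dim_le_card'[of "{p' - p}"] by simp
  ultimately have dim1: "DIM('v) = 1" using DIM_positive[where 'a='v] by linarith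
  have iso: "norm (g a - g b) = norm (a - b)" if g: "g \<in> Wa M" for g a b
  proof -
    obtain w t where w: "w \<in> Wv M" "g = (\<lambda>v. w v + t)" by (rule Wa_affine[OF g])
    then show ?thesis using Wv_norm_dim1[OF dim1 w(1), of "a - b"] by (simp add: linear_diff[OF Wv_linear])
  qed
  obtain z where z: "z \<in> U" using U(2) by blast
  have cmp: "comparable (r *\<^sub>R (z - p))" if "r \<noteq> 0" for r
  proof -
    have "comparable (s *\<^sub>R v)" if "comparable v" "s > 0" for s v
      using that face_scale unfolding comparable_iff by blast
    then show ?thesis using p(2)[OF z] that comparable_uminus
      by (metis linorder_neqE_linordered_idom neg_0_less_iff_less scaleR_minus_left)
  qed
  define q where "q = (\<lambda>s::real. z + s *\<^sub>R (p - z))"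
  define j where "j = (\<lambda>s. inv f' (f (q s)))"
  have qdiff: "q s - q s' = (s' - s) *\<^sub>R (z - p)" for s s' by (simp add: q_def algebra_simps)
  have segs: "q r \<in> closed_segment (q s) (q s')" if "s \<le> r" "r \<le> s'" for r s s'
  proof (cases "s = s'")
    case False
    have "q s + k *\<^sub>R (q s' - q s) = q (s + k * (s' - s))" for k by (simp add: q_def algebra_simps)
    from this[of "(r - s) / (s' - s)"] have "q r = q s + ((r - s) / (s' - s)) *\<^sub>R (q s' - q s)"
      using False by simp
    then show ?thesis unfolding in_segment using that False
      by (intro bexI[of _ "(r - s) / (s' - s)"]) (auto simp: divide_simps)
  qed (use that in auto)
  have q01: "q 0 = z" "q 1 = p" by (auto simp: q_def)
  have fq: "f (q s) \<in> A'" if "s \<in> {0..1}" for s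
  proof -
    have "f (q s) \<in> f ` closed_segment p z"
      using segs[of 0 s 1] that by (auto simp: q01 closed_segment_commute)
    then show ?thesis using MAO_chart[OF A p(1) U(3)[OF z] p(2)[OF z]] chart_mem[OF A(2,4)] by auto
  qed
  have fj: "f (q s) = f' (j s)" if "s \<in> {0..1}" for s
    unfolding j_def using inv_chart(2)[OF A(2,4) fq[OF that]] by simp
  have jz: "j 0 = z" unfolding j_def q01 U(3)[OF z] by (rule inv_chart(1)[OF A(2,4)])
  have jp: "j 1 = p'" unfolding j_def q01 p(1) by (rule inv_chart(1)[OF A(2,4)])
  \<comment> \<open>The transition map preserves the distances from \<open>z\<close>: by the next two facts the error is a locally
    constant function on the segment from \<open>z\<close> to \<open>p\<close>, and it vanishes at \<open>z\<close>.\<close>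
  have btw: "norm (j s - z) = norm (j r - z) + norm (j s - j r)" if "0 \<le> r" "r \<le> s" "s \<le> 1" for r s
  proof (cases "s = 0")
    case False
    have "comparable (q 0 - q s)" unfolding qdiff using cmp False by simp
    then have "f ` closed_segment (q s) z = f' ` closed_segment (j s) z"
      using MAO_chart[OF A, of "q s" "j s" z z] fj that U(3)[OF z] by (simp add: q01)
    moreover have "q r \<in> closed_segment (q s) z" using segs[of 0 r s] that by (simp add: q01 closed_segment_commute)
    ultimately have "f (q r) \<in> f' ` closed_segment (j s) z" by (metis imageI)
    then have "f' (j r) \<in> f' ` closed_segment (j s) z" using fj[of r] that by simp
    then have "j r \<in> closed_segment (j s) z" using chart_inj[OF A(2,4)] by auto
    then have "dist (j s) z = dist (j s) (j r) + dist (j r) z"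
      unfolding between_mem_segment[symmetric] between by simp
    then show ?thesis by (simp add: dist_norm)
  qed (use that jz in auto)
  have seg_iso: "\<exists>e>0. \<forall>r\<in>closed_segment s b. \<bar>r - s\<bar> < e \<longrightarrow> norm (j r - j s) = norm (q r - q s)"
    if s: "s \<in> {0..1}" "b \<in> {0..1}" for s b
  proof (cases "b = s")
    case True
    then show ?thesis by (intro exI[of _ 1]) auto
  next
    case s3: False
    have ne: "q s \<noteq> q b" using qdiff[of s b] s3 pU z by auto
    have sub: "f ` closed_segment (q s) (q b) \<subseteq> A'"
    proof -
      have "closed_segment (q s) (q b) \<subseteq> closed_segment (q 0) (q 1)"
        using segs[of 0 s 1] segs[of 0 b 1] s by (simp add: closed_segment_subset convex_closed_segment)
      moreover have "f v \<in> A'" if "v \<in> closed_segment (q 0) (q 1)" for v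
        using that fq unfolding in_segment by (auto simp: q_def)
      ultimately show ?thesis by blast
    qed
    obtain f'' where f'': "f'' \<in> Iso A'"
      "eventually (\<lambda>v. f'' v = f v) (enclosure M (germ_at (q s) (closed_segment (q s) (q b))))"
      using MA2_chart[OF segment_ma2[OF A(1,2,3) ne _ sub] A(3)] cmp[of "s - b"] qdiff[of b s] s3 by auto
    obtain w where w: "w \<in> Wa M" "f'' = f' \<circ> w" using chart_change[OF A(2,4) f''(1)] .
    have "eventually (\<lambda>v. f'' v = f v) (germ_at (q s) (closed_segment (q s) (q b)))"
      using f''(2) enclosure_extensive by (auto simp: le_filter_def)
    from eventually_germ_segment[OF this] obtain e
      where e: "e > 0" "\<And>t. t \<in> {0..e} \<Longrightarrow> f'' (q s + t *\<^sub>R (q b - q s)) = f (q s + t *\<^sub>R (q b - q s))"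
      by blast
    have jw: "j (s + t * (b - s)) = w (q (s + t * (b - s)))"
      if "t \<in> {0..e}" for t
    proof -
      have "q s + t *\<^sub>R (q b - q s) = q (s + t * (b - s))" by (simp add: q_def algebra_simps)
      then have "f' (w (q (s + t * (b - s)))) = f (q (s + t * (b - s)))" using e(2)[OF that] by (simp add: w(2))
      then show ?thesis unfolding j_def using inv_chart(1)[OF A(2,4)] by metis
    qed
    show ?thesis
    proof (intro exI[of _ "e * \<bar>b - s\<bar>"] conjI ballI impI)
      fix r assume r: "r \<in> closed_segment s b" "\<bar>r - s\<bar> < e * \<bar>b - s\<bar>"
      define t where "t = (r - s) / (b - s)"
      have "r = s + t * (b - s)" using s3 by (simp add: t_def)
      moreover have "0 \<le> t" using r(1) by (auto simp: t_def zero_le_divide_iff closed_segment_eq_real_ivl split: if_splits)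
      moreover have "\<bar>t\<bar> < e" using r(2) s3 by (simp add: t_def abs_divide pos_divide_less_eq)
      then have "t \<in> {0..e}" using \<open>0 \<le> t\<close> by simp
      ultimately have "j r = w (q r)" "j s = w (q s)" using jw[of t] jw[of 0] e(1) by auto
      then show "norm (j r - j s) = norm (q r - q s)" using iso[OF w(1)] by simp
    qed (use e(1) s3 in simp)
  qed
  define d where "d = (\<lambda>s. norm (j s - z) - norm (q s - z))"
  have qn: "norm (q s - z) = norm (q r - z) + norm (q s - q r)" if "0 \<le> r" "r \<le> s" for r s
  proof -
    have "norm (q s - q r) = (s - r) * norm (z - p)" using that unfolding qdiff by (simp add: abs_if)
    moreover have "norm (q s - z) = s * norm (z - p)" "norm (q r - z) = r * norm (z - p)"
      using that by (simp_all add: q_def norm_minus_commute)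
    ultimately show ?thesis by (simp add: algebra_simps)
  qed
  have dloc: "d r = d s" if "r \<in> {0..1}" "s \<in> {0..1}" "norm (j r - j s) = norm (q r - q s)" for r s
  proof (cases "r \<le> s")
    case True
    then show ?thesis using btw[of r s] qn[of r s] that by (simp add: d_def norm_minus_commute)
  next
    case False
    then show ?thesis using btw[of s r] qn[of s r] that by (simp add: d_def norm_minus_commute)
  qed
  have "d 0 = d 1"
  proof (rule connected_local_const[where A = "{0..1}" and f = d])
    show "\<forall>s\<in>{0..1}. eventually (\<lambda>r. d s = d r) (at s within {0..1})"
    proof
      fix s :: real assume s: "s \<in> {0..1}"
      obtain e1 e2 where e: "e1 > 0" "e2 > 0"
        and n: "\<forall>r\<in>closed_segment s 1. \<bar>r - s\<bar> < e1 \<longrightarrow> norm (j r - j s) = norm (q r - q s)"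
          "\<forall>r\<in>closed_segment s 0. \<bar>r - s\<bar> < e2 \<longrightarrow> norm (j r - j s) = norm (q r - q s)"
        using seg_iso[OF s, of 1] seg_iso[OF s, of 0] by auto
      show "eventually (\<lambda>r. d s = d r) (at s within {0..1})"
        unfolding eventually_at
      proof (intro exI[of _ "min e1 e2"] conjI ballI impI)
        show "0 < min e1 e2" using e by simp
        fix r assume r: "r \<in> {0..1}" "r \<noteq> s \<and> dist r s < min e1 e2"
        then have "norm (j r - j s) = norm (q r - q s)"
          using n s by (cases "r \<ge> s") (auto simp: dist_real_def closed_segment_eq_real_ivl)
        then show "d s = d r" using dloc[OF r(1) s] by simp
      qed
    qed
  qed auto
  then have "norm (p' - z) = norm (p - z)" unfolding d_def jz jp q01 by simp
  moreover obtain l where l: "l > 0" "p' - z = l *\<^sub>R (p - z)" using ray[OF z] by blast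
  ultimately have "l * norm (p - z) = norm (p - z)" by simp
  then have "l = 1" using pU z by auto
  then show False using l(2) ne by simp
qed

text \<open>The points of \<open>P\<close> close to \<open>x\<close> are comparable with an open part of the local chamber, and belong to \<open>A'\<close>
  because of \<open>f2\<close>; so they have the same coordinates for \<open>f\<close> and \<open>f1\<close>.  The other points of \<open>P\<close> follow
  because charts of \<open>A'\<close> differ by affine maps.  This lemma is the heart of the matter: a group
  element that is only known to fix a local chamber is thereby seen to fix \<open>f ` P\<close>.\<close>

lemma agree_on_convex:
  assumes A: "A \<in> \<A>" "A' \<in> \<A>" "f \<in> Iso A" "f1 \<in> Iso A'" "f2 \<in> Iso A'"
    and C: "C \<in> chambers M" "eventually (\<lambda>v. f1 v = f v) (local_face x C)"
    and P: "convex P" "x \<in> P" "\<And>p. p \<in> P \<Longrightarrow> f2 p = f p"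
    and p: "p \<in> P"
  shows "f1 p = f p"
proof -
  obtain U where U: "open U" "U \<noteq> {}" "\<And>v. v \<in> U \<Longrightarrow> f1 v = f v" "U \<subseteq> (+) x ` C"
    using local_chamber_open_subset[OF C] by blast
  obtain c where c: "x + c \<in> U" "c \<in> C" using U(2,4) by blast
  have agree: "f1 y = f y" if y: "f2 y = f y" "c + x - y \<in> C" for y
  proof -
    let ?V = "U \<inter> (\<lambda>z. z - y) -` C"
    have "open ((\<lambda>z. z - y) -` C)"
      by (rule open_vimage[OF chamber_open[OF C(1)]]) (intro continuous_intros)
    then have "open ?V" using U(1) by blast
    moreover have "x + c \<in> ?V" using c(1) y(2) by (simp add: add.commute)
    moreover have "f y = f1 (inv f1 (f y))"
      using inv_chart(2)[OF A(2,4)] chart_mem[OF A(2,5)] y(1) by metis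
    ultimately have "inv f1 (f y) = y"
      using comparable_chamber[OF C(1)] U(3)
      by (intro same_coordinates[OF A(1,2,3,4), of ?V]) auto
    then show ?thesis using inv_chart(2)[OF A(2,4), of "f y"] chart_mem[OF A(2,5)] y(1) by metis
  qed
  obtain e where e: "e > 0" "\<And>t. 0 \<le> t \<Longrightarrow> t < e \<Longrightarrow> c + t *\<^sub>R (x - p) \<in> C"
    using small_multiple_in_open[OF chamber_open[OF C(1)] c(2), of "x - p"] by blast
  define s where "s = min e 1 / 2"
  have s: "0 < s" "s < e" "s \<le> 1" using e(1) by (auto simp: s_def)
  let ?y = "x + s *\<^sub>R (p - x)"
  have "?y = (1 - s) *\<^sub>R x + s *\<^sub>R p" by (simp add: algebra_simps)
  then have "?y \<in> P" using convexD[OF P(1,2) p, of "1 - s" s] s by simp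
  then have y: "f1 ?y = f2 ?y"
    using agree[of ?y] P(3) e(2)[of s] s by (simp add: algebra_simps)
  have x: "f1 x = f2 x" using agree[of x] P(2,3) c(2) by simp
  obtain w where w: "w \<in> Wa M" "f2 = f1 \<circ> w" using chart_change[OF A(2,4,5)] .
  have "w x = x" "w ?y = ?y" using x y chart_inj[OF A(2,4)] by (auto simp: w(2))
  then have "s *\<^sub>R (w p - x) = s *\<^sub>R (p - x)" using Wa_segment[OF w(1), of x s p] by simp
  then have "w p = p" using s(1) by simp
  then have "f2 p = f1 p" by (simp add: w(2))
  then show ?thesis using P(3)[OF p] by simp
qed

text \<open>To compare two apartments containing a local chamber, (MA2) is applied to the germ of a regular
  segment that starts at a point \<open>x + c'\<close> inside it, since \<open>f x\<close> itself might not belong to \<open>A'\<close>.  The chart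
  obtained agrees with \<open>f\<close> on an open set, whose points are comparable with those of the chamber that
  are close to \<open>x\<close>.\<close>

lemma segment_in_local_chamber:
  assumes A: "A \<in> \<A>" "A' \<in> \<A>" "f \<in> Iso A"
    and C: "C \<in> chambers M" "filtermap f (local_face x C) \<le> principal A'"
  obtains F where "ma2_situation M \<A> Iso A A' (filtermap f F)"
    "\<And>f'. f' \<in> Iso A' \<Longrightarrow> eventually (\<lambda>v. f' v = f v) (enclosure M F) \<Longrightarrow>
       eventually (\<lambda>v. f' v = f v) (local_face x C)"
proof -
  note CF = chamber_is_face[OF C(1)]
  have "eventually (\<lambda>v. f v \<in> A') (local_face x C)" using C(2) by (simp add: le_principal eventually_filtermap)
  then obtain S where S: "open S" "0 \<in> S" "\<And>u. u \<in> C \<Longrightarrow> u \<in> S \<Longrightarrow> f (x + u) \<in> A'"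
    unfolding eventually_local_face by blast
  obtain c where c: "c \<in> C" using face_nonempty[OF CF] by blast
  obtain e where e: "e > 0" "\<And>t. 0 \<le> t \<Longrightarrow> t < e \<Longrightarrow> 0 + t *\<^sub>R c \<in> S"
    using small_multiple_in_open[OF S(1,2)] by blast
  define c' where "c' = (e / 3) *\<^sub>R c"
  have c': "c' \<in> C" unfolding c'_def using face_scale[OF CF c] e(1) by simp
  have c'0: "c' \<noteq> 0"
  proof
    assume "c' = 0"
    then have C0: "0 \<in> C" using c' by simp
    obtain a where a: "\<And>i::'i. a i \<in> real_roots M" "C = {v. \<forall>i. 0 < a i v}"
      using chamber_roots[OF C(1)] by metis
    have "a i 0 = 0" for i using a(1)[of i] real_roots_km km_root_linear linear_0 by blast
    then show False using C0 a(2) by simp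
  qed
  let ?F = "germ_at (x + c') (closed_segment (x + c') (x + c' + c'))"
  show thesis
  proof (rule that[of ?F])
    have "f ` closed_segment (x + c') (x + c' + c') \<subseteq> A'"
    proof
      fix y assume "y \<in> f ` closed_segment (x + c') (x + c' + c')"
      then obtain s where s: "s \<in> {0..1}" "y = f (x + c' + s *\<^sub>R c')" by (auto simp: in_segment)
      have "x + c' + s *\<^sub>R c' = x + (1 + s) *\<^sub>R c'" by (simp add: algebra_simps)
      then have eq: "x + c' + s *\<^sub>R c' = x + ((1 + s) * (e / 3)) *\<^sub>R c" by (simp add: c'_def)
      moreover have "(1 + s) * (e / 3) > 0" using e(1) s(1) by (intro mult_pos_pos) auto
      moreover have "(1 + s) * (e / 3) \<le> 2 * (e / 3)" using e(1) s(1) by (intro mult_right_mono) auto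
      then have "(1 + s) * (e / 3) < e" using e(1) by linarith
      ultimately show "y \<in> A'"
        using S(3)[of "((1 + s) * (e / 3)) *\<^sub>R c"] face_scale[OF CF c] e(2)[of "(1 + s) * (e / 3)"]
        unfolding s(2) eq by auto
    qed
    then show "ma2_situation M \<A> Iso A A' (filtermap f ?F)"
      using c'0 comparable_chamber[OF C(1) c'] by (intro segment_ma2 A) auto
    fix f' assume f': "f' \<in> Iso A'" "eventually (\<lambda>v. f' v = f v) (enclosure M ?F)"
    then have "eventually (\<lambda>v. f' v = f v) (local_face (x + c') C)"
      using local_chamber_le_enclosure_segment[OF C(1) c', of "x + c'"] by (auto simp: le_filter_def)
    then obtain U where U: "open U" "U \<noteq> {}" "\<And>v. v \<in> U \<Longrightarrow> f' v = f v" "U \<subseteq> (+) (x + c') ` C"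
      using local_chamber_open_subset[OF C(1)] by blast
    let ?S = "S \<inter> (\<lambda>u. c' - u) -` C"
    have "open ((\<lambda>u. c' - u) -` C)"
      by (rule open_vimage[OF chamber_open[OF C(1)]]) (intro continuous_intros)
    then have "open ?S" using S(1) by blast
    moreover have "0 \<in> ?S" using S(2) c' by simp
    moreover have "f' (x + u) = f (x + u)" if u: "u \<in> C" "u \<in> ?S" for u
    proof -
      have fA: "f (x + u) \<in> A'" using S(3) u by blast
      have "comparable (z - (x + u))" if z: "z \<in> U" for z
      proof -
        obtain d where d: "d \<in> C" "z = x + c' + d" using U(4) z by blast
        have eq: "z - (x + u) = (c' - u) + d" by (simp add: d(2))
        have "c' - u \<in> C" using u(2) by simp
        from face_add[OF CF this d(1)] show ?thesis unfolding eq by (rule comparable_chamber[OF C(1)])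
      qed
      then have "inv f' (f (x + u)) = x + u"
        using inv_chart(2)[OF A(2) f'(1) fA] U(3)
        by (intro same_coordinates[OF A f'(1) U(1,2)]) auto
      then show ?thesis using inv_chart(2)[OF A(2) f'(1) fA] by simp
    qed
    ultimately show "eventually (\<lambda>v. f' v = f v) (local_face x C)"
      unfolding eventually_local_face by blast
  qed
qed

lemma local_chamber_chart:
  assumes "A \<in> \<A>" "A' \<in> \<A>" "f \<in> Iso A" "C \<in> chambers M" "filtermap f (local_face x C) \<le> principal A'"
  obtains f' where "f' \<in> Iso A'" "eventually (\<lambda>v. f' v = f v) (local_face x C)"
  using segment_in_local_chamber[OF assms] MA2_chart[OF _ assms(3)] by metis

lemma minimal_closed_face_le:
  assumes "A \<in> \<A>" "A' \<in> \<A>" "f \<in> Iso A" "f y \<in> A'"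
  shows "filtermap f (enclosure M (local_face y (Fv M UNIV))) \<le> principal A'"
proof -
  obtain f' where f': "f' \<in> Iso A'" "eventually (\<lambda>v. f' v = f v) (enclosure M (principal {y}))"
    using MA2_point[OF assms] .
  then have "eventually (\<lambda>v. f v \<in> A') (enclosure M (principal {y}))"
    by (elim eventually_mono) (metis chart_mem[OF assms(2) f'(1)])
  from filter_leD[OF enclosure_minimal_face this] show ?thesis
    by (simp add: le_principal eventually_filtermap)
qed

text \<open>(MA4) is applied to the sector germ and to the closed face at \<open>y\<close>; the enclosure of their union
  contains the sector with base point \<open>y\<close>.\<close>

lemma sector_chart:
  assumes A: "A \<in> \<A>" "A' \<in> \<A>" "f \<in> Iso A" and C: "C \<in> chambers M"
    and R: "filtermap f (sector_face_germ x C) \<le> principal A'" and y: "f y \<in> A'"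
  obtains f' where "f' \<in> Iso A'" "\<And>d. (\<And>c. c \<in> C \<Longrightarrow> d + c \<in> C) \<Longrightarrow> f' (y + d) = f (y + d)"
proof -
  note CF = chamber_is_face[OF C]
  let ?R = "sector_face_germ x C" and ?K = "enclosure M (local_face y (Fv M UNIV))"
  have "ma4_situation M \<A> Iso A A' (filtermap f ?R) (filtermap f ?K)"
    unfolding ma4_situation_def
  proof (intro conjI)
    show "ma3_situation M \<A> Iso (filtermap f ?R) (filtermap f ?K)"
      using splayed_in_chart[OF A(1,3) CF chamber_spherical[OF C]] closed_face_in_chart[OF A(1,3) minimal_face]
      unfolding sector_germ_eq_chimney_germ[OF C] by (intro ma3_situationI[of A _ A] A(1)) auto
  qed (use A R minimal_closed_face_le[OF A y] chart_le in auto)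
  then obtain f' where f': "f' \<in> Iso A'" "eventually (\<lambda>v. f' v = f v) (enclosure M (sup ?R ?K))"
    using MA4_chart[OF _ A(3)] by blast
  obtain P where P: "P \<in> enclosed_sets M" "eventually (\<lambda>v. v \<in> P) ?R" "eventually (\<lambda>v. v \<in> P) ?K"
    "\<forall>v\<in>P. f' v = f v"
    using f'(2) by (auto simp: eventually_enclosure_iff[of _ "sup _ _"] eventually_sup)
  have "eventually (\<lambda>v. v \<in> P) (local_face y (Fv M UNIV))"
    using P(3) enclosure_extensive by (auto simp: le_filter_def)
  then have yP: "y \<in> P" by (rule local_face_base[OF enclosed_closed_convex(1)[OF P(1)] minimal_face])
  obtain \<xi> where \<xi>: "\<And>c. c \<in> C \<Longrightarrow> x + \<xi> + c \<in> P" using P(2) by (auto simp: eventually_sector_germ_iff[OF C])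
  show thesis
  proof (rule that[OF f'(1)])
    fix d assume d: "\<And>c. c \<in> C \<Longrightarrow> d + c \<in> C"
    have "y + d \<in> P"
      by (rule recession[OF enclosed_closed_convex[OF P(1)] C \<xi> yP d])
    then show "f' (y + d) = f (y + d)" using P(4) by blast
  qed
qed

end

section \<open>Friendliness in terms of charts\<close>

locale masure_group = masure_data M \<Delta> \<A> Iso
  for M :: "('i::finite, 'v::euclidean_space, 'g::real_vector) apartment_data"
    and \<Delta> :: "'d set" and \<A> :: "'d set set" and Iso :: "'d set \<Rightarrow> ('v \<Rightarrow> 'd) set" +
  fixes G :: "('d \<Rightarrow> 'd) set"
  assumes group: "automorphism_group M \<Delta> \<A> Iso G"
begin

lemma G_inv: "g \<in> G \<Longrightarrow> inv g \<in> G" and G_comp: "g \<in> G \<Longrightarrow> h \<in> G \<Longrightarrow> g \<circ> h \<in> G"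
  using group by (auto simp: automorphism_group_def)

lemma G_bij: "g \<in> G \<Longrightarrow> bij g"
  using group permutes_bij by (fastforce simp: automorphism_group_def masure_automorphisms_def)

text \<open>As charts are determined by their restriction to an open set, this is the strongest transitivity
  property that an agreement of charts on an open set can suggest.\<close>

definition transitive_on_charts :: bool where
  "transitive_on_charts \<longleftrightarrow> (\<forall>A\<in>\<A>. \<forall>A'\<in>\<A>. \<forall>f\<in>Iso A. \<forall>f'\<in>Iso A'. \<forall>U.
     open U \<longrightarrow> U \<noteq> {} \<longrightarrow> (\<forall>v\<in>U. f v = f' v) \<longrightarrow> (\<exists>g\<in>G. g \<circ> f = f'))"

lemma transitive_on_chartsD:
  assumes "transitive_on_charts" "A \<in> \<A>" "A' \<in> \<A>" "f \<in> Iso A" "f' \<in> Iso A'"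
    "open U" "U \<noteq> {}" "\<And>v. v \<in> U \<Longrightarrow> f v = f' v"
  obtains g where "g \<in> G" "g \<circ> f = f'"
  using assms(1)[unfolded transitive_on_charts_def, rule_format, OF assms(2-8)] that by blast

lemma transitive_local_chamber:
  assumes T: "transitive_on_charts" "A \<in> \<A>" "A' \<in> \<A>" "f \<in> Iso A" "f' \<in> Iso A'"
    and C: "C \<in> chambers M" "eventually (\<lambda>v. f' v = f v) (local_face x C)"
  obtains g where "g \<in> G" "g \<circ> f = f'"
proof -
  obtain U where U: "open U" "U \<noteq> {}" "\<And>v. v \<in> U \<Longrightarrow> f' v = f v"
    using local_chamber_open_subset[OF C] by metis
  show thesis using transitive_on_chartsD[OF T U(1,2) U(3)[symmetric]] that by blast
qed

lemma transitive_chimney_germ: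
  assumes T: "transitive_on_charts" "A \<in> \<A>" "A' \<in> \<A>" "f \<in> Iso A" "f' \<in> Iso A'"
    and C: "C \<in> chambers M" "D \<in> faces M" "eventually (\<lambda>v. f' v = f v) (chimney_germ M (local_face x C) D)"
  obtains g where "g \<in> G" "g \<circ> f = f'"
proof -
  obtain U where U: "open U" "U \<noteq> {}" "\<And>v. v \<in> U \<Longrightarrow> f' v = f v"
    using chimney_germ_open_subset[OF C] by metis
  show thesis using transitive_on_chartsD[OF T U(1,2) U(3)[symmetric]] that by blast
qed

lemma friendly_chart:
  assumes "friendly M \<A> Iso G \<Omega>" "A \<in> \<A>" "A' \<in> \<A>" "\<Omega> \<le> principal A" "\<Omega> \<le> principal A'" "f \<in> Iso A"
  obtains g where "g \<in> G" "g \<circ> f \<in> Iso A'" "eventually (\<lambda>x. g x = x) \<Omega>"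
proof -
  obtain g where "g \<in> G" "\<forall>\<^sub>F x in \<Omega>. g x = x" "weyl_isomorphism M Iso A A' g"
    using assms unfolding friendly_def by blast
  then show thesis using that weyl_isomorphism_iff[OF assms(2,3,6)] by blast
qed

text \<open>Two apartments containing the filter are compared through the one in which it is given.\<close>

lemma friendlyI:
  assumes A: "A \<in> \<A>" "f \<in> Iso A"
    and ex: "\<And>A'. A' \<in> \<A> \<Longrightarrow> filtermap f F \<le> principal A' \<Longrightarrow>
      \<exists>g\<in>G. g \<circ> f \<in> Iso A' \<and> eventually (\<lambda>v. g (f v) = f v) F"
  shows "friendly M \<A> Iso G (filtermap f F)"
  unfolding friendly_def
proof (intro ballI impI)
  fix B B' assume B: "B \<in> \<A>" "B' \<in> \<A>" "filtermap f F \<le> principal B" "filtermap f F \<le> principal B'"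
  obtain g where g: "g \<in> G" "g \<circ> f \<in> Iso B" "eventually (\<lambda>v. g (f v) = f v) F"
    using ex[OF B(1,3)] by blast
  obtain h where h: "h \<in> G" "h \<circ> f \<in> Iso B'" "eventually (\<lambda>v. h (f v) = f v) F"
    using ex[OF B(2,4)] by blast
  have ig: "inv g (g x) = x" for x using G_bij[OF g(1)] by (simp add: bij_is_inj)
  have eq: "h \<circ> inv g \<circ> (g \<circ> f) = h \<circ> f" by (auto simp: ig)
  show "\<exists>g\<in>G. (\<forall>\<^sub>F x in filtermap f F. g x = x) \<and> B' = g ` B \<and> weyl_isomorphism M Iso B B' g"
  proof (intro bexI[of _ "h \<circ> inv g"] conjI)
    show "h \<circ> inv g \<in> G" by (intro G_comp h G_inv g)
    have "eventually (\<lambda>v. (h \<circ> inv g) (f v) = f v) F"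
      using g(3) h(3) by eventually_elim (metis comp_apply ig)
    then show "\<forall>\<^sub>F x in filtermap f F. (h \<circ> inv g) x = x" by (simp add: eventually_filtermap)
    show w: "weyl_isomorphism M Iso B B' (h \<circ> inv g)"
      unfolding weyl_isomorphism_iff[OF B(1,2) g(2)] eq by (rule h(2))
    then show "B' = (h \<circ> inv g) ` B" by (simp add: apartment_map_def bij_betw_def)
  qed
qed

text \<open>A point of \<open>x - C\<close> is comparable with all points of \<open>x + C\<close>.\<close>

lemma same_coordinates_opposite:
  assumes A: "A \<in> \<A>" "A' \<in> \<A>" "f \<in> Iso A" "f' \<in> Iso A'" and C: "C \<in> chambers M"
    and U: "open U" "x \<in> U" "\<And>c. c \<in> C \<Longrightarrow> x + c \<in> U \<Longrightarrow> f (x + c) = f' (x + c)"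
    and d: "\<And>c. c \<in> C \<Longrightarrow> d + c \<in> C" and p: "f (x - d) \<in> A'"
  shows "f' (x - d) = f (x - d)"
proof -
  let ?U = "U \<inter> (\<lambda>v. v - x) -` C"
  have "open ((\<lambda>v. v - x) -` C)" by (rule open_vimage[OF chamber_open[OF C]]) (intro continuous_intros)
  then have "open ?U" using U(1) by blast
  moreover have "?U \<noteq> {}"
  proof -
    obtain c where c: "c \<in> C" using face_nonempty[OF chamber_is_face[OF C]] by blast
    obtain e where e: "e > 0" "\<And>t. 0 \<le> t \<Longrightarrow> t < e \<Longrightarrow> x + t *\<^sub>R c \<in> U"
      using small_multiple_in_open[OF U(1,2)] by blast
    then have "x + (e / 2) *\<^sub>R c \<in> ?U" using face_scale[OF chamber_is_face[OF C] c, of "e / 2"] by simp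
    then show ?thesis by blast
  qed
  moreover have "f z = f' z" if "z \<in> ?U" for z using U(3)[of "z - x"] that by simp
  moreover have "comparable (z - (x - d))" if "z \<in> ?U" for z
  proof -
    have "d + (z - x) \<in> C" using d that by simp
    moreover have "d + (z - x) = z - (x - d)" by simp
    ultimately show ?thesis using comparable_chamber[OF C] by metis
  qed
  moreover have "f (x - d) = f' (inv f' (f (x - d)))" using inv_chart(2)[OF A(2,4) p] by simp
  ultimately have "inv f' (f (x - d)) = x - d" using same_coordinates[OF A, of ?U] by blast
  then show ?thesis using inv_chart(2)[OF A(2,4) p] by simp
qed

lemma chambers_nonempty: "\<exists>C. C \<in> chambers M"
  by (rule face_below_chamber[OF minimal_face]) (rule exI)

text \<open>The supremum of the \<open>r \<le> t\<close> with \<open>{0..r} \<subseteq> S\<close> is \<open>t\<close>.\<close>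

lemma real_induction:
  fixes S :: "real set"
  assumes "0 \<in> S"
    and right: "\<And>t. 0 \<le> t \<Longrightarrow> t \<in> S \<Longrightarrow> \<exists>e>0. \<forall>s. 0 \<le> s \<and> s < e \<longrightarrow> t + s \<in> S"
    and left: "\<And>t. 0 < t \<Longrightarrow> (\<And>s. 0 \<le> s \<Longrightarrow> s < t \<Longrightarrow> s \<in> S) \<Longrightarrow> t \<in> S"
    and "0 \<le> t"
  shows "t \<in> S"
proof -
  define X where "X = {r\<in>{0..t}. {0..r} \<subseteq> S}"
  have X: "0 \<in> X" "bdd_above X" using assms(1,4) by (auto simp: X_def intro!: bdd_aboveI[of _ t])
  define c where "c = Sup X"
  have c0: "0 \<le> c" "c \<le> t"
    unfolding c_def using X cSup_upper[OF X(1,2)] by (auto intro!: cSup_least simp: X_def)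
  have below: "s \<in> S" if s: "0 \<le> s" "s < c" for s
  proof -
    obtain r where "r \<in> X" "s < r" using s less_cSup_iff[OF _ X(2)] X(1) unfolding c_def by blast
    then show ?thesis using s(1) by (auto simp: X_def)
  qed
  have cS: "c \<in> S" using left[of c] below assms(1) c0(1) by (cases "c = 0") auto
  show ?thesis
  proof (cases "c = t")
    case False
    obtain e where e: "e > 0" "\<And>s. 0 \<le> s \<Longrightarrow> s < e \<Longrightarrow> c + s \<in> S" using right[OF c0(1) cS] by blast
    define r where "r = min t (c + e / 2)"
    have r: "c < r" "r \<le> t" "r \<le> c + e / 2" using False c0 e(1) by (auto simp: r_def)
    have "s \<in> S" if "0 \<le> s" "s \<le> r" for s
    proof (cases "s < c")
      case False
      then show ?thesis using e(2)[of "s - c"] that r e(1) by auto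
    qed (use below that in blast)
    then have "r \<in> X" using r c0 by (auto simp: X_def)
    then show ?thesis using cSup_upper[OF _ X(2)] r(1) unfolding c_def by force
  qed (use cS in simp)
qed

section \<open>Friendly local chambers and friendly sector germs\<close>

lemma transitive_if_local_chambers_friendly:
  assumes fr: "\<forall>A\<in>\<A>. \<forall>C\<in>filters_in Iso A (local_chambers M). friendly M \<A> Iso G C"
  shows "transitive_on_charts"
  unfolding transitive_on_charts_def
proof (intro ballI allI impI)
  fix A A' f f' U
  assume A: "A \<in> \<A>" "A' \<in> \<A>" "f \<in> Iso A" "f' \<in> Iso A'"
    and U: "open U" "U \<noteq> {}" "\<forall>v\<in>U. f v = f' v"
  obtain x where x: "x \<in> U" using U(2) by blast
  obtain C where C: "C \<in> chambers M" using chambers_nonempty by blast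
  have "eventually (\<lambda>v. v \<in> U) (local_face x C)"
    unfolding local_face_def germ_at_def eventually_inf_principal
    using eventually_nhds_in_open[OF U(1) x] by (rule eventually_mono) simp
  then have ev: "eventually (\<lambda>v. f v = f' v) (local_face x C)" using U(3) by (auto elim: eventually_mono)
  then have "eventually (\<lambda>v. f v \<in> A') (local_face x C)"
    by eventually_elim (metis chart_mem[OF A(2,4)])
  then have le: "filtermap f (local_face x C) \<le> principal A'" by (simp add: le_principal eventually_filtermap)
  have "friendly M \<A> Iso G (filtermap f (local_face x C))"
    using fr A(1) local_chamber_in_chart[OF A(1,3) C] by blast
  then obtain g where g: "g \<in> G" "g \<circ> f \<in> Iso A'" "eventually (\<lambda>x. g x = x) (filtermap f (local_face x C))"
    using friendly_chart[OF _ A(1,2) chart_le[OF A(1,3)] le A(3)] by blast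
  have "eventually (\<lambda>v. (g \<circ> f) v = f' v) (local_face x C)"
    using g(3) ev unfolding eventually_filtermap by eventually_elim simp
  from local_chamber_open_subset[OF C this]
  obtain V where "open V" "V \<noteq> {}" "\<And>v. v \<in> V \<Longrightarrow> (g \<circ> f) v = f' v" by metis
  then have "g \<circ> f = f'" by (rule chart_eq_on_open[OF A(2) g(2) A(4)])
  then show "\<exists>g\<in>G. g \<circ> f = f'" using g(1) by blast
qed

text \<open>Let \<open>f\<close>, \<open>f'\<close> be charts of \<open>A\<close>, \<open>A'\<close> that agree near \<open>x\<close>.  By (MA3) some apartment \<open>B\<close> contains the germs of
  the sector \<open>f (x + C)\<close> and of the opposite sector \<open>f' (x - C)\<close>.  It suffices that \<open>B\<close> has a chart agreeing
  with \<open>f\<close> on \<open>x + C\<close>: by the comparability of opposite sectors this chart agrees with \<open>f'\<close> on the germ of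
  \<open>x - C\<close>, so friendliness of the two germs moves \<open>A\<close> to \<open>B\<close> and \<open>B\<close> to \<open>A'\<close> in the required manner.  Such a
  chart exists if there is one for some apartment that contains a point \<open>f' (x - t \<eta>)\<close>, \<open>\<eta> \<in> C\<close>, of \<open>B\<close>,
  because the sectors of direction \<open>C\<close> based at this point are the same in both apartments.  Finally
  the set of the \<open>t\<close> for which \<open>f' (x - t \<eta>)\<close> lies in an apartment having such a chart is seen to be the
  whole half-line, by applying (MA3) to the germ of \<open>f (x + C)\<close> and closed chambers of \<open>A'\<close>.\<close>

lemma transitive_if_sector_germs_friendly:
  assumes fr: "\<forall>A\<in>\<A>. \<forall>S\<in>filters_in Iso A (sector_germs M). friendly M \<A> Iso G S"
  shows "transitive_on_charts"
  unfolding transitive_on_charts_def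
proof (intro ballI allI impI)
  fix A A' f f' U
  assume A: "A \<in> \<A>" "A' \<in> \<A>" "f \<in> Iso A" "f' \<in> Iso A'"
    and U: "open U" "U \<noteq> {}" "\<forall>v\<in>U. f v = f' v"
  obtain x where x: "x \<in> U" using U(2) by blast
  obtain C where C: "C \<in> chambers M" using chambers_nonempty by blast
  note CF = chamber_is_face[OF C]
  define C' where "C' = uminus ` C"
  have C': "C' \<in> chambers M" unfolding C'_def by (rule chamber_uminus[OF C])
  have C'_iff: "v \<in> C' \<longleftrightarrow> - v \<in> C" for v unfolding C'_def by force
  obtain \<eta> where \<eta>: "\<eta> \<in> C" using face_nonempty[OF CF] by blast
  let ?R = "filtermap f (sector_face_germ x C)" and ?R' = "filtermap f' (sector_face_germ x C')"
  have R: "?R \<in> filters_in Iso A (splayed_chimney_germs M)"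
    unfolding sector_germ_eq_chimney_germ[OF C]
    by (rule splayed_in_chart[OF A(1,3) CF chamber_spherical[OF C]])
  have R': "?R' \<in> filters_in Iso A' (solid_chimney_germs M)"
    unfolding sector_germ_eq_chimney_germ[OF C']
    by (rule solid_germ_in_chart[OF A(2,4) C' chamber_is_face[OF C']])
  \<comment> \<open>The condition \<open>d + C \<subseteq> C\<close> admits both \<open>d = 0\<close> and \<open>d \<in> C\<close>.\<close>
  define ext where "ext = (\<lambda>B b. B \<in> \<A> \<and> b \<in> Iso B \<and> (\<forall>d. (\<forall>c\<in>C. d + c \<in> C) \<longrightarrow> b (x + d) = f (x + d)))"
  have ext_C: "b (x + c) = f (x + c)" if "ext B b" "c \<in> C" for B b c
    using that face_add[OF CF] unfolding ext_def by blast
  have t\<eta>: "t *\<^sub>R \<eta> + c \<in> C" if "0 \<le> t" "c \<in> C" for t c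
    using face_add[OF CF face_scale[OF CF \<eta>] that(2)] that by (cases "t = 0") auto
  have opp: "b (x - d) = f' (x - d)"
    if "ext B b" "\<And>c. c \<in> C \<Longrightarrow> d + c \<in> C" "f' (x - d) \<in> B" for B b d
  proof (rule same_coordinates_opposite[OF A(2) _ A(4) _ C U(1) x _ that(2,3)])
    show "B \<in> \<A>" "b \<in> Iso B" using that(1) by (auto simp: ext_def)
    show "f' (x + c) = b (x + c)" if "c \<in> C" "x + c \<in> U" for c
      using U(3) that ext_C[OF \<open>ext B b\<close>] by metis
  qed
  have extend: "\<exists>b'. ext B' b'"
    if b: "ext B b" "f' (x - t *\<^sub>R \<eta>) \<in> B" and B': "B' \<in> \<A>" "?R \<le> principal B'" "f' (x - t *\<^sub>R \<eta>) \<in> B'"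
      and t: "0 \<le> t" for B b B' t
  proof -
    have B: "B \<in> \<A>" "b \<in> Iso B" using b(1) by (auto simp: ext_def)
    have base: "b (x - t *\<^sub>R \<eta>) = f' (x - t *\<^sub>R \<eta>)" by (rule opp[OF b(1) t\<eta>[OF t] b(2)])
    have "eventually (\<lambda>v. b v = f v) (sector_face_germ x C)"
      unfolding eventually_sector_germ_iff[OF C]
      using ext_C[OF b(1) face_add[OF CF]] \<eta> by (auto simp: add.assoc)
    then have "filtermap b (sector_face_germ x C) = ?R" by (rule filtermap_agree)
    then have le: "filtermap b (sector_face_germ x C) \<le> principal B'" using B'(2) by simp
    have yB: "b (x - t *\<^sub>R \<eta>) \<in> B'" using base B'(3) by simp
    obtain b' where b': "b' \<in> Iso B'"
      "\<And>d. (\<And>c. c \<in> C \<Longrightarrow> d + c \<in> C) \<Longrightarrow> b' (x - t *\<^sub>R \<eta> + d) = b (x - t *\<^sub>R \<eta> + d)"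
      using sector_chart[OF B(1) B'(1) B(2) C le yB] by blast
    have "b' (x + d) = f (x + d)" if d: "\<forall>c\<in>C. d + c \<in> C" for d
    proof -
      have "t *\<^sub>R \<eta> + d + c \<in> C" if "c \<in> C" for c using t\<eta>[OF t] d that by (simp add: add.assoc)
      then have "b' (x + d) = b (x + d)" using b'(2)[of "t *\<^sub>R \<eta> + d"] by simp
      then show ?thesis using b(1) d by (simp add: ext_def)
    qed
    then show ?thesis using b'(1) B'(1) unfolding ext_def by blast
  qed
  \<comment> \<open>By (MA3), an apartment containing the sector germ and the beginning of a segment of \<open>A'\<close>.\<close>
  have start: "\<exists>B\<in>\<A>. ?R \<le> principal B \<and> f' y \<in> B \<and> (\<exists>e>0. \<forall>s. 0 \<le> s \<and> s < e \<longrightarrow> f' (y + s *\<^sub>R v) \<in> B)"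
    if E: "E \<in> chambers M" "v \<in> E" for y E v
  proof -
    note EF = chamber_is_face[OF E(1)]
    let ?F = "filtermap f' (enclosure M (local_face y E))"
    have "ma3_situation M \<A> Iso ?R ?F"
      by (rule ma3_situationI[OF A(1) R A(2)]) (use closed_face_in_chart[OF A(2,4) EF] in blast)
    then obtain B where B: "B \<in> \<A>" "?R \<le> principal B" "?F \<le> principal B" by (rule MA3)
    then obtain P where P: "P \<in> enclosed_sets M" "eventually (\<lambda>v. v \<in> P) (local_face y E)" "\<forall>v\<in>P. f' v \<in> B"
      by (auto simp: le_principal eventually_filtermap eventually_enclosure_iff)
    have yP: "y \<in> P" by (rule local_face_base[OF enclosed_closed_convex(1)[OF P(1)] EF P(2)])
    obtain S where S: "open S" "0 \<in> S" "\<And>u. u \<in> E \<Longrightarrow> u \<in> S \<Longrightarrow> y + u \<in> P"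
      using P(2) unfolding eventually_local_face by blast
    obtain e where e: "e > 0" "\<And>t. 0 \<le> t \<Longrightarrow> t < e \<Longrightarrow> 0 + t *\<^sub>R v \<in> S"
      using small_multiple_in_open[OF S(1,2)] by blast
    have "f' (y + s *\<^sub>R v) \<in> B" if "0 \<le> s" "s < e" for s
    proof (cases "s = 0")
      case False
      then show ?thesis using S(3)[OF face_scale[OF EF E(2)], of s] e(2)[of s] P(3) that by auto
    qed (use yP P(3) in auto)
    then show ?thesis using B(1,2) yP P(3) e(1) by blast
  qed
  define S where "S = {t. \<exists>B b. ext B b \<and> f' (x - t *\<^sub>R \<eta>) \<in> B}"
  have reach: "t \<in> S" if t: "0 \<le> t" for t
  proof (rule real_induction[of S])
    have "ext A f" using A by (simp add: ext_def)
    moreover have "f' x \<in> A" using U(3) x chart_mem[OF A(1,3)] by metis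
    ultimately show "0 \<in> S" unfolding S_def by auto
  next
    fix t :: real assume t: "0 \<le> t" "t \<in> S"
    then obtain B b where b: "ext B b" "f' (x - t *\<^sub>R \<eta>) \<in> B" unfolding S_def by blast
    have "- \<eta> \<in> C'" using \<eta> by (simp add: C'_iff)
    then obtain B' e where B': "B' \<in> \<A>" "?R \<le> principal B'" "f' (x - t *\<^sub>R \<eta>) \<in> B'" "e > 0"
      "\<And>s. 0 \<le> s \<Longrightarrow> s < e \<Longrightarrow> f' (x - t *\<^sub>R \<eta> + s *\<^sub>R (- \<eta>)) \<in> B'"
      using start[OF C', of "- \<eta>" "x - t *\<^sub>R \<eta>"] by blast
    obtain b' where "ext B' b'" using extend[OF b B'(1-3) t(1)] by blast
    moreover have "f' (x - (t + s) *\<^sub>R \<eta>) \<in> B'" if "0 \<le> s" "s < e" for s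
    proof -
      have "x - t *\<^sub>R \<eta> + s *\<^sub>R (- \<eta>) = x - (t + s) *\<^sub>R \<eta>" by (simp add: algebra_simps)
      with B'(5)[OF that] show ?thesis by (simp only:)
    qed
    ultimately show "\<exists>e>0. \<forall>s. 0 \<le> s \<and> s < e \<longrightarrow> t + s \<in> S"
      unfolding S_def using B'(4) by (intro exI[of _ e]) blast
  next
    fix t :: real assume t: "0 < t" "\<And>s. 0 \<le> s \<Longrightarrow> s < t \<Longrightarrow> s \<in> S"
    obtain B' e where B': "B' \<in> \<A>" "?R \<le> principal B'" "f' (x - t *\<^sub>R \<eta>) \<in> B'" "e > 0"
      "\<And>s. 0 \<le> s \<Longrightarrow> s < e \<Longrightarrow> f' (x - t *\<^sub>R \<eta> + s *\<^sub>R \<eta>) \<in> B'"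
      using start[OF C \<eta>, of "x - t *\<^sub>R \<eta>"] by blast
    define s where "s = min t e / 2"
    have s: "0 < s" "s < t" "s < e" using t(1) B'(4) by (auto simp: s_def)
    obtain B b where b: "ext B b" "f' (x - (t - s) *\<^sub>R \<eta>) \<in> B" using t(2)[of "t - s"] s unfolding S_def by auto
    have "x - t *\<^sub>R \<eta> + s *\<^sub>R \<eta> = x - (t - s) *\<^sub>R \<eta>" by (simp add: algebra_simps)
    with B'(5)[of s] have "f' (x - (t - s) *\<^sub>R \<eta>) \<in> B'" using s by (simp only: less_imp_le)
    then obtain b' where "ext B' b'" using extend[OF b B'(1,2)] s by auto
    then show "t \<in> S" unfolding S_def using B'(3) by blast
  qed (rule t)
  have "ma3_situation M \<A> Iso ?R ?R'"
    by (rule ma3_situationI[OF A(1) R A(2)]) (use R' in blast)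
  then obtain B where B: "B \<in> \<A>" "?R \<le> principal B" "?R' \<le> principal B" by (rule MA3)
  then obtain \<xi> where \<xi>: "\<xi> \<in> C'" "\<And>c. c \<in> C' \<Longrightarrow> f' (x + \<xi> + c) \<in> B"
    by (auto simp: le_principal eventually_filtermap eventually_sector_germ_iff[OF C'])
  obtain e where e: "e > 0" "\<And>t. 0 \<le> t \<Longrightarrow> t < e \<Longrightarrow> \<eta> + t *\<^sub>R \<xi> \<in> C"
    using small_multiple_in_open[OF chamber_open[OF C] \<eta>] by blast
  \<comment> \<open>The ray \<open>x - t \<eta>\<close> enters every shortening of the sector \<open>x - C\<close>; here is a value of \<open>t\<close> for which
    \<open>t \<eta> + \<xi> \<in> C\<close>.\<close>
  define t where "t = 2 / e"
  have t: "0 < t" "1 / t < e" using e(1) by (auto simp: t_def)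
  have "t *\<^sub>R (\<eta> + (1 / t) *\<^sub>R \<xi>) \<in> C" using face_scale[OF CF e(2)[of "1 / t"]] t by simp
  then have "t *\<^sub>R \<eta> + \<xi> \<in> C" using t(1) by (simp add: scaleR_add_right)
  then have "- (t *\<^sub>R \<eta> + \<xi>) \<in> C'" by (simp only: C'_iff minus_minus)
  from \<xi>(2)[OF this] have tB: "f' (x - t *\<^sub>R \<eta>) \<in> B" by (simp add: algebra_simps)
  have "t \<in> S" using reach t(1) by simp
  then obtain B0 b0 where "ext B0 b0" "f' (x - t *\<^sub>R \<eta>) \<in> B0" unfolding S_def by blast
  then obtain b where b: "ext B b" using extend[OF _ _ B(1,2) tB] t(1) by auto
  have bB: "b \<in> Iso B" using b by (simp add: ext_def)
  have "friendly M \<A> Iso G ?R" using fr A(1) sector_germ_in_chart[OF A(1,3) C] by blast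
  then obtain g where g: "g \<in> G" "g \<circ> f \<in> Iso B" "eventually (\<lambda>x. g x = x) ?R"
    using friendly_chart[OF _ A(1) B(1) chart_le[OF A(1,3)] B(2) A(3)] by blast
  have "eventually (\<lambda>v. (g \<circ> f) v = b v) (sector_face_germ x C)"
  proof -
    have "eventually (\<lambda>v. b v = f v) (sector_face_germ x C)"
      unfolding eventually_sector_germ_iff[OF C]
      using ext_C[OF b face_add[OF CF]] \<eta> by (auto simp: add.assoc)
    with g(3) show ?thesis unfolding eventually_filtermap by eventually_elim simp
  qed
  from chimney_germ_open_subset[OF C CF this[unfolded sector_germ_eq_chimney_germ[OF C]]]
  obtain V where "open V" "V \<noteq> {}" "\<And>v. v \<in> V \<Longrightarrow> (g \<circ> f) v = b v" by metis
  then have gf: "g \<circ> f = b" by (rule chart_eq_on_open[OF B(1) g(2) bB])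
  have "friendly M \<A> Iso G ?R'" using fr A(2) sector_germ_in_chart[OF A(2,4) C'] by blast
  then obtain h where h: "h \<in> G" "h \<circ> b \<in> Iso A'" "eventually (\<lambda>x. h x = x) ?R'"
    using friendly_chart[OF _ B(1) A(2) B(3) chart_le[OF A(2,4)] bB] by blast
  have "eventually (\<lambda>v. (h \<circ> b) v = f' v) (sector_face_germ x C')"
  proof -
    have "b (x + \<xi> + c) = f' (x + \<xi> + c)" if c: "c \<in> C'" for c
    proof -
      have d: "- (\<xi> + c) \<in> C"
        using face_add[OF chamber_is_face[OF C'] \<xi>(1) c] by (simp only: C'_iff)
      have "f' (x - - (\<xi> + c)) \<in> B" using \<xi>(2)[OF c] by (simp only: diff_minus_eq_add add.assoc)
      from opp[OF b face_add[OF CF d] this] show ?thesis by (simp only: diff_minus_eq_add add.assoc)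
    qed
    then have "eventually (\<lambda>v. b v = f' v) (sector_face_germ x C')"
      unfolding eventually_sector_germ_iff[OF C'] using \<xi>(1) by blast
    with h(3) show ?thesis unfolding eventually_filtermap by eventually_elim simp
  qed
  from chimney_germ_open_subset[OF C' chamber_is_face[OF C'] this[unfolded sector_germ_eq_chimney_germ[OF C']]]
  obtain V where "open V" "V \<noteq> {}" "\<And>v. v \<in> V \<Longrightarrow> (h \<circ> b) v = f' v" by metis
  then have "h \<circ> b = f'" by (rule chart_eq_on_open[OF A(2) h(2) A(4)])
  then have "(h \<circ> g) \<circ> f = f'" using gf by (simp add: comp_assoc)
  then show "\<exists>g\<in>G. g \<circ> f = f'" using G_comp[OF h(1) g(1)] by blast
qed

section \<open>Strong transitivity implies friendliness\<close>

lemma local_chambers_friendly: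
  assumes st: "strongly_transitive M \<A> Iso G" and A: "A \<in> \<A>" and F: "F \<in> filters_in Iso A (local_chambers M)"
  shows "friendly M \<A> Iso G F"
proof -
  let ?f = "chart Iso A"
  note f = chart_in[OF A]
  obtain x C where C: "C \<in> chambers M" "F = filtermap ?f (local_face x C)"
    using F unfolding filters_in_def local_chambers_def by blast
  show ?thesis unfolding C(2)
  proof (rule friendlyI[OF A f])
    fix A' assume A': "A' \<in> \<A>" "filtermap ?f (local_face x C) \<le> principal A'"
    obtain K where K: "ma2_situation M \<A> Iso A A' (filtermap ?f K)"
      "\<And>f'. f' \<in> Iso A' \<Longrightarrow> eventually (\<lambda>v. f' v = ?f v) (enclosure M K) \<Longrightarrow>
         eventually (\<lambda>v. f' v = ?f v) (local_face x C)"
      using segment_in_local_chamber[OF A A'(1) f C(1) A'(2)] by blast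
    obtain g where g: "g \<in> G" "weyl_isomorphism M Iso A A' g"
      "\<forall>\<^sub>F x in enclosure_in M Iso A (filtermap ?f K). g x = x"
      using st[unfolded strongly_transitive_def, THEN conjunct1, rule_format, OF K(1)] by blast
    have gf: "g \<circ> ?f \<in> Iso A'" using g(2) weyl_isomorphism_iff[OF A A'(1) f] by blast
    have "eventually (\<lambda>v. (g \<circ> ?f) v = ?f v) (enclosure M K)"
      using g(3) by (simp add: enclosure_in_chart[OF A f] eventually_filtermap)
    from K(2)[OF gf this] gf g(1)
    show "\<exists>g\<in>G. g \<circ> ?f \<in> Iso A' \<and> eventually (\<lambda>v. g (?f v) = ?f v) (local_face x C)" by auto
  qed
qed

text \<open>A sector germ is the germ of a chimney that is both splayed and solid, so it can take both places
  in (MA4).\<close>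

lemma sector_germs_friendly:
  assumes st: "strongly_transitive M \<A> Iso G" and A: "A \<in> \<A>" and F: "F \<in> filters_in Iso A (sector_germs M)"
  shows "friendly M \<A> Iso G F"
proof -
  let ?f = "chart Iso A"
  note f = chart_in[OF A]
  obtain x C where C: "C \<in> chambers M" "F = filtermap ?f (sector_face_germ x C)"
    using F unfolding filters_in_def sector_germs_def by blast
  let ?R = "sector_face_germ x C"
  note CF = chamber_is_face[OF C(1)]
  show ?thesis unfolding C(2)
  proof (rule friendlyI[OF A f])
    fix A' assume A': "A' \<in> \<A>" "filtermap ?f ?R \<le> principal A'"
    have "ma3_situation M \<A> Iso (filtermap ?f ?R) (filtermap ?f ?R)"
      using splayed_in_chart[OF A f CF chamber_spherical[OF C(1)]] solid_germ_in_chart[OF A f C(1) CF]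
      unfolding sector_germ_eq_chimney_germ[OF C(1)] by (intro ma3_situationI[OF A _ A]) auto
    then have "ma4_situation M \<A> Iso A A' (filtermap ?f ?R) (filtermap ?f ?R)"
      using A A' chart_le[OF A f] by (simp add: ma4_situation_def)
    from st[unfolded strongly_transitive_def, THEN conjunct2, rule_format, OF this]
    obtain g where g: "g \<in> G" "weyl_isomorphism M Iso A A' g"
      "\<forall>\<^sub>F x in enclosure_in M Iso A (filtermap ?f ?R). g x = x" by auto
    have "g \<circ> ?f \<in> Iso A'" using g(2) weyl_isomorphism_iff[OF A A'(1) f] by blast
    moreover have "eventually (\<lambda>v. g (?f v) = ?f v) (enclosure M ?R)"
      using g(3) by (simp add: enclosure_in_chart[OF A f] eventually_filtermap)
    ultimately show "\<exists>g\<in>G. g \<circ> ?f \<in> Iso A' \<and> eventually (\<lambda>v. g (?f v) = ?f v) ?R"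
      using g(1) filter_leD[OF enclosure_extensive] by blast
  qed
qed

end

section \<open>From charts to strong transitivity\<close>

context masure_group
begin

text \<open>All four cases of (MA2) are of this form, \<open>x\<close> being the base point of the filter \<open>\<Omega>\<close>.  Choose in \<open>A\<close> a
  sector germ whose direction \<open>C\<close> has \<open>D\<close> in its closure, and in \<open>A'\<close> a local chamber at \<open>x\<close> having the
  local face \<open>germ\<^sub>x(x + E)\<close> in its closure.  An apartment \<open>B\<close> containing both contains \<open>\<Omega>\<close> by (MA4), and
  shares with \<open>A\<close> and with \<open>A'\<close> an open set; so \<open>A\<close> is first moved to \<open>B\<close> and then to \<open>A'\<close>.  The first
  motion fixes \<open>\<Omega>\<close> by (MA4), and the second one does because it fixes a local chamber at \<open>x\<close>.\<close>

lemma move_chimney: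
  assumes T: "transitive_on_charts"
    and A: "A \<in> \<A>" "A' \<in> \<A>" "f \<in> Iso A" "f' \<in> Iso A'"
    and agree: "eventually (\<lambda>v. f' v = f v) (enclosure M \<Omega>)"
    and E: "E \<in> faces M" and D: "D \<in> faces M"
    and lower: "enclosure M (local_face x E) \<le> enclosure M \<Omega>"
    and upper: "\<Omega> \<le> chimney M (local_face x E) D"
  shows "\<exists>g\<in>G. g \<circ> f \<in> Iso A' \<and> eventually (\<lambda>v. g (f v) = f v) (enclosure M \<Omega>)"
proof -
  obtain C where C: "C \<in> chambers M" "\<And>u c. u \<in> D \<Longrightarrow> c \<in> C \<Longrightarrow> u + c \<in> C"
    using face_below_chamber[OF D] by metis
  obtain C1 where C1: "C1 \<in> chambers M" "\<And>u c. u \<in> E \<Longrightarrow> c \<in> C1 \<Longrightarrow> u + c \<in> C1"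
    using face_below_chamber[OF E] by metis
  note CF = chamber_is_face[OF C(1)] and C1F = chamber_is_face[OF C1(1)]
  let ?R = "chimney_germ M (local_face x C) C" and ?K = "enclosure M (local_face x E)"
  let ?K1 = "enclosure M (local_face x C1)"
  have R: "filtermap f ?R \<in> filters_in Iso A (splayed_chimney_germs M)"
    by (rule splayed_in_chart[OF A(1,3) CF chamber_spherical[OF C(1)]])
  have "ma3_situation M \<A> Iso (filtermap f ?R) (filtermap f' ?K1)"
    by (rule ma3_situationI[OF A(1) R A(2)]) (use closed_face_in_chart[OF A(2,4) C1F] in blast)
  then obtain B where B: "B \<in> \<A>" "filtermap f ?R \<le> principal B" "filtermap f' ?K1 \<le> principal B"
    by (rule MA3)
  have "filtermap f ?K = filtermap f' ?K"
    by (rule filtermap_agree[symmetric]) (rule filter_leD[OF lower agree])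
  also have "\<dots> \<le> filtermap f' ?K1" by (intro filtermap_mono enclosure_local_face_below C1)
  finally have KB: "filtermap f ?K \<le> principal B" using B(3) by (rule order_trans)
  have "ma4_situation M \<A> Iso A B (filtermap f ?R) (filtermap f ?K)"
    unfolding ma4_situation_def
  proof (intro conjI)
    show "ma3_situation M \<A> Iso (filtermap f ?R) (filtermap f ?K)"
      by (rule ma3_situationI[OF A(1) R A(1)]) (use closed_face_in_chart[OF A(1,3) E] in blast)
  qed (use A B KB chart_le in auto)
  then obtain h where h: "h \<in> Iso B" "eventually (\<lambda>v. h v = f v) (enclosure M (sup ?R ?K))"
    using MA4_chart[OF _ A(3)] by metis
  obtain P2 where P2: "P2 \<in> enclosed_sets M" "eventually (\<lambda>v. v \<in> P2) ?R" "eventually (\<lambda>v. v \<in> P2) ?K"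
    "\<forall>v\<in>P2. h v = f v"
    using h(2) by (auto simp: eventually_enclosure_iff[of _ "sup _ _"] eventually_sup)
  have "eventually (\<lambda>v. h v = f v) ?R" using P2(2) by (rule eventually_mono) (use P2(4) in blast)
  then obtain g1 where g1: "g1 \<in> G" "g1 \<circ> f = h"
    using transitive_chimney_germ[OF T A(1) B(1) A(3) h(1) C(1) CF] by metis
  have "filtermap f' (local_face x C1) \<le> principal B"
    using B(3) filtermap_mono[OF enclosure_extensive] order_trans by blast
  then obtain h' where h': "h' \<in> Iso B" "eventually (\<lambda>v. h' v = f' v) (local_face x C1)"
    using local_chamber_chart[OF A(2) B(1) A(4) C1(1)] by metis
  have h'2: "eventually (\<lambda>v. f' v = h' v) (local_face x C1)" using h'(2) by (simp add: eq_commute)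
  obtain g2 where g2: "g2 \<in> G" "g2 \<circ> h' = f'"
    using transitive_local_chamber[OF T B(1) A(2) h'(1) A(4) C1(1) h'2] by metis
  obtain P1 where P1: "P1 \<in> enclosed_sets M" "eventually (\<lambda>v. v \<in> P1) \<Omega>" "\<forall>v\<in>P1. f' v = f v"
    using agree by (auto simp: eventually_enclosure_iff)
  \<comment> \<open>The set on which \<open>f\<close> and \<open>h\<close> agree contains \<open>\<Omega>\<close>: it contains a sector of direction \<open>C\<close> and a
    neighbourhood of \<open>x\<close> in \<open>x + E\<close>, hence it is stable under \<open>D\<close> and contains a tube.\<close>
  have "tube x E D P2"
  proof -
    have "eventually (\<lambda>v. v \<in> P2) (local_face x E)" by (rule filter_leD[OF enclosure_extensive P2(3)])
    then obtain S where S: "open S" "0 \<in> S" "\<And>u. u \<in> E \<Longrightarrow> u \<in> S \<Longrightarrow> x + u \<in> P2"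
      unfolding eventually_local_face by blast
    obtain \<xi> where \<xi>: "\<And>c. c \<in> C \<Longrightarrow> x + \<xi> + c \<in> P2"
      using P2(2)[folded sector_germ_eq_chimney_germ[OF C(1)]]
      by (auto simp: eventually_sector_germ_iff[OF C(1)])
    have "x + u + d \<in> P2" if "u \<in> E" "u \<in> S" "d \<in> D" for u d
      by (rule recession[OF enclosed_closed_convex[OF P2(1)] C(1) \<xi> S(3)[OF that(1,2)] C(2)[OF that(3)]])
    then show ?thesis unfolding tube_def using S(1,2) by blast
  qed
  then have "eventually (\<lambda>v. v \<in> P2) (chimney M (local_face x E) D)"
    unfolding eventually_chimney_iff using P2(1) by blast
  then have P2\<Omega>: "eventually (\<lambda>v. v \<in> P2) \<Omega>" by (rule filter_leD[OF upper])
  let ?P = "P1 \<inter> P2"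
  have P: "?P \<in> enclosed_sets M" "eventually (\<lambda>v. v \<in> ?P) \<Omega>"
    using enclosed_sets_Int[OF P1(1) P2(1)] eventually_conj[OF P1(2) P2\<Omega>] by simp_all
  then have P\<Omega>: "eventually (\<lambda>v. v \<in> ?P) (enclosure M \<Omega>)" unfolding eventually_enclosure_iff by blast
  have "eventually (\<lambda>v. v \<in> ?P) (local_face x E)"
    by (rule filter_leD[OF enclosure_extensive filter_leD[OF lower P\<Omega>]])
  then have x: "x \<in> ?P" by (rule local_face_base[OF enclosed_closed_convex(1)[OF P(1)] E])
  have hh': "h' p = f' p" if "p \<in> ?P" for p
    by (rule agree_on_convex[OF A(2) B(1) A(4) h'(1) h(1) C1(1) h'(2)
          enclosed_closed_convex(2)[OF P(1)] x _ that])
       (use P1(3) P2(4) in auto)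
  have g1f: "g1 (f v) = h v" and g2h: "g2 (h' v) = f' v" for v
    using g1(2) g2(2) by (auto dest: fun_cong[of _ _ v])
  show ?thesis
  proof (intro bexI[of _ "g2 \<circ> g1"] conjI)
    show "g2 \<circ> g1 \<in> G" by (rule G_comp[OF g2(1) g1(1)])
    obtain w where w: "w \<in> Wa M" "h = h' \<circ> w" using chart_change[OF B(1) h'(1) h(1)] .
    have "(g2 \<circ> g1) \<circ> f = f' \<circ> w" using g1f g2h w(2) by auto
    then show "(g2 \<circ> g1) \<circ> f \<in> Iso A'" using chart_comp[OF A(2,4) w(1)] by simp
    have "(g2 \<circ> g1) (f p) = f p" if p: "p \<in> ?P" for p
    proof -
      have "h p = h' p" using hh'[OF p] P1(3) P2(4) p by auto
      then show ?thesis using g1f g2h P1(3) p by simp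
    qed
    then show "eventually (\<lambda>v. (g2 \<circ> g1) (f v) = f v) (enclosure M \<Omega>)"
      using P\<Omega> by (auto elim: eventually_mono)
  qed
qed

lemma move_MA2:
  assumes T: "transitive_on_charts" and sit: "ma2_situation M \<A> Iso A A' F"
  shows "\<exists>g\<in>G. weyl_isomorphism M Iso A A' g \<and> (\<forall>\<^sub>F x in enclosure_in M Iso A F. g x = x)"
proof -
  have A: "A \<in> \<A>" "A' \<in> \<A>" using sit by (auto simp: ma2_situation_def)
  let ?f = "chart Iso A"
  note f = chart_in[OF A(1)]
  obtain F0 where F0: "F = filtermap ?f F0"
    "F0 \<in> points \<union> preordered_segment_germs M \<union> generic_rays M \<union> solid_chimneys M"
    using sit unfolding ma2_situation_def filters_in_def by blast
  \<comment> \<open>A point is a degenerate chimney of minimal direction, and a segment germ or a ray starting at \<open>x\<close>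
    lies between the point \<open>x\<close> and the chimney whose direction is the face containing it.\<close>
  have ray: "\<exists>x E D. E \<in> faces M \<and> D \<in> faces M \<and> enclosure M (local_face x E) \<le> enclosure M F0 \<and>
      F0 \<le> chimney M (local_face x E) D"
    if D: "D \<in> faces M" and start: "\<And>Q. eventually Q F0 \<Longrightarrow> Q x"
      and inside: "\<And>Q. Q x \<Longrightarrow> (\<And>d. d \<in> D \<Longrightarrow> Q (x + d)) \<Longrightarrow> eventually Q F0" for x D
  proof (intro exI conjI)
    have "principal {x} \<le> F0" by (rule filter_leI) (simp add: eventually_principal start)
    then have "enclosure M (principal {x}) \<le> enclosure M F0" by (rule enclosure_mono)
    then show "enclosure M (local_face x (Fv M UNIV)) \<le> enclosure M F0"
      by (rule order_trans[OF enclosure_minimal_face])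
    show "F0 \<le> chimney M (local_face x (Fv M UNIV)) D"
    proof (rule filter_leI)
      fix Q assume "eventually Q (chimney M (local_face x (Fv M UNIV)) D)"
      then obtain P where P: "P \<in> enclosed_sets M" "tube x (Fv M UNIV) D P" "\<forall>v\<in>P. Q v"
        unfolding eventually_chimney_iff by blast
      note b = tube_base[OF enclosed_closed_convex(1)[OF P(1)] minimal_face D P(2)]
      show "eventually Q F0" using P(3) b(1,3) by (intro inside) blast+
    qed
  qed (use D minimal_face in auto)
  have "\<exists>x E D. E \<in> faces M \<and> D \<in> faces M \<and> enclosure M (local_face x E) \<le> enclosure M F0 \<and>
      F0 \<le> chimney M (local_face x E) D"
  proof -
    have tle: "comparable (y - x)" if "tle M x y \<or> tle M y x" for x y
      using that unfolding tle_def comparable_def by auto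
    have tless: "tle M x y" if "tless M x y" for x y
      using that open_tits_cone_le unfolding tless_def tle_def by auto
    consider "F0 \<in> points" | "F0 \<in> preordered_segment_germs M" | "F0 \<in> generic_rays M"
      | "F0 \<in> solid_chimneys M" using F0(2) by blast
    then show ?thesis
    proof cases
      case 1
      then obtain x where pt: "F0 = principal {x}" unfolding points_def by blast
      show ?thesis by (rule ray[OF minimal_face]) (auto simp: pt eventually_principal)
    next
      case 2
      then obtain x y where seg: "F0 = germ_at x (closed_segment x y)" "comparable (y - x)"
        using tle unfolding preordered_segment_germs_def by blast
      obtain D where D: "D \<in> faces M" "y - x \<in> D" using seg(2) by (auto simp: comparable_iff)
      show ?thesis
      proof (rule ray[OF D(1)])
        show "Q x" if "eventually Q F0" for Q
          using eventually_germ_segment[OF that[unfolded seg(1)]] by force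
        fix Q assume Q: "Q x" "\<And>d. d \<in> D \<Longrightarrow> Q (x + d)"
        have "Q v" if v: "v \<in> closed_segment x y" for v
        proof -
          obtain s where s: "s \<in> {0..1}" "v = x + s *\<^sub>R (y - x)" using v unfolding in_segment by blast
          then show ?thesis using Q face_scale[OF D, of s] by (cases "s = 0") auto
        qed
        then show "eventually Q F0" unfolding seg(1) germ_at_def eventually_inf_principal by simp
      qed
    next
      case 3
      then obtain x y where gen: "F0 = principal {x + t *\<^sub>R (y - x) | t. 0 \<le> t}" "comparable (y - x)"
        using tle tless unfolding generic_rays_def by blast
      obtain D where D: "D \<in> faces M" "y - x \<in> D" using gen(2) by (auto simp: comparable_iff)
      show ?thesis
      proof (rule ray[OF D(1)])
        show "Q x" if "eventually Q F0" for Q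
          using that unfolding gen(1) eventually_principal by force
        fix Q assume Q: "Q x" "\<And>d. d \<in> D \<Longrightarrow> Q (x + d)"
        have "Q (x + s *\<^sub>R (y - x))" if "0 \<le> s" for s
          using Q face_scale[OF D, of s] that by (cases "s = 0") auto
        then show "eventually Q F0" unfolding gen(1) eventually_principal by auto
      qed
    next
      case 4
      then obtain x E D where chim: "F0 = chimney M (local_face x E) D" "E \<in> faces M" "D \<in> faces M"
        unfolding solid_chimneys_def local_faces_def by blast
      have "enclosure M (local_face x E) \<le> enclosure M F0"
        unfolding enclosure_le_iff
      proof (rule filter_leI)
        fix Q assume "eventually Q (enclosure M F0)"
        then have "eventually Q F0" unfolding chim(1) chimney_def enclosure_idem .
        then obtain P where P: "P \<in> enclosed_sets M" "tube x E D P" "\<forall>v\<in>P. Q v"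
          unfolding chim(1) eventually_chimney_iff by blast
        from tube_base(2)[OF enclosed_closed_convex(1)[OF P(1)] chim(2,3) P(2)]
        show "eventually Q (local_face x E)" by (rule eventually_mono) (use P(3) in blast)
      qed
      then show ?thesis using chim by blast
    qed
  qed
  then obtain x E D where ED: "E \<in> faces M" "D \<in> faces M"
    "enclosure M (local_face x E) \<le> enclosure M F0" "F0 \<le> chimney M (local_face x E) D" by blast
  obtain f' where f': "f' \<in> Iso A'" "eventually (\<lambda>v. f' v = ?f v) (enclosure M F0)"
    using MA2_chart[OF sit[unfolded F0(1)] f] by blast
  obtain g where g: "g \<in> G" "g \<circ> ?f \<in> Iso A'" "eventually (\<lambda>v. g (?f v) = ?f v) (enclosure M F0)"
    using move_chimney[OF T A f f' ED] by blast
  then show ?thesis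
    unfolding F0(1) weyl_isomorphism_iff[OF A f] enclosure_in_chart[OF A(1) f]
    by (auto simp: eventually_filtermap)
qed

text \<open>Here \<open>A\<close> and \<open>A'\<close> share the germ of a splayed chimney and the filter \<open>F0\<close>, both in coordinates of \<open>A\<close>.
  The image of \<open>F0\<close> is that of a filter \<open>F2\<close> of an apartment \<open>B\<close>, and \<open>F2'\<close> is a filter containing \<open>F2\<close>
  and local chambers of \<open>B\<close> at points of \<open>F2\<close>.  Enlarge the chimney to one based on a local chamber,
  inside \<open>A\<close> and inside \<open>A'\<close>.  By (MA3) there are apartments \<open>A1\<close>, \<open>A2\<close> containing the image of \<open>F2'\<close>
  together with the germ of one or the other of these chimneys.  Any two consecutive apartments in
  \<open>A, A1, A2, A'\<close> share an open set.  The first and the last motion fix \<open>F0\<close> and the germ of the given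
  chimney by (MA4), and the second one does because it fixes a local chamber at one of their points.\<close>

lemma move_MA4_chart:
  assumes T: "transitive_on_charts"
    and A: "A \<in> \<A>" "A' \<in> \<A>" "a \<in> Iso A" "a' \<in> Iso A'"
    and E: "E \<in> faces M" and D: "D \<in> spherical_faces M"
    and agree: "eventually (\<lambda>v. a' v = a v) (enclosure M (sup (chimney_germ M (local_face x E) D) F0))"
    and B: "B \<in> \<A>" "c \<in> Iso B" "filtermap a F0 = filtermap c F2" "F2 \<le> F2'"
    and F2: "filtermap c F2 \<in> filters_in Iso B (closed_faces M) \<or> filtermap c F2 \<in> filters_in Iso B (solid_chimney_germs M)"
    and F2': "filtermap c F2' \<in> filters_in Iso B (closed_faces M) \<or> filtermap c F2' \<in> filters_in Iso B (solid_chimney_germs M)"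
    and C2: "C2 \<in> chambers M"
    and near: "\<And>Q Q'. eventually Q F2 \<Longrightarrow> eventually Q' F2' \<Longrightarrow> \<exists>y. Q y \<and> eventually Q' (local_face y C2)"
  shows "\<exists>g\<in>G. g \<circ> a \<in> Iso A' \<and>
    eventually (\<lambda>v. g (a v) = a v) (enclosure M (sup (chimney_germ M (local_face x E) D) F0))"
proof -
  obtain C1 where C1: "C1 \<in> chambers M" "\<And>u c. u \<in> E \<Longrightarrow> c \<in> C1 \<Longrightarrow> u + c \<in> C1"
    using face_below_chamber[OF E] by metis
  note C1F = chamber_is_face[OF C1(1)] and DF = spherical_face_is_face[OF D]
  let ?R = "chimney_germ M (local_face x E) D" and ?R' = "chimney_germ M (local_face x C1) D"
  have RR': "?R \<le> ?R'" by (rule chimney_germ_below[OF C1 DF])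
  have step: "\<exists>B1\<in>\<A>. filtermap c F2' \<le> principal B1 \<and>
      (\<exists>h\<in>Iso B1. eventually (\<lambda>v. h v = b v) (enclosure M (sup ?R' F0)))"
    if b: "A0 \<in> \<A>" "b \<in> Iso A0" "filtermap b F0 = filtermap c F2" for A0 b
  proof -
    have R: "filtermap b ?R' \<in> filters_in Iso A0 (splayed_chimney_germs M)"
      by (rule splayed_in_chart[OF b(1,2) C1F D])
    have "ma3_situation M \<A> Iso (filtermap b ?R') (filtermap c F2')"
      by (rule ma3_situationI[OF b(1) R B(1) F2'])
    then obtain B1 where B1: "B1 \<in> \<A>" "filtermap b ?R' \<le> principal B1" "filtermap c F2' \<le> principal B1"
      by (rule MA3)
    have "filtermap b F0 \<le> principal B1"
      unfolding b(3) using filtermap_mono[OF B(4)] B1(3) by (rule order_trans)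
    moreover have "ma3_situation M \<A> Iso (filtermap b ?R') (filtermap b F0)"
      unfolding b(3) by (rule ma3_situationI[OF b(1) R B(1) F2])
    ultimately have "ma4_situation M \<A> Iso A0 B1 (filtermap b ?R') (filtermap b F0)"
      unfolding ma4_situation_def using b(1) B1 chart_le[OF b(1,2)] by (intro conjI) blast+
    from MA4_chart[OF this b(2)] obtain h
      where "h \<in> Iso B1" "eventually (\<lambda>v. h v = b v) (enclosure M (sup ?R' F0))" by blast
    then show ?thesis using B1(1,3) by blast
  qed
  have R_sup: "eventually Q ?R'" if "eventually Q (enclosure M (sup ?R' F0))" for Q
    using filter_leD[OF enclosure_extensive that] by (simp add: eventually_sup)
  have "eventually (\<lambda>v. a' v = a v) F0"
    using filter_leD[OF enclosure_extensive agree] by (simp add: eventually_sup)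
  then have a'F0: "filtermap a' F0 = filtermap c F2" using filtermap_agree B(3) by metis
  obtain A1 h where A1: "A1 \<in> \<A>" "filtermap c F2' \<le> principal A1" "h \<in> Iso A1"
    "eventually (\<lambda>v. h v = a v) (enclosure M (sup ?R' F0))"
    using step[OF A(1,3) B(3)] by blast
  obtain A2 h' where A2: "A2 \<in> \<A>" "filtermap c F2' \<le> principal A2" "h' \<in> Iso A2"
    "eventually (\<lambda>v. h' v = a' v) (enclosure M (sup ?R' F0))"
    using step[OF A(2,4) a'F0] by blast
  obtain g1 where g1: "g1 \<in> G" "g1 \<circ> a = h"
    using transitive_chimney_germ[OF T A(1) A1(1) A(3) A1(3) C1(1) DF R_sup[OF A1(4)]] by metis
  have "eventually (\<lambda>v. a' v = h' v) ?R'" using R_sup[OF A2(4)] by (simp add: eq_commute)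
  then obtain g3 where g3: "g3 \<in> G" "g3 \<circ> h' = a'"
    using transitive_chimney_germ[OF T A2(1) A(2) A2(3) A(4) C1(1) DF] by metis
  obtain P0 where P0: "P0 \<in> enclosed_sets M" "eventually (\<lambda>v. v \<in> P0) (sup ?R F0)" "\<forall>v\<in>P0. a' v = a v"
    using agree by (auto simp: eventually_enclosure_iff)
  obtain P1 where P1: "P1 \<in> enclosed_sets M" "eventually (\<lambda>v. v \<in> P1) (sup ?R' F0)" "\<forall>v\<in>P1. h v = a v"
    using A1(4) by (auto simp: eventually_enclosure_iff)
  obtain P2 where P2: "P2 \<in> enclosed_sets M" "eventually (\<lambda>v. v \<in> P2) (sup ?R' F0)" "\<forall>v\<in>P2. h' v = a' v"
    using A2(4) by (auto simp: eventually_enclosure_iff)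
  define P where "P = P0 \<inter> P1 \<inter> P2"
  have P: "P \<in> enclosed_sets M" unfolding P_def by (intro enclosed_sets_Int P0 P1 P2)
  have "sup ?R F0 \<le> sup ?R' F0" using RR' by (rule sup_mono) simp
  from filter_leD[OF this P1(2)] filter_leD[OF this P2(2)] P0(2)
  have PR: "eventually (\<lambda>v. v \<in> P) (sup ?R F0)" unfolding P_def by eventually_elim simp
  have eqs: "a' v = a v" "h v = a v" "h' v = a v" if "v \<in> P" for v
    using that P0(3) P1(3) P2(3) by (auto simp: P_def)
  \<comment> \<open>A point \<open>c y\<close> of the image of \<open>P\<close> such that \<open>A1\<close> and \<open>A2\<close> contain a local chamber of \<open>B\<close> at \<open>c y\<close>.\<close>
  have "eventually (\<lambda>v. a v \<in> a ` P) F0" using PR by (auto simp: eventually_sup elim: eventually_mono)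
  then have "eventually (\<lambda>x. x \<in> a ` P) (filtermap a F0)" by (simp add: eventually_filtermap)
  then have "eventually (\<lambda>v. c v \<in> a ` P) F2" unfolding B(3) by (simp add: eventually_filtermap)
  moreover have "eventually (\<lambda>v. c v \<in> A1 \<and> c v \<in> A2) F2'"
    using A1(2) A2(2) by (auto simp: le_principal eventually_filtermap intro: eventually_conj)
  ultimately obtain y where y: "c y \<in> a ` P" "eventually (\<lambda>v. c v \<in> A1 \<and> c v \<in> A2) (local_face y C2)"
    using near by blast
  obtain x0 where x0: "x0 \<in> P" "c y = a x0" using y(1) by blast
  have yB: "c y \<in> A1" "c y \<in> A2" using eqs[OF x0(1)] x0(2) chart_mem[OF A1(1,3)] chart_mem[OF A2(1,3)] by metis+
  have base: "\<exists>k\<in>Iso B1. eventually (\<lambda>v. k v = c v) (local_face y C2) \<and> k y = c y"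
    if B1: "B1 \<in> \<A>" "c y \<in> B1" "eventually (\<lambda>v. c v \<in> B1) (local_face y C2)" for B1
  proof -
    have "filtermap c (local_face y C2) \<le> principal B1" using B1(3) by (simp add: le_principal eventually_filtermap)
    then obtain k where k: "k \<in> Iso B1" "eventually (\<lambda>v. k v = c v) (local_face y C2)"
      using local_chamber_chart[OF B(1) B1(1) B(2) C2] by metis
    obtain k2 where k2: "k2 \<in> Iso B1" "eventually (\<lambda>v. k2 v = c v) (enclosure M (principal {y}))"
      using MA2_point[OF B(1) B1(1) B(2) B1(2)] by metis
    have "k2 y = c y" using filter_leD[OF enclosure_extensive k2(2)] by (simp add: eventually_principal)
    then have "k y = c y"
      by (intro agree_on_convex[OF B(1) B1(1) B(2) k(1) k2(1) C2 k(2), of "{y}"]) auto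
    then show ?thesis using k by blast
  qed
  obtain k where k: "k \<in> Iso A1" "eventually (\<lambda>v. k v = c v) (local_face y C2)" "k y = c y"
    using base[OF A1(1) yB(1) eventually_mono[OF y(2)]] by blast
  obtain k' where k': "k' \<in> Iso A2" "eventually (\<lambda>v. k' v = c v) (local_face y C2)"
    using base[OF A2(1) yB(2) eventually_mono[OF y(2)]] by blast
  have kk': "eventually (\<lambda>v. k' v = k v) (local_face y C2)" using k(2) k'(2) by eventually_elim simp
  obtain g2 where g2: "g2 \<in> G" "g2 \<circ> k = k'"
    using transitive_local_chamber[OF T A1(1) A2(1) k(1) k'(1) C2 kk'] by metis
  obtain w where w: "w \<in> Wa M" "k = h \<circ> w" using chart_change[OF A1(1,3) k(1)] .
  let ?h = "k' \<circ> inv w"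
  have h2: "?h \<in> Iso A2" by (rule chart_comp[OF A2(1) k'(1) Wa_inv[OF w(1)]])
  have g2h: "g2 \<circ> h = ?h"
  proof
    fix v
    have "g2 (h v) = g2 (k (inv w v))" by (simp add: w(2) Wa_inv_apply[OF w(1)])
    also have "\<dots> = k' (inv w v)" using g2(2) by (metis comp_apply)
    finally show "(g2 \<circ> h) v = ?h v" by simp
  qed
  have wy: "w y = x0"
    using k(3) x0(2) eqs(2)[OF x0(1)] chart_inj[OF A1(1,3), of "w y" x0] by (simp add: w(2))
  obtain u t where u: "u \<in> Wv M" "w = (\<lambda>v. u v + t)" by (rule Wa_affine[OF w(1)])
  have "eventually (\<lambda>v. ?h v = h v) (filtermap w (local_face y C2))"
    using kk' unfolding eventually_filtermap by eventually_elim (simp add: Wa_inv_apply[OF w(1)] w(2))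
  then have ev: "eventually (\<lambda>v. ?h v = h v) (local_face x0 (u ` C2))"
    unfolding local_face_Wa[OF u w(1)] wy .
  have hh: "?h v = h v" if v: "v \<in> P" for v
    by (rule agree_on_convex[OF A1(1) A2(1) A1(3) h2 A2(3) chamber_Wv[OF u(1) C2] ev
          enclosed_closed_convex(2)[OF P] x0(1) _ v])
       (simp add: eqs)
  obtain w' where w': "w' \<in> Wa M" "?h = h' \<circ> w'" using chart_change[OF A2(1,3) h2] .
  have ap: "g1 (a v) = h v" "g2 (h v) = ?h v" "g3 (h' v) = a' v" for v
    using g1(2) g2h g3(2) by (auto dest: fun_cong[of _ _ v])
  show ?thesis
  proof (intro bexI[of _ "g3 \<circ> (g2 \<circ> g1)"] conjI)
    show "g3 \<circ> (g2 \<circ> g1) \<in> G" by (intro G_comp g1 g2 g3)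
    have "(g3 \<circ> (g2 \<circ> g1)) \<circ> a = a' \<circ> w'"
    proof
      fix v
      have "?h v = h' (w' v)" using w'(2) by (metis comp_apply)
      then show "((g3 \<circ> (g2 \<circ> g1)) \<circ> a) v = (a' \<circ> w') v" using ap by simp
    qed
    then show "(g3 \<circ> (g2 \<circ> g1)) \<circ> a \<in> Iso A'" using chart_comp[OF A(2,4) w'(1)] by simp
    have "(g3 \<circ> (g2 \<circ> g1)) (a v) = a v" if v: "v \<in> P" for v
    proof -
      have "g2 (g1 (a v)) = h' v" unfolding ap using hh[OF v] eqs[OF v] by simp
      then show ?thesis using ap(3) eqs(1)[OF v] by simp
    qed
    then show "eventually (\<lambda>v. (g3 \<circ> (g2 \<circ> g1)) (a v) = a v) (enclosure M (sup ?R F0))"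
      unfolding eventually_enclosure_iff using P PR by blast
  qed
qed

text \<open>(MA4) is applied to the germ and to one of its points; so the germ of a splayed chimney of \<open>B\<close> that is
  contained in \<open>A\<close> is also the germ of a splayed chimney of \<open>A\<close>.\<close>

lemma splayed_germ_chart:
  assumes B: "B \<in> \<A>" "A \<in> \<A>" "b \<in> Iso B" and E: "E \<in> faces M" and D: "D \<in> spherical_faces M"
    and R: "filtermap b (chimney_germ M (local_face x E) D) \<le> principal A"
  obtains a where "a \<in> Iso A" "eventually (\<lambda>v. a v = b v) (chimney_germ M (local_face x E) D)"
proof -
  note DF = spherical_face_is_face[OF D]
  let ?R = "chimney_germ M (local_face x E) D"
  obtain \<xi> P where P: "\<xi> \<in> D" "P \<in> enclosed_sets M" "tube (x + \<xi>) E D P" "\<forall>v\<in>P. b v \<in> A"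
    using R by (auto simp: le_principal eventually_filtermap eventually_chimney_germ_iff[OF DF])
  let ?p = "x + \<xi>" and ?K = "enclosure M (local_face (x + \<xi>) (Fv M UNIV))"
  have "?p \<in> P" by (rule tube_base(3)[OF enclosed_closed_convex(1)[OF P(2)] E DF P(3)])
  then have pA: "b ?p \<in> A" using P(4) by blast
  have "ma3_situation M \<A> Iso (filtermap b ?R) (filtermap b ?K)"
    using splayed_in_chart[OF B(1,3) E D] closed_face_in_chart[OF B(1,3) minimal_face]
    by (intro ma3_situationI[OF B(1) _ B(1)]) auto
  then have "ma4_situation M \<A> Iso B A (filtermap b ?R) (filtermap b ?K)"
    using B R chart_le[OF B(1,3)] minimal_closed_face_le[OF B pA] by (simp add: ma4_situation_def)
  then obtain a where a: "a \<in> Iso A" "eventually (\<lambda>v. a v = b v) (enclosure M (sup ?R ?K))"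
    using MA4_chart[OF _ B(3)] by metis
  show thesis
  proof (rule that[OF a(1)])
    show "eventually (\<lambda>v. a v = b v) ?R"
      using filter_leD[OF enclosure_extensive a(2)] by (simp add: eventually_sup)
  qed
qed

lemma move_MA4:
  assumes T: "transitive_on_charts" and sit: "ma4_situation M \<A> Iso A A' R F"
  shows "\<exists>g\<in>G. weyl_isomorphism M Iso A A' g \<and> (\<forall>\<^sub>F x in enclosure_in M Iso A (sup R F). g x = x)"
proof -
  have A: "A \<in> \<A>" "A' \<in> \<A>" and le: "R \<le> principal A" "F \<le> principal A"
    and ma3: "ma3_situation M \<A> Iso R F" using sit by (auto simp: ma4_situation_def)
  obtain B1 where B1: "B1 \<in> \<A>" "R \<in> filters_in Iso B1 (splayed_chimney_germs M)"
    using ma3 unfolding ma3_situation_def by blast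
  then obtain x E D where ED: "E \<in> faces M" "D \<in> spherical_faces M"
    "R = filtermap (chart Iso B1) (chimney_germ M (local_face x E) D)"
    unfolding filters_in_def splayed_chimney_germs_def local_faces_def by blast
  let ?R = "chimney_germ M (local_face x E) D"
  obtain a where a: "a \<in> Iso A" "eventually (\<lambda>v. a v = chart Iso B1 v) ?R"
    using splayed_germ_chart[OF B1(1) A(1) chart_in[OF B1(1)] ED(1,2) le(1)[unfolded ED(3)]] by metis
  have Ra: "R = filtermap a ?R" unfolding ED(3) by (rule filtermap_agree[OF a(2), symmetric])
  define F0 where "F0 = filtermap (inv a) F"
  have Fa: "F = filtermap a F0" unfolding F0_def by (rule filter_in_chart[OF A(1) a(1) le(2)])
  obtain a' where a': "a' \<in> Iso A'" "eventually (\<lambda>v. a' v = a v) (enclosure M (sup ?R F0))"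
    using MA4_chart[OF sit[unfolded Ra Fa] a(1)] by metis
  obtain B where B: "B \<in> \<A>" "F \<in> filters_in Iso B (closed_faces M) \<or> F \<in> filters_in Iso B (solid_chimney_germs M)"
    using ma3 unfolding ma3_situation_def filters_in_def by blast
  let ?c = "chart Iso B"
  note c = chart_in[OF B(1)]
  \<comment> \<open>The local face on which \<open>F\<close> is built is replaced by a local chamber.\<close>
  have "\<exists>F2 F2' C2. F = filtermap ?c F2 \<and> F2 \<le> F2' \<and> C2 \<in> chambers M \<and>
      (filtermap ?c F2' \<in> filters_in Iso B (closed_faces M) \<or>
       filtermap ?c F2' \<in> filters_in Iso B (solid_chimney_germs M)) \<and>
      (\<forall>Q Q'. eventually Q F2 \<longrightarrow> eventually Q' F2' \<longrightarrow> (\<exists>y. Q y \<and> eventually Q' (local_face y C2)))"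
    using B(2)
  proof
    assume "F \<in> filters_in Iso B (closed_faces M)"
    then obtain y E2 where E2: "E2 \<in> faces M" "F = filtermap ?c (enclosure M (local_face y E2))"
      unfolding filters_in_def closed_faces_def local_faces_def by blast
    obtain C2 where C2: "C2 \<in> chambers M" "\<And>u c. u \<in> E2 \<Longrightarrow> c \<in> C2 \<Longrightarrow> u + c \<in> C2"
      using face_below_chamber[OF E2(1)] by metis
    have "\<exists>y. Q y \<and> eventually Q' (local_face y C2)"
      if Q: "eventually Q (enclosure M (local_face y E2))" "eventually Q' (enclosure M (local_face y C2))"
      for Q Q'
    proof -
      obtain P where P: "P \<in> enclosed_sets M" "eventually (\<lambda>v. v \<in> P) (local_face y E2)" "\<forall>v\<in>P. Q v"
        using Q(1) by (auto simp: eventually_enclosure_iff)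
      have "y \<in> P" by (rule local_face_base[OF enclosed_closed_convex(1)[OF P(1)] E2(1) P(2)])
      then show ?thesis using P(3) filter_leD[OF enclosure_extensive Q(2)] by blast
    qed
    then show ?thesis
      using E2(2) C2(1) enclosure_local_face_below[OF C2]
        closed_face_in_chart[OF B(1) c chamber_is_face[OF C2(1)]] by blast
  next
    assume "F \<in> filters_in Iso B (solid_chimney_germs M)"
    then obtain y E2 D2 where E2: "E2 \<in> faces M" "D2 \<in> faces M"
      "F = filtermap ?c (chimney_germ M (local_face y E2) D2)"
      unfolding filters_in_def solid_chimney_germs_def local_faces_def by blast
    obtain C2 where C2: "C2 \<in> chambers M" "\<And>u c. u \<in> E2 \<Longrightarrow> c \<in> C2 \<Longrightarrow> u + c \<in> C2"
      using face_below_chamber[OF E2(1)] by metis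
    have "\<exists>y. Q y \<and> eventually Q' (local_face y C2)"
      if Q: "eventually Q (chimney_germ M (local_face y E2) D2)"
        "eventually Q' (chimney_germ M (local_face y C2) D2)" for Q Q'
    proof -
      obtain \<xi> P where P: "\<xi> \<in> D2" "P \<in> enclosed_sets M" "tube (y + \<xi>) E2 D2 P" "\<forall>v\<in>P. Q v"
        using Q(1) unfolding eventually_chimney_germ_iff[OF E2(2)] by blast
      obtain \<zeta> P' where P': "\<zeta> \<in> D2" "P' \<in> enclosed_sets M" "tube (y + \<zeta>) C2 D2 P'" "\<forall>v\<in>P'. Q' v"
        using Q(2) unfolding eventually_chimney_germ_iff[OF E2(2)] by blast
      let ?y = "y + \<xi> + \<zeta>"
      have "?y \<in> P" by (rule tube_base(1)[OF enclosed_closed_convex(1)[OF P(2)] E2(1,2) P(3) P'(1)])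
      moreover have "tube ?y C2 D2 P'"
        using tube_translate[OF E2(2) P'(3) P(1)] by (simp add: add.assoc add.commute[of \<xi>])
      from tube_base(2)[OF enclosed_closed_convex(1)[OF P'(2)] chamber_is_face[OF C2(1)] E2(2) this]
      have "eventually Q' (local_face ?y C2)" by (rule eventually_mono) (use P'(4) in blast)
      ultimately show ?thesis using P(4) by blast
    qed
    then show ?thesis
      using E2(3) C2(1) chimney_germ_below[OF C2 E2(2)] solid_germ_in_chart[OF B(1) c C2(1) E2(2)] by blast
  qed
  then obtain F2 F2' C2 where F2: "F = filtermap ?c F2" "F2 \<le> F2'" "C2 \<in> chambers M"
    "filtermap ?c F2' \<in> filters_in Iso B (closed_faces M) \<or>
       filtermap ?c F2' \<in> filters_in Iso B (solid_chimney_germs M)"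
    "\<And>Q Q'. eventually Q F2 \<Longrightarrow> eventually Q' F2' \<Longrightarrow> \<exists>y. Q y \<and> eventually Q' (local_face y C2)"
    by blast
  have aF: "filtermap a F0 = filtermap ?c F2" using Fa F2(1) by simp
  have "\<exists>g\<in>G. g \<circ> a \<in> Iso A' \<and> eventually (\<lambda>v. g (a v) = a v) (enclosure M (sup ?R F0))"
    by (rule move_MA4_chart[OF T A a(1) a'(1) ED(1,2) a'(2) B(1) c aF F2(2) B(2)[unfolded F2(1)] F2(4,3,5)])
  then show ?thesis
    unfolding Ra Fa filtermap_sup[symmetric] weyl_isomorphism_iff[OF A a(1)] enclosure_in_chart[OF A(1) a(1)]
    by (auto simp: eventually_filtermap)
qed

lemma strongly_transitive_if_transitive_on_charts:
  "transitive_on_charts \<Longrightarrow> strongly_transitive M \<A> Iso G"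
  unfolding strongly_transitive_def using move_MA2 move_MA4 by blast

end

theorem proposition4p7:
  fixes M :: "('i::finite, 'v::euclidean_space, 'g::real_vector) apartment_data"
    and \<Delta> :: "'d set" and \<A> :: "'d set set" and Iso :: "'d set \<Rightarrow> ('v \<Rightarrow> 'd) set"
    and G :: "('d \<Rightarrow> 'd) set"
  assumes "masure M \<Delta> \<A> Iso"
    and "automorphism_group M \<Delta> \<A> Iso G"
    and "\<And>g. g \<in> G \<Longrightarrow> vect_weyl_automorphism M \<A> Iso g"
  shows "(strongly_transitive M \<A> Iso G \<longleftrightarrow>
            (\<forall>A\<in>\<A>. \<forall>C\<in>filters_in Iso A (local_chambers M). friendly M \<A> Iso G C)) \<and>
         (strongly_transitive M \<A> Iso G \<longleftrightarrow>
            (\<forall>A\<in>\<A>. \<forall>S\<in>filters_in Iso A (sector_germs M). friendly M \<A> Iso G S))"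
proof -
  have model: "model_apartment M" using assms(1) unfolding masure_def by (rule conjunct1)
  interpret masure_group M \<Delta> \<A> Iso G
    by unfold_locales (use model assms in \<open>auto simp: model_apartment_def\<close>)
  show ?thesis
    using local_chambers_friendly sector_germs_friendly transitive_if_local_chambers_friendly
      transitive_if_sector_germs_friendly strongly_transitive_if_transitive_on_charts
    by blast
qed

end
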